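(* For any non-crossing partition $\sigma$ of $\{1,\dots,n\}$, the polynomial $$\ddddot{\Pr}(\sigma)=\sum_{\tau}\mathcal P_{\sigma,\tau}\,L_\tau ,$$ where the sum is over all partitions $\tau$ of $\{1,\dots,n\}$, is an irreducible polynomial in the $L_{i,j}$'s.
   Context: A partition of $\{1,\dots,n\}$ is crossing if there are $a<b<c<d$ with $a,c$ in one part and $b,d$ in a different part; otherwise it is non-crossing (equivalently, planar). Let $W_n$ be the vector space of formal linear combinations of partitions of $\{1,\dots,n\}$ and $U_n\subset W_n$ the subspace of formal linear combinations of planar partitions. Define a bilinear form on $W_n$ by: for partitions $\tau,\sigma$, $\langle\tau,\sigma\rangle=1$ if (1) the numbers of parts of $\tau$ and $\sigma$ add up to $n+1$, and (2) the transitive closure of the relation on $\{1,\dots,n\}$ defined by the union of $\tau$ and $\sigma$ has a single equivalence class; otherwise $\langle\tau,\sigma\rangle=0$. Let $K_n=\{w\in W_n:\langle w,w'\rangle=0\text{ for all }w'\in W_n\}$. It is known that $W_n=U_n\oplus K_n$. The matrix $\mathcal P=(\mathcal P_{\sigma,\tau})$, with $\sigma$ planar and $\tau$ an arbitrary partition, is the matrix of the projection of $W_n$ onto $U_n$ along $K_n$: $\tau-\sum_{\sigma\text{ planar}}\mathcal P_{\sigma,\tau}\,\sigma\in K_n$. It is known that its entries are integers. For variables $L_{i,j}=L_{j,i}$ ($i\ne j$, $1\le i,j\le n$) and a partition $\tau$ of $\{1,\dots,n\}$, set $L_\tau=\sum_F\prod_{\{i,j\}\in F}L_{i,j}$, where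 the sum is over the spanning forests $F$ of the complete graph on $\{1,\dots,n\}$ whose trees span the parts of $\tau$. Background: consider a finite planar graph with positive edge weights (conductances) and nodes $1,\dots,n$ in counterclockwise order on the outer face. A grove is a spanning forest each of whose component trees contains at least one node, taken with probability proportional to the product of its edge weights. When $L_{i,j}$ are the entries of the response matrix of this network, $\ddddot{\Pr}(\sigma)$ evaluates to $\Pr(\sigma)/\Pr(1|2|\cdots|n)$, where $\Pr(\sigma)$ is the probability that the component trees of a random grove partition the nodes according to $\sigma$.
   Formalization: The partition σ = 1|2|…|n is excluded: its polynomial is the constant 1, a unit, so it is not irreducible in the usual sense; every other non-crossing partition is covered. *)

theory Defs
  imports
    "HOL-Library.Poly_Mapping"
    "HOL-Library.Disjoint_Sets"
    "HOL-Computational_Algebra.Factorial_Ring"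
begin

section \<open>Partitions of the set of nodes\<close>

definition node_partitions :: "nat \<Rightarrow> nat set set set" where
  "node_partitions n = {\<tau>. partition_on {1..n} \<tau>}"

definition crossing :: "nat set set \<Rightarrow> bool" where
  "crossing \<tau> \<longleftrightarrow>
     (\<exists>A\<in>\<tau>. \<exists>B\<in>\<tau>. A \<noteq> B \<and>
        (\<exists>a b c d. a < b \<and> b < c \<and> c < d \<and> a \<in> A \<and> c \<in> A \<and> b \<in> B \<and> d \<in> B))"

definition planar_partitions :: "nat \<Rightarrow> nat set set set" where
  "planar_partitions n = {\<sigma> \<in> node_partitions n. \<not> crossing \<sigma>}"

text \<open>
  The partition \<open>1|2|\<dots>|n\<close>.  Its polynomial is the constant \<open>1\<close>, a unit, so
  irreducibility in the usual sense can only be claimed for the other planar partitions.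
\<close>

definition singletons_partition :: "nat \<Rightarrow> nat set set" where
  "singletons_partition n = (\<lambda>i. {i}) ` {1..n}"


section \<open>The bilinear form and the projection onto planar partitions\<close>

text \<open>
  Formal linear combinations of partitions are finitely supported functions on
  \<^typ>\<open>nat set set\<close>.  The coefficients range over an arbitrary integral domain of
  characteristic \<open>0\<close>, which covers the fields of rational, real and complex numbers and
  also (the matrix of the projection being integral) the ring of integers.
\<close>

definition W_space :: "nat \<Rightarrow> (nat set set \<Rightarrow>\<^sub>0 'a::{idom,ring_char_0}) set" where
  "W_space n = {w. Poly_Mapping.keys w \<subseteq> node_partitions n}"

definition same_part :: "nat set set \<Rightarrow> (nat \<times> nat) set" where
  "same_part \<tau> = {(i, j). \<exists>A\<in>\<tau>. i \<in> A \<and> j \<in> A}"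

definition partition_pairing :: "nat \<Rightarrow> nat set set \<Rightarrow> nat set set \<Rightarrow> 'a::{idom,ring_char_0}" where
  "partition_pairing n \<tau> \<sigma> =
     (if card \<tau> + card \<sigma> = n + 1 \<and>
         card ({1..n} // (same_part \<tau> \<union> same_part \<sigma>)\<^sup>+) = 1
      then 1 else 0)"

definition W_form ::
  "nat \<Rightarrow> (nat set set \<Rightarrow>\<^sub>0 'a) \<Rightarrow> (nat set set \<Rightarrow>\<^sub>0 'a) \<Rightarrow> 'a::{idom,ring_char_0}" where
  "W_form n w w' =
     (\<Sum>\<tau>\<in>Poly_Mapping.keys w. \<Sum>\<sigma>\<in>Poly_Mapping.keys w'.
        Poly_Mapping.lookup w \<tau> * Poly_Mapping.lookup w' \<sigma> * partition_pairing n \<tau> \<sigma>)"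

definition K_space :: "nat \<Rightarrow> (nat set set \<Rightarrow>\<^sub>0 'a::{idom,ring_char_0}) set" where
  "K_space n = {w \<in> W_space n. \<forall>w'\<in>W_space n. W_form n w w' = 0}"

text \<open>
  \<open>P \<sigma> \<tau>\<close> is the entry in row \<open>\<sigma>\<close> and column \<open>\<tau>\<close>; entries outside
  \<open>planar_partitions n \<times> node_partitions n\<close> are irrelevant and left unconstrained.  As
  the space of all combinations is the direct sum of the planar ones and \<open>K_space n\<close>
  (for \<open>n \<ge> 1\<close>), the relevant entries exist and are uniquely determined.
\<close>

definition is_planar_projection_matrix ::
  "nat \<Rightarrow> (nat set set \<Rightarrow> nat set set \<Rightarrow> 'a::{idom,ring_char_0}) \<Rightarrow> bool" where
  "is_planar_projection_matrix n P \<longleftrightarrow>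
     (\<forall>\<tau>\<in>node_partitions n.
        Poly_Mapping.single \<tau> 1 - (\<Sum>\<sigma>\<in>planar_partitions n. Poly_Mapping.single \<sigma> (P \<sigma> \<tau>))
          \<in> K_space n)"


section \<open>Spanning forests of the complete graph\<close>

text \<open>
  An edge \<open>{i, j}\<close> of the complete graph on \<open>{1..n}\<close> is represented by the pair
  \<open>(i, j)\<close> with \<open>i < j\<close>.
\<close>

definition complete_edges :: "nat \<Rightarrow> (nat \<times> nat) set" where
  "complete_edges n = {(i, j). 1 \<le> i \<and> i < j \<and> j \<le> n}"

definition has_cycle :: "(nat \<times> nat) set \<Rightarrow> bool" where
  "has_cycle F \<longleftrightarrow>
     (\<exists>vs. 3 \<le> length vs \<and> distinct vs \<and>
        (\<forall>k<length vs. (vs ! k, vs ! (Suc k mod length vs)) \<in> F \<union> F\<inverse>))"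

definition components :: "nat \<Rightarrow> (nat \<times> nat) set \<Rightarrow> nat set set" where
  "components n F = {1..n} // (F \<union> F\<inverse>)\<^sup>*"

definition forests_spanning :: "nat \<Rightarrow> nat set set \<Rightarrow> (nat \<times> nat) set set" where
  "forests_spanning n \<tau> = {F. F \<subseteq> complete_edges n \<and> \<not> has_cycle F \<and> components n F = \<tau>}"


section \<open>The polynomials\<close>

text \<open>
  Multivariate polynomials are finitely supported functions from monomials (exponent
  vectors) to coefficients.  The type provides a variable for every pair of naturals,
  whereas only those for pairs in \<open>complete_edges n\<close> are used.  The spare variables do
  not affect irreducibility: over a domain, the factors of a polynomial involve only
  variables that occur in it.
\<close>

type_synonym 'a L_poly = "((nat \<times> nat) \<Rightarrow>\<^sub>0 nat) \<Rightarrow>\<^sub>0 'a"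

definition L_var :: "nat \<Rightarrow> nat \<Rightarrow> 'a::{idom,ring_char_0} L_poly" where
  "L_var i j = Poly_Mapping.single (Poly_Mapping.single (min i j, max i j) 1) 1"

definition L_const :: "'a::{idom,ring_char_0} \<Rightarrow> 'a L_poly" where
  "L_const c = Poly_Mapping.single 0 c"

definition L_partition :: "nat \<Rightarrow> nat set set \<Rightarrow> 'a::{idom,ring_char_0} L_poly" where
  "L_partition n \<tau> = (\<Sum>F\<in>forests_spanning n \<tau>. \<Prod>(i, j)\<in>F. L_var i j)"

definition Pr_poly ::
  "nat \<Rightarrow> (nat set set \<Rightarrow> nat set set \<Rightarrow> 'a::{idom,ring_char_0}) \<Rightarrow> nat set set \<Rightarrow> 'a L_poly" where
  "Pr_poly n P \<sigma> = (\<Sum>\<tau>\<in>node_partitions n. L_const (P \<sigma> \<tau>) * L_partition n \<tau>)"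

end

theory Submission
  imports
    Defs
    "HOL-Combinatorics.Permutations"
    "HOL-Library.Product_Lexorder"
    "HOL-Library.Transitive_Closure_Table"
begin

text \<open>
  The coefficient of the monomial of a forest depends only on the partition \<open>\<tau>\<close> that
  the forest spans: it is \<open>P \<sigma> \<tau>\<close> (\<open>lookup_Pr_poly_forest\<close>). So
  the support of the polynomial is a union of complete families \<open>forests_spanning n
  \<tau>\<close>, and it is the support that shows irreducibility. Suppose the polynomial is \<open>f
  * g\<close> with neither factor a unit.

  All monomials are squarefree, so \<open>f\<close> and \<open>g\<close> have no variable in common
  (\<open>top_exponent_mult\<close>), and the forests in the support are exactly the unions of a
  monomial of \<open>f\<close> and a monomial of \<open>g\<close>
  (\<open>lookup_mult_disjoint_vars\<close>). Suppose that a variable \<open>ij\<close> of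
  \<open>f\<close> and a variable \<open>jk\<close> of \<open>g\<close> share the node
  \<open>j\<close>. Some forest of the support contains both; exchanging either edge for
  \<open>ik\<close> gives a forest that spans the same partition, hence again one of the support.
  Whether \<open>ik\<close> belongs to \<open>f\<close> or to \<open>g\<close>, recombining the
  factors yields a forest with the triangle \<open>ij\<close>, \<open>jk\<close>, \<open>ik\<close>,
  which is absurd (\<open>product_edges_no_common_vertex\<close>). Hence the nodes touched by
  \<open>f\<close> and by \<open>g\<close> are disjoint, and every part of a partition
  \<open>\<tau>\<close> with \<open>P \<sigma> \<tau> \<noteq> 0\<close> either consists of nodes
  touched by \<open>f\<close> or avoids them. As \<open>P \<sigma> \<sigma> = 1\<close> and the
  polynomial is homogeneous, there is on either side a part of \<open>\<sigma>\<close> with several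
  nodes. Let \<open>x\<close> and \<open>y\<close> be nodes of two such parts, on different sides and
  as close together as possible, and let \<open>\<tau>\<close> be \<open>\<sigma>\<close> with
  \<open>x\<close> and \<open>y\<close> transposed. Then \<open>P \<sigma> \<tau> = -1\<close>
  (\<open>swap_coefficient\<close>), although a part of \<open>\<tau>\<close> has nodes of both sides
  (\<open>support_not_product\<close>).

  The entries of \<open>P\<close> used here are known only because the planar partitions are linearly
  independent modulo the kernel of the form (\<open>planar_kernel_trivial\<close>): an identity
  between pairings then determines a column of \<open>P\<close> (\<open>projection_unique\<close>).
  The value \<open>-1\<close> comes from the skein relation \<open>12|34 + 13|24 + 14|23 = 1|234 +
  2|134 + 3|124 + 4|123\<close> (\<open>skein_pairing\<close>), in which all terms other than the
  transposed one are planar when \<open>x\<close> and \<open>y\<close> are neighbours.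

  For independence, the pairing of \<open>\<tau>\<close> with \<open>\<rho>\<close> is read as
  follows: it is \<open>1\<close> iff the edges of a forest spanning \<open>\<rho>\<close> form a
  spanning tree of the complete graph in which the parts of \<open>\<tau>\<close> are contracted. By
  the matrix-tree theorem these indicators are the coefficients of a reduced Laplacian determinant.
  Replacing every edge \<open>uv\<close> by the combination \<open>ur + vr - uv\<close>, with
  \<open>r\<close> the root, keeps only the off-diagonal entries of its Laplacian
  (\<open>signed_sum\<close>), and antisymmetrising over the ways to pair up two families of nodes
  leaves a functional that, up to a positive factor and a sign, asks whether each of the two families
  is a transversal of the parts not containing the root (\<open>signed_sum_pos\<close>,
  \<open>antisym_sum_nonzero\<close>). With the minima and the maxima of the parts of a planar
  partition as families, these functionals are triangular with respect to the sum of the lengths of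
  the parts (\<open>antisym_sum_triangular\<close>), because a planar partition is determined by its
  minima and maxima (\<open>planar_determined\<close>). All of this is carried out by contracting
  edges, without determinants.
\<close>

section \<open>Merging parts of a partition\<close>

text \<open>
  For a partition the union has one member, the part that contains \<open>u\<close>; the union makes
  the function total without a choice operator.
\<close>

definition blk :: "nat set set \<Rightarrow> nat \<Rightarrow> nat set" where
  "blk \<tau> u = \<Union> {X \<in> \<tau>. u \<in> X}"

definition merge :: "nat set set \<Rightarrow> nat \<Rightarrow> nat \<Rightarrow> nat set set" where
  "merge \<tau> u v = insert (blk \<tau> u \<union> blk \<tau> v) (\<tau> - {blk \<tau> u, blk \<tau> v})"

text \<open>
  A partition is handled through the two-valued functions that are constant on its parts. Joining
  nodes by parts, by edges or by both then means imposing more equations on such functions, and no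
  paths are needed.
\<close>

definition part_const :: "nat set set \<Rightarrow> (nat \<Rightarrow> bool) \<Rightarrow> bool" where
  "part_const \<tau> f \<longleftrightarrow> (\<forall>X\<in>\<tau>. \<forall>x\<in>X. \<forall>y\<in>X. f x = f y)"

definition edge_const :: "(nat \<times> nat) set \<Rightarrow> (nat \<Rightarrow> bool) \<Rightarrow> bool" where
  "edge_const E f \<longleftrightarrow> (\<forall>(u, v)\<in>E. f u = f v)"

text \<open>
  Connectedness of \<open>N\<close> under the identifications that \<open>Q\<close> imposes: there is
  no proper cut.
\<close>

definition joined :: "nat set \<Rightarrow> ((nat \<Rightarrow> bool) \<Rightarrow> bool) \<Rightarrow> bool" where
  "joined N Q \<longleftrightarrow> (\<forall>f. Q f \<longrightarrow> (\<forall>x\<in>N. \<forall>y\<in>N. f x = f y))"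

lemma joinedD: "joined N Q \<Longrightarrow> Q f \<Longrightarrow> x \<in> N \<Longrightarrow> y \<in> N \<Longrightarrow> f x = f y"
  unfolding joined_def by blast

lemma joinedI: "(\<And>f x y. Q f \<Longrightarrow> x \<in> N \<Longrightarrow> y \<in> N \<Longrightarrow> f x = f y) \<Longrightarrow> joined N Q"
  unfolding joined_def by blast

text \<open>
  The edges form a spanning tree of the graph whose vertices are the parts of \<open>\<tau>\<close>:
  one edge fewer than vertices, and connected.
\<close>

definition tree :: "nat set \<Rightarrow> nat set set \<Rightarrow> (nat \<times> nat) list \<Rightarrow> bool" where
  "tree N \<tau> es \<longleftrightarrow> card \<tau> = Suc (length es) \<and>
     joined N (\<lambda>f. part_const \<tau> f \<and> edge_const (set es) f)"

lemma part_constD: "part_const \<tau> f \<Longrightarrow> X \<in> \<tau> \<Longrightarrow> x \<in> X \<Longrightarrow> y \<in> X \<Longrightarrow> f x = f y"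
  unfolding part_const_def by blast

lemma blk_eq:
  assumes "partition_on N \<tau>" "X \<in> \<tau>" "u \<in> X"
  shows "blk \<tau> u = X"
proof -
  have "{Y \<in> \<tau>. u \<in> Y} = {X}"
    using assms by (auto simp: partition_on_def disjoint_def)
  then show ?thesis by (simp add: blk_def)
qed

lemma blk_mem:
  assumes "partition_on N \<tau>" "u \<in> N"
  shows "blk \<tau> u \<in> \<tau>" "u \<in> blk \<tau> u"
proof -
  obtain X where "X \<in> \<tau>" "u \<in> X"
    using assms by (auto simp: partition_on_def)
  then show "blk \<tau> u \<in> \<tau>" "u \<in> blk \<tau> u"
    using blk_eq[OF assms(1)] by auto
qed

lemma blk_subset: "partition_on N \<tau> \<Longrightarrow> X \<in> \<tau> \<Longrightarrow> X \<subseteq> N"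
  by (auto simp: partition_on_def)

lemma blk_eq_iff:
  assumes "partition_on N \<tau>" "u \<in> N" "v \<in> N"
  shows "blk \<tau> u = blk \<tau> v \<longleftrightarrow> v \<in> blk \<tau> u"
  using blk_mem[OF assms(1,2)] blk_mem[OF assms(1,3)] blk_eq[OF assms(1)] by metis

lemma part_const_iff_blk:
  assumes "partition_on N \<tau>"
  shows "part_const \<tau> f \<longleftrightarrow> (\<forall>x\<in>N. \<forall>y\<in>N. blk \<tau> x = blk \<tau> y \<longrightarrow> f x = f y)"
proof
  assume r: "part_const \<tau> f"
  show "\<forall>x\<in>N. \<forall>y\<in>N. blk \<tau> x = blk \<tau> y \<longrightarrow> f x = f y"
    using r blk_mem[OF assms] unfolding part_const_def by metis
next
  assume r: "\<forall>x\<in>N. \<forall>y\<in>N. blk \<tau> x = blk \<tau> y \<longrightarrow> f x = f y"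
  show "part_const \<tau> f"
    unfolding part_const_def
    using r blk_eq[OF assms] blk_subset[OF assms] by (metis subsetD)
qed

lemma merge_partition:
  assumes "partition_on N \<tau>" "u \<in> N" "v \<in> N"
  shows "partition_on N (merge \<tau> u v)"
proof -
  have d: "X \<inter> Y = {}" if "X \<in> \<tau>" "Y \<in> \<tau>" "X \<noteq> Y" for X Y
    using that assms(1) by (auto simp: partition_on_def disjoint_def)
  note b = blk_mem[OF assms(1,2)] blk_mem[OF assms(1,3)]
  have U: "\<Union>\<tau> = N" "{} \<notin> \<tau>" using assms(1) by (auto simp: partition_on_def)
  have "\<Union>(merge \<tau> u v) = N"
    using b U(1) unfolding merge_def by blast
  moreover have "disjoint (merge \<tau> u v)"
    unfolding merge_def disjoint_def using d b by blast
  moreover have "{} \<notin> merge \<tau> u v"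
    using U b unfolding merge_def by blast
  ultimately show ?thesis by (simp add: partition_on_def)
qed

lemma merge_card:
  assumes "finite N" "partition_on N \<tau>" "u \<in> N" "v \<in> N" "blk \<tau> u \<noteq> blk \<tau> v"
  shows "card \<tau> = Suc (card (merge \<tau> u v))"
proof -
  note b = blk_mem[OF assms(2,3)] blk_mem[OF assms(2,4)]
  have fin: "finite \<tau>" using finite_elements[OF assms(1,2)] .
  have "blk \<tau> u \<union> blk \<tau> v \<notin> \<tau>"
    using b blk_eq[OF assms(2)] assms(5) by (metis UnI1 UnI2)
  then have "card (merge \<tau> u v) = Suc (card (\<tau> - {blk \<tau> u, blk \<tau> v}))"
    unfolding merge_def using fin by (subst card_insert_disjoint) auto
  moreover have "card (\<tau> - {blk \<tau> u, blk \<tau> v}) = card \<tau> - 2"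
    using b fin assms(5) by (subst card_Diff_subset) auto
  moreover have "card \<tau> \<ge> 2"
    using card_mono[OF fin, of "{blk \<tau> u, blk \<tau> v}"] b assms(5) by auto
  ultimately show ?thesis by simp
qed

lemma blk_merge:
  assumes "partition_on N \<tau>" "u \<in> N" "v \<in> N" "w \<in> N"
  shows "blk (merge \<tau> u v) w =
    (if blk \<tau> w = blk \<tau> u \<or> blk \<tau> w = blk \<tau> v then blk \<tau> u \<union> blk \<tau> v else blk \<tau> w)"
proof -
  note p = merge_partition[OF assms(1-3)]
  note b = blk_mem[OF assms(1,4)]
  show ?thesis
  proof (cases "blk \<tau> w = blk \<tau> u \<or> blk \<tau> w = blk \<tau> v")
    case True
    have "blk (merge \<tau> u v) w = blk \<tau> u \<union> blk \<tau> v"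
      by (rule blk_eq[OF p]) (use b(2) True in \<open>auto simp: merge_def\<close>)
    then show ?thesis using True by simp
  next
    case False
    have "blk (merge \<tau> u v) w = blk \<tau> w"
      by (rule blk_eq[OF p]) (use b False in \<open>auto simp: merge_def\<close>)
    then show ?thesis using False by simp
  qed
qed

text \<open>
  Membership of two nodes in a common part of the merged partition, expressed through
  \<open>\<tau>\<close> alone; it makes all later case distinctions about contractions propositional.
\<close>

lemma blk_merge_eq_iff:
  assumes "partition_on N \<tau>" "u \<in> N" "v \<in> N" "w \<in> N" "w' \<in> N"
  shows "blk (merge \<tau> u v) w = blk (merge \<tau> u v) w' \<longleftrightarrow>
    blk \<tau> w = blk \<tau> w' \<or> (blk \<tau> w \<in> {blk \<tau> u, blk \<tau> v} \<and> blk \<tau> w' \<in> {blk \<tau> u, blk \<tau> v})"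
proof -
  have *: "blk \<tau> u \<union> blk \<tau> v = blk \<tau> x \<longleftrightarrow> blk \<tau> u = blk \<tau> v \<and> blk \<tau> x = blk \<tau> u" if "x \<in> N" for x
  proof
    assume a: "blk \<tau> u \<union> blk \<tau> v = blk \<tau> x"
    have "u \<in> blk \<tau> x" "v \<in> blk \<tau> x" using a blk_mem(2)[OF assms(1)] assms(2,3) by blast+
    then show "blk \<tau> u = blk \<tau> v \<and> blk \<tau> x = blk \<tau> u"
      using blk_eq_iff[OF assms(1) that] assms(2,3) by metis
  qed auto
  show ?thesis
  proof (cases "blk \<tau> w \<in> {blk \<tau> u, blk \<tau> v}"; cases "blk \<tau> w' \<in> {blk \<tau> u, blk \<tau> v}")
    assume "blk \<tau> w \<in> {blk \<tau> u, blk \<tau> v}" "blk \<tau> w' \<notin> {blk \<tau> u, blk \<tau> v}"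
    then show ?thesis
      using *[OF assms(5)] blk_merge[OF assms(1-3,4)] blk_merge[OF assms(1-3,5)] by (metis insert_iff)
  next
    assume "blk \<tau> w \<notin> {blk \<tau> u, blk \<tau> v}" "blk \<tau> w' \<in> {blk \<tau> u, blk \<tau> v}"
    then show ?thesis
      using *[OF assms(4)] blk_merge[OF assms(1-3,4)] blk_merge[OF assms(1-3,5)] by (metis insert_iff)
  qed (use blk_merge[OF assms(1-3,4)] blk_merge[OF assms(1-3,5)] in auto)
qed

lemma part_const_merge:
  assumes "partition_on N \<tau>" "u \<in> N" "v \<in> N"
  shows "part_const (merge \<tau> u v) f \<longleftrightarrow> part_const \<tau> f \<and> f u = f v"
proof
  note eq = blk_merge_eq_iff[OF assms]
  assume l: "part_const (merge \<tau> u v) f"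
  have same: "f x = f y" if "x \<in> N" "y \<in> N" "blk (merge \<tau> u v) x = blk (merge \<tau> u v) y" for x y
    using l that unfolding part_const_iff_blk[OF merge_partition[OF assms]] by blast
  have "part_const \<tau> f"
    unfolding part_const_iff_blk[OF assms(1)]
  proof (intro ballI impI)
    fix x y assume "x \<in> N" "y \<in> N" "blk \<tau> x = blk \<tau> y"
    then show "f x = f y" by (intro same) (simp_all add: eq)
  qed
  moreover have "f u = f v" by (intro same) (simp_all add: eq assms)
  ultimately show "part_const \<tau> f \<and> f u = f v" ..
next
  note eq = blk_merge_eq_iff[OF assms]
  assume r: "part_const \<tau> f \<and> f u = f v"
  have f: "f x = f y" if "x \<in> N" "y \<in> N" "blk \<tau> x = blk \<tau> y" for x y
    using r that unfolding part_const_iff_blk[OF assms(1)] by blast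
  have fu: "f x = f u" if "x \<in> N" "blk \<tau> x \<in> {blk \<tau> u, blk \<tau> v}" for x
    using that f[of x u] f[of x v] r assms(2,3) by auto
  show "part_const (merge \<tau> u v) f"
    unfolding part_const_iff_blk[OF merge_partition[OF assms]]
  proof (intro ballI impI)
    fix x y assume xy: "x \<in> N" "y \<in> N" "blk (merge \<tau> u v) x = blk (merge \<tau> u v) y"
    from xy(3)[unfolded eq[OF xy(1,2)]] show "f x = f y"
      using f[OF xy(1,2)] fu[OF xy(1)] fu[OF xy(2)] by (elim disjE conjE) simp_all
  qed
qed

lemma edge_const_iff: "edge_const E f \<longleftrightarrow> (\<forall>u v. (u, v) \<in> E \<longrightarrow> f u = f v)"
  unfolding edge_const_def by fast

lemma edge_const_Cons [simp]:
  "edge_const (insert (u, v) E) f \<longleftrightarrow> f u = f v \<and> edge_const E f"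
  by (auto simp: edge_const_def)

lemma edge_const_empty [simp]: "edge_const {} f"
  by (simp add: edge_const_def)

text \<open>
  Adding an edge merges at most two parts, so connecting \<open>k\<close> parts takes at least
  \<open>k - 1\<close> edges.
\<close>

lemma card_le_of_connected:
  assumes "finite N" "partition_on N \<tau>" "fst ` set es \<subseteq> N" "snd ` set es \<subseteq> N"
    and "joined N (\<lambda>f. part_const \<tau> f \<and> edge_const (set es) f)"
  shows "card \<tau> \<le> Suc (length es)"
  using assms(2-5)
proof (induction es arbitrary: \<tau>)
  case Nil
  have "X = Y" if XY: "X \<in> \<tau>" "Y \<in> \<tau>" for X Y
  proof -
    obtain x y where xy: "x \<in> X" "y \<in> Y"
      using XY Nil(1) by (metis equals0I partition_on_def)
    have "part_const \<tau> (\<lambda>z. z \<in> X)"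
      using XY(1) blk_eq[OF Nil(1)] unfolding part_const_def by metis
    then have "x \<in> X \<longleftrightarrow> y \<in> X"
      by (intro joinedD[OF Nil(4), of "\<lambda>z. z \<in> X"])
        (use xy XY blk_subset[OF Nil(1)] in auto)
    then show "X = Y" using xy XY blk_eq[OF Nil(1)] by metis
  qed
  then show ?case
    by (metis card_le_Suc0_iff_eq assms(1) Nil(1) finite_elements list.size(3))
next
  case (Cons e es)
  obtain u v where e: "e = (u, v)" by force
  have uv: "u \<in> N" "v \<in> N" using Cons(3,4) e by auto
  have "joined N (\<lambda>f. part_const (merge \<tau> u v) f \<and> edge_const (set es) f)"
    using Cons(5) by (simp add: part_const_merge[OF Cons(2) uv] e conj_ac)
  then have "card (merge \<tau> u v) \<le> Suc (length es)"
    using Cons(3,4) by (intro Cons.IH merge_partition Cons uv) auto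
  moreover have "card \<tau> \<le> Suc (card (merge \<tau> u v))"
  proof (cases "blk \<tau> u = blk \<tau> v")
    case True
    then have "merge \<tau> u v = \<tau>" using blk_mem[OF Cons(2) uv(1)] by (auto simp: merge_def)
    then show ?thesis by simp
  next
    case False
    then show ?thesis using merge_card[OF assms(1) Cons(2) uv] by simp
  qed
  ultimately show ?case by simp
qed

text \<open>
  Contraction of an edge, the recursion behind all that follows. A loop cannot occur in a tree,
  because the other edges would have to connect all parts while being one too few.
\<close>

lemma tree_Cons:
  assumes "finite N" "partition_on N \<tau>" "u \<in> N" "v \<in> N" "set es \<subseteq> N \<times> N"
  shows "tree N \<tau> ((u, v) # es) \<longleftrightarrow> blk \<tau> u \<noteq> blk \<tau> v \<and> tree N (merge \<tau> u v) es"
proof (cases "blk \<tau> u = blk \<tau> v")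
  case True
  then have uv: "f u = f v" if "part_const \<tau> f" for f
    using that part_const_iff_blk[OF assms(2)] assms(3,4) by blast
  have "\<not> tree N \<tau> ((u, v) # es)"
  proof
    assume t: "tree N \<tau> ((u, v) # es)"
    have "card \<tau> \<le> Suc (length es)"
    proof (rule card_le_of_connected[OF assms(1,2)])
      have "part_const \<tau> f \<and> f u = f v \<and> edge_const (set es) f \<longleftrightarrow> part_const \<tau> f \<and> edge_const (set es) f" for f
        using uv by blast
      then show "joined N (\<lambda>f. part_const \<tau> f \<and> edge_const (set es) f)"
        using t by (simp add: tree_def)
    qed (use assms(5) in auto)
    with t show False by (simp add: tree_def)
  qed
  with True show ?thesis by simp
next
  case False
  then have "card \<tau> = Suc (card (merge \<tau> u v))"
    by (rule merge_card[OF assms(1-4)])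
  with False show ?thesis
    by (simp add: tree_def part_const_merge[OF assms(2-4)] conj_ac)
qed

lemma tree_cong: "mset es = mset es' \<Longrightarrow> tree N \<tau> es = tree N \<tau> es'"
proof -
  assume m: "mset es = mset es'"
  show ?thesis unfolding tree_def mset_eq_length[OF m] mset_eq_setD[OF m] by (rule refl)
qed

lemma tree_Nil:
  assumes "partition_on N \<tau>"
  shows "tree N \<tau> [] \<longleftrightarrow> card \<tau> = 1"
proof
  assume c: "card \<tau> = 1"
  then obtain X where "\<tau> = {X}" by (metis card_1_singletonE)
  then have "\<tau> = {N}" using assms by (auto simp: partition_on_def)
  then have "joined N (\<lambda>f. part_const \<tau> f \<and> edge_const (set []) f)"
  proof (intro joinedI, elim conjE)
    fix f x y assume "part_const \<tau> f" "x \<in> N" "y \<in> N"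
    then show "f x = f y" by (intro part_constD[of \<tau> f N]) (simp_all add: \<open>\<tau> = {N}\<close>)
  qed
  then show "tree N \<tau> []" using c by (simp add: tree_def)
qed (simp add: tree_def)

section \<open>The bilinear form counts trees\<close>

text \<open>
  The transitive closure in the definition of the form has one class iff no proper cut respects both
  partitions.
\<close>

lemma connected_pairing_iff:
  assumes "N \<noteq> {}" "partition_on N \<tau>" "partition_on N \<rho>"
  shows "card (N // (same_part \<tau> \<union> same_part \<rho>)\<^sup>+) = 1 \<longleftrightarrow>
    joined N (\<lambda>f. part_const \<tau> f \<and> part_const \<rho> f)"
    (is "card (N // ?R) = 1 \<longleftrightarrow> ?C")
proof -
  let ?r = "same_part \<tau> \<union> same_part \<rho>"
  have sub: "?r \<subseteq> N \<times> N"
    using blk_subset[OF assms(2)] blk_subset[OF assms(3)] by (auto simp: same_part_def)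
  have R_sub: "?R \<subseteq> N \<times> N" by (rule trancl_subset_Sigma[OF sub])
  have symr: "sym ?r" by (auto simp: sym_def same_part_def)
  have refl: "(x, x) \<in> ?R" if "x \<in> N" for x
  proof -
    have "(x, x) \<in> same_part \<tau>"
      using blk_mem[OF assms(2) that] by (auto simp: same_part_def)
    then show ?thesis by (intro r_into_trancl) simp
  qed
  have eq: "equiv N ?R"
  proof (rule equivI)
    show "refl_on N ?R" using R_sub refl by (simp add: refl_on_def)
  qed (use R_sub symr in \<open>simp_all add: sym_trancl\<close>)
  have inv: "f x = f y" if "(x, y) \<in> ?R" "part_const \<tau> f" "part_const \<rho> f" for f x y
  proof -
    have step: "f a = f b" if "(a, b) \<in> ?r" for a b
      using that \<open>part_const \<tau> f\<close> \<open>part_const \<rho> f\<close>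
      by (auto simp: same_part_def dest: part_constD)
    from that(1) show ?thesis by induction (simp_all add: step)
  qed
  show ?thesis
  proof
    assume c: "card (N // ?R) = 1"
    then obtain Z where Z: "N // ?R = {Z}" by (auto simp: card_1_singleton_iff)
    show ?C
    proof (rule joinedI)
      fix f x y assume f: "part_const \<tau> f \<and> part_const \<rho> f" and xy: "x \<in> N" "y \<in> N"
      have "?R `` {x} \<in> N // ?R" "?R `` {y} \<in> N // ?R" using xy by (auto intro: quotientI)
      then have "?R `` {x} = ?R `` {y}" using Z by auto
      then have "(x, y) \<in> ?R" using eq xy by (metis equiv_class_self Image_singleton_iff)
      then show "f x = f y" using inv f by blast
    qed
  next
    assume C: ?C
    obtain x where x: "x \<in> N" using assms(1) by blast
    have resp: "part_const \<tau> (\<lambda>z. (x, z) \<in> ?R)" "part_const \<rho> (\<lambda>z. (x, z) \<in> ?R)"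
      unfolding part_const_def
      by (intro ballI iffI; erule trancl_into_trancl; auto simp: same_part_def)+
    have all: "(x, y) \<in> ?R" if "y \<in> N" for y
      using joinedD[OF C, of "\<lambda>z. (x, z) \<in> ?R" x y] resp x that refl[OF x] by blast
    have "N // ?R = {?R `` {x}}"
    proof -
      have "N // ?R = (\<lambda>y. ?R `` {y}) ` N" unfolding quotient_def by blast
      also have "\<dots> = (\<lambda>y. ?R `` {x}) ` N"
        by (rule image_cong) (simp_all add: equiv_class_eq[OF eq all])
      also have "\<dots> = {?R `` {x}}" using x by blast
      finally show ?thesis .
    qed
    then show "card (N // ?R) = 1" by simp
  qed
qed

text \<open>
  A partition can be recovered from its cuts, since the indicator functions of its parts are among
  them.
\<close>

lemma part_const_determines:
  assumes "partition_on N \<tau>" "partition_on N \<rho>" "\<And>f. part_const \<tau> f = part_const \<rho> f"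
  shows "\<tau> = \<rho>"
proof -
  have *: "blk \<rho> u = blk \<rho> v"
    if p: "partition_on N \<tau>" "partition_on N \<rho>" "\<And>f. part_const \<tau> f = part_const \<rho> f" 
      and uv: "u \<in> N" "v \<in> N" "blk \<tau> u = blk \<tau> v" for \<tau> \<rho> u v
  proof -
    have "part_const \<rho> (\<lambda>z. z \<in> blk \<rho> u)"
      using blk_eq[OF p(2)] blk_mem[OF p(2) uv(1)] unfolding part_const_def by metis
    then have "part_const \<tau> (\<lambda>z. z \<in> blk \<rho> u)" using p(3) by simp
    then have "u \<in> blk \<rho> u \<longleftrightarrow> v \<in> blk \<rho> u"
      using uv unfolding part_const_iff_blk[OF p(1)] by blast
    then show ?thesis using blk_eq_iff[OF p(2) uv(1,2)] blk_mem[OF p(2) uv(1)] by simp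
  qed
  have iff: "blk \<tau> u = blk \<tau> v \<longleftrightarrow> blk \<rho> u = blk \<rho> v" if "u \<in> N" "v \<in> N" for u v
    using *[OF assms that] *[OF assms(2,1) assms(3)[symmetric] that] by blast
  have beq: "blk \<tau> u = blk \<rho> u" if "u \<in> N" for u
  proof -
    have "v \<in> blk \<tau> u \<longleftrightarrow> v \<in> blk \<rho> u" if v: "v \<in> N" for v
      using iff[OF \<open>u \<in> N\<close> v] blk_eq_iff[OF assms(1) \<open>u \<in> N\<close> v] blk_eq_iff[OF assms(2) \<open>u \<in> N\<close> v]
      by simp
    moreover have "blk \<tau> u \<subseteq> N" "blk \<rho> u \<subseteq> N"
      using blk_mem(1)[OF assms(1) that] blk_mem(1)[OF assms(2) that]
        blk_subset[OF assms(1)] blk_subset[OF assms(2)] by auto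
    ultimately show ?thesis by blast
  qed
  have img: "\<tau> = blk \<tau> ` N" if p: "partition_on N \<tau>" for \<tau>
  proof -
    have "X \<in> blk \<tau> ` N" if "X \<in> \<tau>" for X
    proof -
      have "X \<noteq> {}" using that p unfolding partition_on_def by blast
      then obtain x where "x \<in> X" by blast
      then have "blk \<tau> x = X" "x \<in> N"
        using blk_eq[OF p that] blk_subset[OF p that] by blast+
      then show ?thesis by blast
    qed
    moreover have "blk \<tau> ` N \<subseteq> \<tau>" using blk_mem(1)[OF p] by (rule image_subsetI)
    ultimately show ?thesis by blast
  qed
  have "\<tau> = blk \<tau> ` N" by (rule img[OF assms(1)])
  also have "\<dots> = blk \<rho> ` N" by (rule image_cong) (simp_all add: beq)
  also have "\<dots> = \<rho>" by (rule img[OF assms(2), symmetric])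
  finally show ?thesis .
qed

primrec edge_part :: "nat set \<Rightarrow> (nat \<times> nat) list \<Rightarrow> nat set set" where
  "edge_part N [] = (\<lambda>i. {i}) ` N"
| "edge_part N (e # es) = merge (edge_part N es) (fst e) (snd e)"

lemma edge_part_partition:
  "set es \<subseteq> N \<times> N \<Longrightarrow> partition_on N (edge_part N es)"
  by (induction es) (auto intro: partition_on_singletons merge_partition)

lemma part_const_edge_part:
  "set es \<subseteq> N \<times> N \<Longrightarrow> part_const (edge_part N es) f \<longleftrightarrow> edge_const (set es) f"
proof (induction es)
  case Nil
  then show ?case by (auto simp: part_const_def)
next
  case (Cons e es)
  then show ?case
    using part_const_merge[OF edge_part_partition[of es N]] by (cases e) auto
qed

lemma merge_same:
  assumes "partition_on N \<tau>" "u \<in> N" "blk \<tau> u = blk \<tau> v"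
  shows "merge \<tau> u v = \<tau>"
  using blk_mem[OF assms(1,2)] assms(3) by (auto simp: merge_def)

text \<open>
  Either every edge merges two parts, and the list is a forest, or some edge joins two nodes that the
  other edges already connect.
\<close>

lemma edge_part_card_or_redundant:
  assumes "finite N" "set es \<subseteq> N \<times> N"
  shows "card (edge_part N es) + length es = card N \<or>
    (\<exists>xs e ys. es = xs @ e # ys \<and> (\<forall>f. edge_const (set (xs @ ys)) f \<longrightarrow> f (fst e) = f (snd e)))"
  using assms(2)
proof (induction es)
  case Nil
  then show ?case by (simp add: card_image)
next
  case (Cons e es)
  have es: "set es \<subseteq> N \<times> N" and e: "fst e \<in> N" "snd e \<in> N" using Cons(2) by auto
  note p = edge_part_partition[OF es]
  consider (r) xs e' ys where "es = xs @ e' # ys"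
      "\<And>f. edge_const (set (xs @ ys)) f \<longrightarrow> f (fst e') = f (snd e')"
    | (same) "blk (edge_part N es) (fst e) = blk (edge_part N es) (snd e)"
    | (new) "blk (edge_part N es) (fst e) \<noteq> blk (edge_part N es) (snd e)"
      "card (edge_part N es) + length es = card N"
    using Cons.IH[OF es] by blast
  then show ?case
  proof cases
    case r
    then have "e # es = (e # xs) @ e' # ys" by simp
    moreover have "\<forall>f. edge_const (set ((e # xs) @ ys)) f \<longrightarrow> f (fst e') = f (snd e')"
      using r(2) by (cases e) auto
    ultimately show ?thesis by blast
  next
    case same
    have "f (fst e) = f (snd e)" if "edge_const (set es) f" for f
      using same e that unfolding part_const_edge_part[OF es, symmetric] part_const_iff_blk[OF p] by blast
    then show ?thesis by (metis append_Nil)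
  next
    case new
    then show ?thesis using merge_card[OF assms(1) p e] by simp
  qed
qed

text \<open>
  The pairing as a proposition: the graph on the parts of \<open>\<tau>\<close> and of
  \<open>\<rho>\<close>, with one edge for each node, is a tree.
\<close>

definition tree_pair :: "nat \<Rightarrow> nat set set \<Rightarrow> nat set set \<Rightarrow> bool" where
  "tree_pair n \<tau> \<rho> \<longleftrightarrow> card \<tau> + card \<rho> = n + 1 \<and>
    joined {1..n} (\<lambda>f. part_const \<tau> f \<and> part_const \<rho> f)"

lemma partition_pairing_eq:
  assumes "n \<ge> 1" "\<tau> \<in> node_partitions n" "\<rho> \<in> node_partitions n"
  shows "partition_pairing n \<tau> \<rho> = of_bool (tree_pair n \<tau> \<rho>)"
  using connected_pairing_iff[of "{1..n}" \<tau> \<rho>] assms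
  by (simp add: partition_pairing_def tree_pair_def node_partitions_def)

text \<open>
  For a forest of edges, contracting the parts of \<open>\<tau>\<close> leaves a tree iff
  \<open>\<tau>\<close> pairs to \<open>1\<close> with the partition that the forest spans.
\<close>

lemma tree_eq_tree_pair:
  assumes "set es \<subseteq> {1..n} \<times> {1..n}" "card (edge_part {1..n} es) + length es = n"
  shows "tree {1..n} \<tau> es = tree_pair n \<tau> (edge_part {1..n} es)"
  unfolding tree_def tree_pair_def part_const_edge_part[OF assms(1)] using assms(2) by auto

text \<open>
  Every functional \<open>\<tau> \<mapsto> tree \<tau> es\<close> is a pairing with some partition or
  vanishes: if the list contains a redundant edge, the remaining edges would connect too many parts.
  Hence elements of the kernel are killed by all tree functionals.
\<close>

lemma tree_functional:
  assumes "set es \<subseteq> {1..n} \<times> {1..n}"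
  shows "(\<exists>\<rho>\<in>node_partitions n. \<forall>\<tau>\<in>node_partitions n. tree {1..n} \<tau> es = tree_pair n \<tau> \<rho>) \<or>
    (\<forall>\<tau>\<in>node_partitions n. \<not> tree {1..n} \<tau> es)"
  using edge_part_card_or_redundant[OF finite_atLeastAtMost assms]
proof (elim disjE)
  assume c: "card (edge_part {1..n} es) + length es = card {1..n}" 
  then have "tree {1..n} \<tau> es = tree_pair n \<tau> (edge_part {1..n} es)" for \<tau>
    using tree_eq_tree_pair[OF assms] by simp
  moreover have "edge_part {1..n} es \<in> node_partitions n"
    using edge_part_partition[OF assms] by (simp add: node_partitions_def)
  ultimately show ?thesis by blast
next
  assume "\<exists>xs e ys. es = xs @ e # ys \<and> (\<forall>f. edge_const (set (xs @ ys)) f \<longrightarrow> f (fst e) = f (snd e))"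
  then obtain xs e ys where es: "es = xs @ e # ys"
    and r: "\<And>f. edge_const (set (xs @ ys)) f \<Longrightarrow> f (fst e) = f (snd e)" by blast
  have "\<not> tree {1..n} \<tau> es" if "\<tau> \<in> node_partitions n" for \<tau>
  proof
    assume t: "tree {1..n} \<tau> es"
    have p: "partition_on {1..n} \<tau>" using that by (simp add: node_partitions_def)
    have "card \<tau> \<le> Suc (length (xs @ ys))"
    proof (rule card_le_of_connected[OF _ p])
      have "edge_const (set (xs @ ys)) f = edge_const (set es) f" for f
        using r[of f] es by (auto simp: edge_const_def)
      then show "joined {1..n} (\<lambda>f. part_const \<tau> f \<and> edge_const (set (xs @ ys)) f)"
        using t by (simp add: tree_def)
    qed (use assms es in auto)
    then show False using t es by (simp add: tree_def)
  qed
  then show ?thesis by blast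
qed

text \<open>
  A list of edges of minimal length among those that generate \<open>\<rho>\<close> has no redundant
  edge.
\<close>

lemma exists_forest_list:
  assumes "finite N" "partition_on N \<rho>"
  shows "\<exists>es. set es \<subseteq> N \<times> N \<and> edge_part N es = \<rho> \<and> card \<rho> + length es = card N"
proof -
  have fin: "finite (N \<times> N)" using assms(1) by simp
  let ?S = "{(u, v) \<in> N \<times> N. blk \<rho> u = blk \<rho> v}"
  have "finite ?S" by (rule finite_subset[OF _ fin]) auto
  from finite_list[OF this] obtain es0 where es0: "set es0 = ?S" ..
  \<comment> \<open>Some list generates \<open>\<rho>\<close>, for instance that of all pairs of nodes in a common part.\<close>
  define P where "P es \<longleftrightarrow> set es \<subseteq> N \<times> N \<and> (\<forall>f. edge_const (set es) f = part_const \<rho> f)" for es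
  have "edge_const ?S f = part_const \<rho> f" for f
    unfolding part_const_iff_blk[OF assms(2)] edge_const_iff mem_Collect_eq mem_Sigma_iff case_prod_conv
      Ball_def
    by meson
  then have "P es0"
    unfolding P_def es0 by auto
  then obtain es where es: "P es" and min: "\<And>es'. P es' \<Longrightarrow> length es \<le> length es'"
    using ex_has_least_nat[of P es0 length] by blast
  have sub: "set es \<subseteq> N \<times> N" using es by (simp add: P_def)
  have eq: "edge_part N es = \<rho>"
    using part_const_determines[OF edge_part_partition[OF sub] assms(2)] es part_const_edge_part[OF sub]
    by (simp add: P_def)
  have "\<not> (\<exists>xs e ys. es = xs @ e # ys \<and> (\<forall>f. edge_const (set (xs @ ys)) f \<longrightarrow> f (fst e) = f (snd e)))"
  proof
    assume "\<exists>xs e ys. es = xs @ e # ys \<and> (\<forall>f. edge_const (set (xs @ ys)) f \<longrightarrow> f (fst e) = f (snd e))"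
    then obtain xs e ys where e: "es = xs @ e # ys"
      and r: "\<And>f. edge_const (set (xs @ ys)) f \<Longrightarrow> f (fst e) = f (snd e)" by blast
    have "edge_const (set (xs @ ys)) f = edge_const (set es) f" for f
      using r[of f] e by (auto simp: edge_const_def)
    then have "P (xs @ ys)" using es e by (auto simp: P_def)
    from min[OF this] show False using e by simp
  qed
  then have "card (edge_part N es) + length es = card N"
    using edge_part_card_or_redundant[OF assms(1) sub] by blast
  then show ?thesis using sub eq by blast
qed

section \<open>Four nodes joined by two edges\<close>

lemma tree_two_edges:
  assumes "finite N" "partition_on N \<pi>" "p \<in> N" "q \<in> N" "r \<in> N" "s \<in> N"
  shows "tree N \<pi> [(p, q), (r, s)] \<longleftrightarrow> card \<pi> = 3 \<and> blk \<pi> p \<noteq> blk \<pi> q \<and> blk \<pi> r \<noteq> blk \<pi> s \<and>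
    {blk \<pi> p, blk \<pi> q} \<noteq> {blk \<pi> r, blk \<pi> s}"
proof -
  note m = merge_partition[OF assms(2-4)]
  have aux: "R \<noteq> S \<and> {A, B} \<noteq> {R, S} \<longleftrightarrow> \<not> (R = S \<or> (R \<in> {A, B} \<and> S \<in> {A, B}))"
    if "A \<noteq> B" for A B R S :: "nat set"
    using that by (auto simp: doubleton_eq_iff)
  have "tree N \<pi> [(p, q), (r, s)] \<longleftrightarrow> blk \<pi> p \<noteq> blk \<pi> q \<and>
      blk (merge \<pi> p q) r \<noteq> blk (merge \<pi> p q) s \<and> card (merge (merge \<pi> p q) r s) = 1"
    using assms m by (simp add: tree_Cons tree_Nil merge_partition)
  also have "\<dots> \<longleftrightarrow> blk \<pi> p \<noteq> blk \<pi> q \<and>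
      blk (merge \<pi> p q) r \<noteq> blk (merge \<pi> p q) s \<and> card \<pi> = 3"
    using merge_card[OF assms(1-4)] merge_card[OF assms(1) m assms(5,6)]
    by (intro conj_cong refl) simp
  also have "\<dots> \<longleftrightarrow> card \<pi> = 3 \<and> blk \<pi> p \<noteq> blk \<pi> q \<and>
      (blk \<pi> r \<noteq> blk \<pi> s \<and> {blk \<pi> p, blk \<pi> q} \<noteq> {blk \<pi> r, blk \<pi> s})"
    unfolding blk_merge_eq_iff[OF assms(2-6)] using aux by blast
  finally show ?thesis .
qed

abbreviation tr :: "nat set \<Rightarrow> nat set set \<Rightarrow> (nat \<times> nat) list \<Rightarrow> int" where
  "tr N \<tau> es \<equiv> of_bool (tree N \<tau> es)"

text \<open>
  The relation \<open>12|34 + 13|24 + 14|23 = 1|234 + 2|134 + 3|124 + 4|123\<close>, where the joining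
  of \<open>a\<close>, \<open>b\<close>, \<open>c\<close>, \<open>d\<close> is expressed by adding two
  edges to a common list. As these are arbitrary nodes, contracting the edges of \<open>es\<close>
  preserves the statement, and only the case of three parts remains, in which two of the four nodes
  lie in the same part.
\<close>

lemma skein_tree:
  assumes "finite N" "partition_on N \<pi>" "a \<in> N" "b \<in> N" "c \<in> N" "d \<in> N" "set es \<subseteq> N \<times> N"
  shows "tr N \<pi> ((a, b) # (c, d) # es) + tr N \<pi> ((a, c) # (b, d) # es) + tr N \<pi> ((a, d) # (b, c) # es) =
    tr N \<pi> ((b, c) # (c, d) # es) + tr N \<pi> ((a, c) # (c, d) # es) +
    tr N \<pi> ((a, b) # (b, d) # es) + tr N \<pi> ((a, b) # (b, c) # es)"
  using assms(2,7)
proof (induction es arbitrary: \<pi>)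
  case Nil
  note t = tree_two_edges[OF assms(1) Nil(1)]
  show ?case
  proof (cases "card \<pi> = 3")
    case True
    let ?A = "blk \<pi> a" and ?B = "blk \<pi> b" and ?C = "blk \<pi> c" and ?D = "blk \<pi> d"
    have "{?A, ?B, ?C, ?D} \<subseteq> \<pi>" using blk_mem(1)[OF Nil(1)] assms(3-6) by simp
    then have "card {?A, ?B, ?C, ?D} \<le> 3"
      using True by (metis card_mono card.infinite zero_neq_numeral)
    then have "?A = ?B \<or> ?A = ?C \<or> ?A = ?D \<or> ?B = ?C \<or> ?B = ?D \<or> ?C = ?D"
      by (auto simp: card_insert_if split: if_splits)
    then show ?thesis
      unfolding t[OF assms(3,4,5,6)] t[OF assms(3,5,4,6)] t[OF assms(3,6,4,5)] t[OF assms(4,5,5,6)]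
        t[OF assms(3,5,5,6)] t[OF assms(3,4,4,6)] t[OF assms(3,4,4,5)] True doubleton_eq_iff
      by (elim disjE; simp; cases "?A = ?C"; cases "?A = ?D"; cases "?C = ?D"; cases "?B = ?C"; cases "?B = ?D"; simp)
  next
    case False
    then show ?thesis by (simp add: t assms)
  qed
next
  case (Cons e es)
  obtain u v where e: "e = (u, v)" by force
  have uv: "u \<in> N" "v \<in> N" "set es \<subseteq> N \<times> N" using Cons(3) e by auto
  have m: "tree N \<pi> (x # y # e # es) \<longleftrightarrow> blk \<pi> u \<noteq> blk \<pi> v \<and> tree N (merge \<pi> u v) (x # y # es)"
    if "x \<in> N \<times> N" "y \<in> N \<times> N" for x y
    using tree_cong[of "x # y # e # es" "e # x # y # es" N \<pi>] that uv
      tree_Cons[OF assms(1) Cons(2) uv(1,2), of "x # y # es"] by (simp add: e)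
  show ?case
    using Cons.IH[OF merge_partition[OF Cons(2) uv(1,2)] uv(3)] assms(3-6)
    by (cases "blk \<pi> u = blk \<pi> v") (simp_all add: m)
qed

section \<open>Polarising the tree indicator\<close>

text \<open>
  Each pair \<open>(u, v)\<close> of the first list stands for the formal combination \<open>ur + vr -
  uv\<close> of edges, and the second list contains the edges chosen so far. The reduced Laplacians of
  these three edges, with root \<open>r\<close>, combine to the sum of the matrix units at \<open>(u,
  v)\<close> and \<open>(v, u)\<close>: the off-diagonal entries are isolated.
\<close>

fun signed_sum :: "nat set \<Rightarrow> nat \<Rightarrow> nat set set \<Rightarrow> (nat \<times> nat) list \<Rightarrow> (nat \<times> nat) list \<Rightarrow> int" where
  "signed_sum N r \<tau> [] es = tr N \<tau> es"
| "signed_sum N r \<tau> ((u, v) # ps) es =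
     signed_sum N r \<tau> ps ((u, r) # es) + signed_sum N r \<tau> ps ((v, r) # es) - signed_sum N r \<tau> ps ((u, v) # es)"

lemma signed_sum_cong_edges:
  "mset es = mset es' \<Longrightarrow> signed_sum N r \<tau> ps es = signed_sum N r \<tau> ps es'"
proof (induction ps arbitrary: es es')
  case Nil
  then show ?case by (simp add: tree_cong[OF Nil])
next
  case (Cons p ps)
  obtain u v where p: "p = (u, v)" by force
  have "signed_sum N r \<tau> ps (x # es) = signed_sum N r \<tau> ps (x # es')" for x
    by (rule Cons.IH) (simp add: Cons.prems)
  then show ?case by (simp add: p)
qed

lemma signed_sum_swap: "signed_sum N r \<tau> (p # q # ps) es = signed_sum N r \<tau> (q # p # ps) es"
proof -
  have c: "signed_sum N r \<tau> ps (x # y # es) = signed_sum N r \<tau> ps (y # x # es)" for x y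
    by (rule signed_sum_cong_edges) simp
  obtain u v where p: "p = (u, v)" by force
  obtain a b where q: "q = (a, b)" by force
  show ?thesis
    by (simp add: p q c[of "(u, r)" "(a, r)"] c[of "(u, r)" "(b, r)"] c[of "(u, r)" "(a, b)"]
        c[of "(v, r)" "(a, r)"] c[of "(v, r)" "(b, r)"] c[of "(v, r)" "(a, b)"]
        c[of "(u, v)" "(a, r)"] c[of "(u, v)" "(b, r)"] c[of "(u, v)" "(a, b)"])
qed

lemma signed_sum_Cons_cong:
  assumes "\<And>es. signed_sum N r \<tau> ps es = signed_sum N r \<tau> ps' es"
  shows "signed_sum N r \<tau> (p # ps) es = signed_sum N r \<tau> (p # ps') es"
  by (cases p) (simp add: assms)

lemma signed_sum_move: "signed_sum N r \<tau> (xs @ p # ys) es = signed_sum N r \<tau> (p # xs @ ys) es"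
proof (induction xs arbitrary: es)
  case Nil
  show ?case by simp
next
  case (Cons x xs)
  have "signed_sum N r \<tau> ((x # xs) @ p # ys) es = signed_sum N r \<tau> (x # p # xs @ ys) es"
    using signed_sum_Cons_cong[OF Cons.IH] by simp
  then show ?case using signed_sum_swap[of N r \<tau> x p] by simp
qed

lemma signed_sum_cong_pairs:
  "mset ps = mset ps' \<Longrightarrow> signed_sum N r \<tau> ps es = signed_sum N r \<tau> ps' es"
proof (induction ps arbitrary: ps' es)
  case Nil
  then show ?case by simp
next
  case (Cons p ps)
  have "p \<in> set ps'" using Cons.prems by (metis list.set_intros(1) mset_eq_setD)
  then obtain xs ys where ps': "ps' = xs @ p # ys" by (meson split_list)
  have "mset ps = mset (xs @ ys)" using Cons.prems ps' by simp
  from signed_sum_Cons_cong[OF Cons.IH[OF this]]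
  show ?case by (simp only: ps' signed_sum_move)
qed

text \<open>
  Contraction of an edge commutes with the choices that are still to be made.
\<close>

lemma signed_sum_contract:
  assumes "finite N" "partition_on N \<tau>" "r \<in> N" "u \<in> N" "v \<in> N" "set ps \<subseteq> N \<times> N" "set es \<subseteq> N \<times> N"
  shows "signed_sum N r \<tau> ps ((u, v) # es) =
    (if blk \<tau> u = blk \<tau> v then 0 else signed_sum N r (merge \<tau> u v) ps es)"
  using assms(6,7)
proof (induction ps arbitrary: es)
  case Nil
  then show ?case by (simp add: tree_Cons assms)
next
  case (Cons p ps)
  obtain a b where p: "p = (a, b)" by force
  have ab: "a \<in> N" "b \<in> N" "set ps \<subseteq> N \<times> N" using Cons.prems p by auto
  have "signed_sum N r \<tau> ps (x # (u, v) # es) =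
    (if blk \<tau> u = blk \<tau> v then 0 else signed_sum N r (merge \<tau> u v) ps (x # es))"
    if "x \<in> N \<times> N" for x
  proof -
    have "signed_sum N r \<tau> ps (x # (u, v) # es) = signed_sum N r \<tau> ps ((u, v) # x # es)"
      by (rule signed_sum_cong_edges) simp
    then show ?thesis using Cons.IH[OF ab(3), of "x # es"] that Cons.prems by simp
  qed
  then show ?case using ab assms(3) by (simp add: p)
qed

lemma signed_sum_flip:
  assumes "finite N" "partition_on N \<tau>" "r \<in> N" "u \<in> N" "v \<in> N" "set ps \<subseteq> N \<times> N" "set es \<subseteq> N \<times> N"
  shows "signed_sum N r \<tau> ps ((u, v) # es) = signed_sum N r \<tau> ps ((v, u) # es)"
proof -
  have "merge \<tau> u v = merge \<tau> v u" by (simp add: merge_def Un_commute insert_commute)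
  then show ?thesis
    using signed_sum_contract[OF assms] signed_sum_contract[OF assms(1-3,5,4,6,7)] by auto
qed

definition same_blks :: "nat set \<Rightarrow> nat set set \<Rightarrow> (nat \<times> nat) \<Rightarrow> (nat \<times> nat) \<Rightarrow> bool" where
  "same_blks N \<tau> p q \<longleftrightarrow> p \<in> N \<times> N \<and> q \<in> N \<times> N \<and>
     blk \<tau> (fst p) = blk \<tau> (fst q) \<and> blk \<tau> (snd p) = blk \<tau> (snd q)"

lemma part_const_blk:
  "partition_on N \<tau> \<Longrightarrow> part_const \<tau> f \<Longrightarrow> x \<in> N \<Longrightarrow> y \<in> N \<Longrightarrow> blk \<tau> x = blk \<tau> y \<Longrightarrow> f x = f y"
  using part_const_iff_blk[of N \<tau> f] by blast

lemma signed_sum_cong_blk: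
  assumes "partition_on N \<tau>" "r \<in> N" "list_all2 (same_blks N \<tau>) ps ps'" "list_all2 (same_blks N \<tau>) es es'"
  shows "signed_sum N r \<tau> ps es = signed_sum N r \<tau> ps' es'"
  using assms(3,4)
proof (induction ps ps' arbitrary: es es' rule: list_all2_induct)
  case Nil
  have "edge_const (set es) f = edge_const (set es') f" if f: "part_const \<tau> f" for f
    using Nil
  proof (induction es es' rule: list_all2_induct)
    case (Cons x xs y ys)
    have "f (fst x) = f (fst y)" "f (snd x) = f (snd y)"
      by (rule part_const_blk[OF assms(1) f]; use Cons(1) in \<open>auto simp: same_blks_def\<close>)+
    then show ?case using Cons by (cases x; cases y) simp
  qed simp
  then have "(\<lambda>f. part_const \<tau> f \<and> edge_const (set es) f) = (\<lambda>f. part_const \<tau> f \<and> edge_const (set es') f)"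
    by blast
  then have "tree N \<tau> es = tree N \<tau> es'"
    using list_all2_lengthD[OF Nil] by (simp add: tree_def)
  then show ?case by simp
next
  case (Cons p ps p' ps')
  obtain u v where p: "p = (u, v)" by force
  obtain u' v' where p': "p' = (u', v')" by force
  have "signed_sum N r \<tau> ps (x # es) = signed_sum N r \<tau> ps' (x' # es')" if "same_blks N \<tau> x x'" for x x'
    by (rule Cons.IH) (simp add: that Cons)
  moreover have "same_blks N \<tau> (u, r) (u', r)" "same_blks N \<tau> (v, r) (v', r)" "same_blks N \<tau> (u, v) (u', v')"
    using Cons(1) assms(2) by (auto simp: same_blks_def p p')
  ultimately show ?case by (simp add: p p')
qed

definition avoids :: "nat set \<Rightarrow> (nat \<times> nat) list \<Rightarrow> bool" where
  "avoids X es \<longleftrightarrow> (\<forall>(u, v)\<in>set es. u \<notin> X \<and> v \<notin> X)"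

lemma avoids_simps [simp]:
  "avoids X []" "avoids X ((u, v) # es) \<longleftrightarrow> u \<notin> X \<and> v \<notin> X \<and> avoids X es"
  "avoids X (es @ es') \<longleftrightarrow> avoids X es \<and> avoids X es'"
  by (auto simp: avoids_def)

lemma part_const_block:
  assumes "partition_on N \<tau>" "X \<in> \<tau>"
  shows "part_const \<tau> (\<lambda>z. z \<in> X)"
  unfolding part_const_def using blk_eq[OF assms(1)] assms(2) by metis

lemma edge_const_avoids: "avoids X es \<Longrightarrow> edge_const (set es) (\<lambda>z. z \<in> X)"
  unfolding avoids_def edge_const_def by auto

lemma block_nonempty: "partition_on N \<tau> \<Longrightarrow> X \<in> \<tau> \<Longrightarrow> \<exists>x. x \<in> X \<and> x \<in> N"
  using blk_subset[of N \<tau> X] partition_onD3[of N \<tau>] by (cases "X = {}") auto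

text \<open>
  A part without the root that no pair touches stays isolated whatever is chosen.
\<close>

lemma signed_sum_isolated:
  assumes "partition_on N \<tau>" "X \<in> \<tau>" "r \<in> N" "r \<notin> X" "avoids X ps" "avoids X es"
  shows "signed_sum N r \<tau> ps es = 0"
  using assms(5,6)
proof (induction ps arbitrary: es)
  case Nil
  have "\<not> tree N \<tau> es"
  proof
    assume "tree N \<tau> es"
    then have j: "joined N (\<lambda>f. part_const \<tau> f \<and> edge_const (set es) f)" by (simp add: tree_def)
    obtain x where "x \<in> X" "x \<in> N" using block_nonempty[OF assms(1,2)] by blast
    with joinedD[OF j, of "\<lambda>z. z \<in> X" x r] part_const_block[OF assms(1,2)] edge_const_avoids[OF Nil(2)]
      assms(3,4) show False by simp
  qed
  then show ?case by simp
next
  case (Cons p ps)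
  obtain u v where p: "p = (u, v)" by force
  show ?case using Cons assms(4) by (simp add: p)
qed

text \<open>
  If the edge at \<open>u\<close> is the only one at the part \<open>X\<close>, then \<open>X\<close>
  is a leaf, and it does not matter where the other end of that edge lies.
\<close>

lemma tree_leaf:
  assumes "partition_on N \<tau>" "X \<in> \<tau>" "u \<in> X" "w \<in> N - X" "w' \<in> N - X" "avoids X es"
    and t: "tree N \<tau> ((u, w) # es)"
  shows "tree N \<tau> ((u, w') # es)"
proof -
  have j: "joined N (\<lambda>f. part_const \<tau> f \<and> edge_const (set ((u, w) # es)) f)"
    using t by (simp add: tree_def)
  have "joined N (\<lambda>f. part_const \<tau> f \<and> edge_const (set ((u, w') # es)) f)"
  proof (rule joinedI)
    fix f x y
    assume f: "part_const \<tau> f \<and> edge_const (set ((u, w') # es)) f" and xy: "x \<in> N" "y \<in> N"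
    \<comment> \<open>Recolour the leaf \<open>X\<close> so that the edge to \<open>w\<close>, and not that to
      \<open>w'\<close>, becomes monochromatic.\<close>
    define g where "g z = (if z \<in> X then f w else f z)" for z
    have gX: "g z = f w" if "z \<in> X" for z using that by (simp add: g_def)
    have gN: "g z = f z" if "z \<notin> X" for z using that by (simp add: g_def)
    have "part_const \<tau> g"
      unfolding part_const_def
    proof (intro ballI)
      fix Y a b assume Y: "Y \<in> \<tau>" "a \<in> Y" "b \<in> Y"
      show "g a = g b"
      proof (cases "Y = X")
        case True
        then show ?thesis using Y by (simp add: gX)
      next
        case False
        then have "a \<notin> X" "b \<notin> X" using Y blk_eq[OF assms(1)] assms(2) by metis+
        then show ?thesis using part_constD[OF conjunct1[OF f] Y] by (simp add: gN)
      qed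
    qed
    moreover have "edge_const (set es) g"
      unfolding edge_const_iff
    proof (intro allI impI)
      fix a b assume ab: "(a, b) \<in> set es"
      then have "a \<notin> X" "b \<notin> X" using assms(6) by (auto simp: avoids_def)
      moreover have "f a = f b" using f ab edge_const_iff[of "set ((u, w') # es)" f] by auto
      ultimately show "g a = g b" by (simp add: gN)
    qed
    moreover have "g u = g w" using assms(3,4) by (simp add: g_def)
    ultimately have "part_const \<tau> g \<and> edge_const (set ((u, w) # es)) g" by simp
    from joinedD[OF j this] have g: "g a = g b" if "a \<in> N" "b \<in> N" for a b using that by blast
    have fw: "f z = f w" if "z \<in> N" "z \<notin> X" for z
      using g[of z w] that assms(4) by (simp add: gN)
    have fX: "f z = f w" if "z \<in> X" for z
    proof -
      have "f z = f u" using part_constD[OF conjunct1[OF f] assms(2) that assms(3)] .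
      also have "f u = f w'" using f by simp
      also have "f w' = f w" using fw[of w'] assms(5) by blast
      finally show ?thesis .
    qed
    have "f x = f w" "f y = f w" using fw fX xy by blast+
    then show "f x = f y" by simp
  qed
  then show ?thesis using t by (simp add: tree_def)
qed

lemma signed_sum_leaf:
  assumes "partition_on N \<tau>" "X \<in> \<tau>" "r \<in> N" "r \<notin> X" "u \<in> X" "w \<in> N - X" "w' \<in> N - X"
    "avoids X ps" "avoids X es"
  shows "signed_sum N r \<tau> ps ((u, w) # es) = signed_sum N r \<tau> ps ((u, w') # es)"
  using assms(8,9)
proof (induction ps arbitrary: es)
  case Nil
  have "tree N \<tau> ((u, w) # es) = tree N \<tau> ((u, w') # es)"
    using tree_leaf[OF assms(1,2,5,6,7) Nil(2)] tree_leaf[OF assms(1,2,5,7,6) Nil(2)] by (rule iffI)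
  then show ?case by simp
next
  case (Cons p ps)
  obtain a b where p: "p = (a, b)" by force
  have "signed_sum N r \<tau> ps (x # (u, w) # es) = signed_sum N r \<tau> ps (x # (u, w') # es)"
    if "avoids X [x]" for x
  proof -
    have "signed_sum N r \<tau> ps (x # (u, w) # es) = signed_sum N r \<tau> ps ((u, w) # x # es)"
      by (rule signed_sum_cong_edges) simp
    also have "\<dots> = signed_sum N r \<tau> ps ((u, w') # x # es)"
      by (rule Cons.IH) (use Cons.prems that in \<open>cases x; cases p; auto\<close>)+
    also have "\<dots> = signed_sum N r \<tau> ps (x # (u, w') # es)"
      by (rule signed_sum_cong_edges) simp
    finally show ?thesis .
  qed
  then show ?case using Cons.prems assms(4) by (simp add: p)
qed

text \<open>
  A pair with both ends in \<open>X\<close> counts twice.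
\<close>

definition degree_in :: "nat set \<Rightarrow> (nat \<times> nat) list \<Rightarrow> nat" where
  "degree_in X ps = length (filter (\<lambda>p. fst p \<in> X) ps) + length (filter (\<lambda>p. snd p \<in> X) ps)"

lemma degree_in_simps [simp]:
  "degree_in X [] = 0"
  "degree_in X ((u, v) # ps) = of_bool (u \<in> X) + of_bool (v \<in> X) + degree_in X ps"
  "degree_in X (ps @ qs) = degree_in X ps + degree_in X qs"
  by (auto simp: degree_in_def)

lemma degree_in_0_iff: "degree_in X ps = 0 \<longleftrightarrow> avoids X ps"
  by (induction ps) auto

lemma degree_in_1_split:
  "degree_in X ps = 1 \<Longrightarrow> \<exists>xs u v ys. ps = xs @ (u, v) # ys \<and> avoids X (xs @ ys) \<and> (u \<in> X) \<noteq> (v \<in> X)"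
proof (induction ps)
  case (Cons p ps)
  obtain u v where p: "p = (u, v)" by force
  show ?case
  proof (cases "u \<in> X \<or> v \<in> X")
    case True
    then have "degree_in X ps = 0" "(u \<in> X) \<noteq> (v \<in> X)" using Cons.prems by (auto simp: p split: if_splits)
    then have "p # ps = [] @ (u, v) # ps" "avoids X ([] @ ps)" by (simp_all add: p degree_in_0_iff)
    then show ?thesis using \<open>(u \<in> X) \<noteq> (v \<in> X)\<close> by blast
  next
    case False
    then have "degree_in X ps = 1" using Cons.prems by (simp add: p)
    from Cons.IH[OF this] obtain xs a b ys
      where "ps = xs @ (a, b) # ys" "avoids X (xs @ ys)" "(a \<in> X) \<noteq> (b \<in> X)" by blast
    then have "p # ps = (p # xs) @ (a, b) # ys" "avoids X ((p # xs) @ ys)" using False by (simp_all add: p)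
    then show ?thesis using \<open>(a \<in> X) \<noteq> (b \<in> X)\<close> by blast
  qed
qed simp

text \<open>
  A part of degree one is a leaf in every choice that reaches it. If \<open>u\<close> is the end point
  in it, the choices \<open>ur\<close> and \<open>-uv\<close> cancel by the leaf property, and
  \<open>vr\<close> leaves the part isolated. So a nonzero signed sum forces every part without the
  root to have degree two or more.
\<close>

lemma signed_sum_degree_le_1:
  assumes "finite N" "partition_on N \<tau>" "X \<in> \<tau>" "r \<in> N" "r \<notin> X" "set ps \<subseteq> N \<times> N" "degree_in X ps \<le> 1"
  shows "signed_sum N r \<tau> ps [] = 0"
proof (cases "degree_in X ps = 0")
  case True
  then show ?thesis
    using signed_sum_isolated[OF assms(2-5), of ps "[]"] by (simp add: degree_in_0_iff)
next
  case False
  then obtain xs u v ys where ps: "ps = xs @ (u, v) # ys" and av: "avoids X (xs @ ys)"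
    and uv: "(u \<in> X) \<noteq> (v \<in> X)"
    using degree_in_1_split[of X ps] assms(7) by auto
  have N: "u \<in> N" "v \<in> N" "set (xs @ ys) \<subseteq> N \<times> N" using assms(6) ps by auto
  let ?T = "signed_sum N r \<tau> (xs @ ys)"
  have "signed_sum N r \<tau> ps [] = ?T [(u, r)] + ?T [(v, r)] - ?T [(u, v)]"
    by (simp add: ps signed_sum_move)
  moreover have "?T [(u, r)] = ?T [(u, v)]" "?T [(v, r)] = 0" if "u \<in> X" "v \<notin> X"
    using that N assms(4,5) av
    by (auto intro!: signed_sum_leaf[OF assms(2-5)] signed_sum_isolated[OF assms(2-5)])
  moreover have "?T [(v, r)] = ?T [(u, v)]" "?T [(u, r)] = 0" if "v \<in> X" "u \<notin> X"
  proof -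
    have "?T [(v, r)] = ?T [(v, u)]"
      using that N assms(4,5) av by (intro signed_sum_leaf[OF assms(2-5)]) auto
    also have "\<dots> = ?T [(u, v)]"
      using N by (intro signed_sum_flip[OF assms(1,2,4)]) auto
    finally show "?T [(v, r)] = ?T [(u, v)]" .
    show "?T [(u, r)] = 0"
      using that N assms(4,5) av by (intro signed_sum_isolated[OF assms(2-5)]) auto
  qed
  ultimately show ?thesis using uv by auto
qed

lemma degree_in_map:
  assumes "distinct xs"
  shows "degree_in X (map (\<lambda>a. (f a, g a)) xs) = card {a \<in> set xs. f a \<in> X} + card {a \<in> set xs. g a \<in> X}"
proof -
  have "length (filter P xs) = card {a \<in> set xs. P a}" for P
    using assms by (metis distinct_card distinct_filter set_filter)
  then show ?thesis by (simp add: degree_in_def filter_map comp_def)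
qed

lemma mem_block_iff:
  assumes "partition_on N \<tau>" "x \<in> N" "y \<in> N"
  shows "x \<in> blk \<tau> y \<longleftrightarrow> blk \<tau> x = blk \<tau> y"
  using blk_eq_iff[OF assms(1,3,2)] by auto

lemma block_mem_merge:
  assumes "partition_on N \<tau>" "u \<in> N" "v \<in> N" "w \<in> N" "blk \<tau> w \<noteq> blk \<tau> u" "blk \<tau> w \<noteq> blk \<tau> v"
  shows "blk \<tau> w \<in> merge \<tau> u v"
  using blk_mem[OF assms(1,4)] assms(5,6) by (simp add: merge_def)

lemma card_le_1_if_unique: "(\<And>x y. x \<in> A \<Longrightarrow> y \<in> A \<Longrightarrow> x = y) \<Longrightarrow> card A \<le> 1"
  by (metis card_le_Suc0_iff_eq card.infinite One_nat_def zero_le)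

text \<open>
  If \<open>I\<close> and \<open>J\<close> pick one node each from every part without the root, then
  the pairs form a graph in which all these parts have degree two, that is, the cycles of
  \<open>\<pi>\<close>. By \<open>signed_sum_degree_le_1\<close> an edge of a cycle of length at least
  two can only be contracted with the sign \<open>-1\<close>, which shortens the cycle and also flips
  the sign of \<open>\<pi>\<close>; a cycle of length one contributes the factor \<open>2\<close>.
  Thus the signed sum is \<open>sign \<pi>\<close> times a power of \<open>2\<close>.
\<close>

lemma signed_sum_pos:
  assumes "finite N" "r \<in> N"
    and "partition_on N \<tau>" "distinct xs" "\<pi> permutes set xs"
    and "\<And>a. a \<in> set xs \<Longrightarrow> I a \<in> N \<and> J a \<in> N \<and> blk \<tau> (J a) = blk \<tau> (I a) \<and> blk \<tau> (I a) \<noteq> blk \<tau> r"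
    and "inj_on (\<lambda>a. blk \<tau> (I a)) (set xs)" "card \<tau> = Suc (length xs)"
  shows "0 < sign \<pi> * signed_sum N r \<tau> (map (\<lambda>a. (I a, J (\<pi> a))) xs) []"
  using assms(3-8)
proof (induction xs arbitrary: \<tau> \<pi>)
  case Nil
  then have "\<pi> = id" by (simp add: permutes_empty)
  with Nil show ?case by (simp add: tree_Nil)
next
  case (Cons a xs)
  note p = Cons.prems(1)
  have a: "a \<notin> set xs" and dist: "distinct xs" using Cons.prems(2) by auto
  have perm: "\<pi> permutes insert a (set xs)" using Cons.prems(3) by simp
  have IJ: "I c \<in> N" "J c \<in> N" "blk \<tau> (J c) = blk \<tau> (I c)" "blk \<tau> (I c) \<noteq> blk \<tau> r" if "c \<in> insert a (set xs)" for c
    using Cons.prems(4)[of c] that by auto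
  have inj: "blk \<tau> (I c) = blk \<tau> (I d) \<longleftrightarrow> c = d" if "c \<in> insert a (set xs)" "d \<in> insert a (set xs)" for c d
    using inj_onD[OF Cons.prems(5), of c d] that by auto
  have mapsto: "\<pi> c \<in> insert a (set xs)" if "c \<in> insert a (set xs)" for c
    using permutes_in_image[OF perm] that by blast
  let ?ps = "map (\<lambda>c. (I c, J (\<pi> c))) xs"
  have ps: "set ?ps \<subseteq> N \<times> N" using IJ mapsto by auto
  let ?b = "\<pi> a"
  have aN: "I a \<in> N" "J a \<in> N" "I ?b \<in> N" "J ?b \<in> N" using IJ[of a] IJ[of ?b] mapsto[of a] by auto
  have contr: "signed_sum N r \<tau> ?ps [(u, v)] = (if blk \<tau> u = blk \<tau> v then 0 else signed_sum N r (merge \<tau> u v) ?ps [])"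
    if "u \<in> N" "v \<in> N" for u v
    using signed_sum_contract[OF assms(1) p assms(2) that ps, of "[]"] by simp
  have step: "signed_sum N r \<tau> (map (\<lambda>c. (I c, J (\<pi> c))) (a # xs)) [] =
    signed_sum N r \<tau> ?ps [(I a, r)] + signed_sum N r \<tau> ?ps [(J ?b, r)] - signed_sum N r \<tau> ?ps [(I a, J ?b)]"
    by simp
  show ?case
  proof (cases "?b = a")
    case True
    have "\<pi> permutes set xs"
      by (rule permutes_superset[OF perm]) (use True in auto)
    moreover note m = merge_partition[OF p aN(1) assms(2)]
    note iff = blk_merge_eq_iff[OF p aN(1) assms(2)]
    have blks: "blk \<tau> (I c) \<noteq> blk \<tau> (I a)" "blk \<tau> (I c) \<noteq> blk \<tau> r" "I c \<in> N" "J c \<in> N" "blk \<tau> (J c) = blk \<tau> (I c)"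
      if "c \<in> set xs" for c
      using that IJ[of c] inj[of c a] a by auto
    have "0 < sign \<pi> * signed_sum N r (merge \<tau> (I a) r) ?ps []"
    proof (rule Cons.IH[OF m dist \<open>\<pi> permutes set xs\<close>])
      fix c assume c: "c \<in> set xs"
      show "I c \<in> N \<and> J c \<in> N \<and> blk (merge \<tau> (I a) r) (J c) = blk (merge \<tau> (I a) r) (I c) \<and>
         blk (merge \<tau> (I a) r) (I c) \<noteq> blk (merge \<tau> (I a) r) r"
        using blks[OF c] by (simp add: iff assms(2))
    next
      show "inj_on (\<lambda>c. blk (merge \<tau> (I a) r) (I c)) (set xs)"
      proof (rule inj_onI)
        fix c d assume cd: "c \<in> set xs" "d \<in> set xs" "blk (merge \<tau> (I a) r) (I c) = blk (merge \<tau> (I a) r) (I d)"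
        then have "blk \<tau> (I c) = blk \<tau> (I d)" using blks[OF cd(1)] blks[OF cd(2)] by (simp add: iff)
        then show "c = d" using inj cd by simp
      qed
    next
      show "card (merge \<tau> (I a) r) = Suc (length xs)"
        using merge_card[OF assms(1) p aN(1) assms(2)] IJ[of a] Cons.prems(6) by simp
    qed
    moreover have "signed_sum N r \<tau> ?ps [(I a, r)] = signed_sum N r (merge \<tau> (I a) r) ?ps []"
      using contr[OF aN(1) assms(2)] IJ[of a] by simp
    moreover have "signed_sum N r \<tau> ?ps [(J a, r)] = signed_sum N r (merge \<tau> (I a) r) ?ps []"
    proof -
      have "merge \<tau> (J a) r = merge \<tau> (I a) r" using IJ[of a] by (simp add: merge_def)
      then show ?thesis using contr[OF aN(2) assms(2)] IJ[of a] by simp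
    qed
    moreover have "signed_sum N r \<tau> ?ps [(I a, J a)] = 0"
      using contr[OF aN(1,2)] IJ[of a] by simp
    ultimately show ?thesis unfolding step True by (simp add: algebra_simps)
  next
    case False
    have b: "?b \<in> set xs" using mapsto[of a] False by simp
    have ba: "blk \<tau> (I ?b) \<noteq> blk \<tau> (I a)" using inj[of ?b a] b False by simp
    have bb: "blk \<tau> (J ?b) = blk \<tau> (I ?b)" "blk \<tau> (I ?b) \<noteq> blk \<tau> r" using IJ[of ?b] b by auto
    have aa: "blk \<tau> (J a) = blk \<tau> (I a)" "blk \<tau> (I a) \<noteq> blk \<tau> r" using IJ[of a] by auto
    have pinj: "\<pi> c = \<pi> d \<longleftrightarrow> c = d" for c d using permutes_inj[OF perm] by (auto dest: injD)
    have deg: "signed_sum N r m ?ps [] = 0"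
      if m: "partition_on N m" "blk \<tau> (I d) \<in> m" and d: "d \<in> insert a (set xs)"
        and u: "\<not> (d \<in> set xs \<and> (\<exists>c\<in>set xs. \<pi> c = d))" for m d
    proof (rule signed_sum_degree_le_1[OF assms(1) m assms(2) _ ps])
      show "r \<notin> blk \<tau> (I d)" using mem_block_iff[OF p assms(2) IJ(1)[OF d]] IJ(4)[OF d] by auto
      have 1: "I c \<in> blk \<tau> (I d) \<longleftrightarrow> c = d" if "c \<in> set xs" for c
        using mem_block_iff[OF p IJ(1) IJ(1)[OF d], of c] inj[of c d] that d by simp
      have 2: "J (\<pi> c) \<in> blk \<tau> (I d) \<longleftrightarrow> \<pi> c = d" if "c \<in> set xs" for c
        using mem_block_iff[OF p IJ(2) IJ(1)[OF d], of "\<pi> c"] inj[of "\<pi> c" d] IJ(3)[of "\<pi> c"] mapsto[of c] that d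
        by simp
      have "{c \<in> set xs. I c \<in> blk \<tau> (I d)} = {c \<in> set xs. c = d}" using 1 by blast
      moreover have "{c \<in> set xs. J (\<pi> c) \<in> blk \<tau> (I d)} = {c \<in> set xs. \<pi> c = d}" using 2 by blast
      moreover have "card {c \<in> set xs. c = d} \<le> 1" "card {c \<in> set xs. \<pi> c = d} \<le> 1"
        by (rule card_le_1_if_unique; use pinj in auto)+
      moreover have "{c \<in> set xs. c = d} = {} \<or> {c \<in> set xs. \<pi> c = d} = {}" using u by blast
      then have "card {c \<in> set xs. c = d} = 0 \<or> card {c \<in> set xs. \<pi> c = d} = 0" by (metis card.empty)
      ultimately show "degree_in (blk \<tau> (I d)) ?ps \<le> 1"
        unfolding degree_in_map[OF dist] by presburger
    qed
    \<comment> \<open>Once the part of \<open>I a\<close> is joined to the root, the part of \<open>J (\<pi> a)\<close>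
      has lost one of its two end points; likewise with the roles exchanged.\<close>
    have z1: "signed_sum N r \<tau> ?ps [(I a, r)] = 0"
    proof -
      have "signed_sum N r (merge \<tau> (I a) r) ?ps [] = 0"
      proof (rule deg[of _ ?b])
        show "partition_on N (merge \<tau> (I a) r)" by (rule merge_partition[OF p aN(1) assms(2)])
        show "blk \<tau> (I ?b) \<in> merge \<tau> (I a) r"
          by (rule block_mem_merge[OF p aN(1) assms(2) aN(3) ba bb(2)])
      qed (use b a pinj False in auto)
      then show ?thesis using contr[OF aN(1) assms(2)] by simp
    qed
    have z2: "signed_sum N r \<tau> ?ps [(J ?b, r)] = 0"
    proof -
      have "signed_sum N r (merge \<tau> (J ?b) r) ?ps [] = 0"
      proof (rule deg[of _ a])
        show "partition_on N (merge \<tau> (J ?b) r)" by (rule merge_partition[OF p aN(4) assms(2)])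
        show "blk \<tau> (I a) \<in> merge \<tau> (J ?b) r"
          by (rule block_mem_merge[OF p aN(4) assms(2) aN(1)]) (use ba bb aa in auto)
      qed (use a in auto)
      then show ?thesis using contr[OF aN(4) assms(2)] by simp
    qed
    let ?m = "merge \<tau> (I a) (J ?b)"
    \<comment> \<open>The permutation with \<open>a\<close> bypassed: its preimage is now mapped to \<open>\<pi>
      a\<close>, which lies in the merged part.\<close>
    let ?\<pi> = "transpose a ?b \<circ> \<pi>"
    note m = merge_partition[OF p aN(1,4)]
    note iff = blk_merge_eq_iff[OF p aN(1,4)]
    have perm': "?\<pi> permutes set xs" by (rule permutes_insert_lemma[OF perm])
    have "permutation \<pi>" using perm permutation_permutes by blast
    then have sgn: "sign ?\<pi> = - sign \<pi>"
      using False by (simp add: sign_compose permutation_swap_id sign_swap_id)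
    have "0 < sign ?\<pi> * signed_sum N r ?m (map (\<lambda>c. (I c, J (?\<pi> c))) xs) []"
    proof (rule Cons.IH[OF m dist perm'])
      fix c assume c: "c \<in> set xs"
      have "I c \<in> N" "J c \<in> N" "blk \<tau> (J c) = blk \<tau> (I c)" "blk \<tau> (I c) \<noteq> blk \<tau> r" using IJ[of c] c by auto
      then show "I c \<in> N \<and> J c \<in> N \<and> blk ?m (J c) = blk ?m (I c) \<and> blk ?m (I c) \<noteq> blk ?m r"
        using bb aa by (simp add: iff assms(2))
    next
      show "inj_on (\<lambda>c. blk ?m (I c)) (set xs)"
      proof (rule inj_onI)
        fix c d assume cd: "c \<in> set xs" "d \<in> set xs" "blk ?m (I c) = blk ?m (I d)"
        have N: "I c \<in> N" "I d \<in> N" using IJ cd by auto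
        have na: "blk \<tau> (I c) \<noteq> blk \<tau> (I a)" "blk \<tau> (I d) \<noteq> blk \<tau> (I a)" using inj[of c a] inj[of d a] cd a by auto
        have "blk \<tau> (I c) = blk \<tau> (I d)"
          using cd(3)[unfolded iff[OF N]] na by (elim disjE conjE) simp_all
        then show "c = d" using inj cd by simp
      qed
    next
      show "card ?m = Suc (length xs)"
        using merge_card[OF assms(1) p aN(1,4)] bb ba Cons.prems(6) by simp
    qed
    moreover have "signed_sum N r ?m (map (\<lambda>c. (I c, J (?\<pi> c))) xs) [] = signed_sum N r ?m ?ps []"
    proof (rule signed_sum_cong_blk[OF m assms(2)])
      show "list_all2 (same_blks N ?m) (map (\<lambda>c. (I c, J (?\<pi> c))) xs) ?ps"
        unfolding list_all2_map1 list_all2_map2 list_all2_same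
      proof (rule ballI)
        fix c assume c: "c \<in> set xs"
        have "\<pi> c \<noteq> ?b" using pinj c a by auto
        then have "?\<pi> c = (if \<pi> c = a then ?b else \<pi> c)" by (simp add: transpose_def)
        moreover have "blk ?m (J ?b) = blk ?m (J a)" using aa bb aN by (simp add: iff)
        ultimately show "same_blks N ?m (I c, J (?\<pi> c)) (I c, J (\<pi> c))"
          using IJ[of c] IJ[of "\<pi> c"] mapsto[of c] c aN by (auto simp: same_blks_def)
      qed
    qed simp
    moreover have "signed_sum N r \<tau> ?ps [(I a, J ?b)] = signed_sum N r ?m ?ps []"
      using contr[OF aN(1,4)] ba bb by auto
    ultimately show ?thesis unfolding step z1 z2 sgn by simp
  qed
qed

section \<open>Antisymmetrisation\<close>

text \<open>
  The list \<open>xs\<close> enumerates the index set; by \<open>signed_sum_cong_pairs\<close> its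
  order is immaterial.
\<close>

definition antisym_sum :: "nat set \<Rightarrow> nat \<Rightarrow> nat set set \<Rightarrow> 'b list \<Rightarrow> ('b \<Rightarrow> nat) \<Rightarrow> ('b \<Rightarrow> nat) \<Rightarrow> int" where
  "antisym_sum N r \<tau> xs f g =
     (\<Sum>\<pi> | \<pi> permutes set xs. sign \<pi> * signed_sum N r \<tau> (map (\<lambda>a. (f a, g (\<pi> a))) xs) [])"

lemma sign_transpose_compose:
  assumes "\<pi> permutes S" "finite S" "a \<noteq> b"
  shows "sign (transpose a b \<circ> \<pi>) = - sign \<pi>" "sign (\<pi> \<circ> transpose a b) = - sign \<pi>"
proof -
  have "permutation \<pi>" using assms(1,2) permutation_permutes by blast
  then show "sign (transpose a b \<circ> \<pi>) = - sign \<pi>" "sign (\<pi> \<circ> transpose a b) = - sign \<pi>"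
    using assms(3) by (simp_all add: sign_compose permutation_swap_id sign_swap_id)
qed

text \<open>
  Transposing two indices whose nodes lie in the same part changes only the sign.
\<close>

lemma antisym_sum_zero_right:
  assumes "partition_on N \<tau>" "r \<in> N" "f ` set xs \<subseteq> N" "g ` set xs \<subseteq> N"
    and "a \<in> set xs" "b \<in> set xs" "a \<noteq> b" "blk \<tau> (g a) = blk \<tau> (g b)"
  shows "antisym_sum N r \<tau> xs f g = 0"
proof -
  let ?T = "\<lambda>\<pi>. signed_sum N r \<tau> (map (\<lambda>a. (f a, g (\<pi> a))) xs) []"
  let ?t = "transpose a b"
  have T: "?T (?t \<circ> \<pi>) = ?T \<pi>" if "\<pi> permutes set xs" for \<pi>
  proof (rule signed_sum_cong_blk[OF assms(1,2)])
    show "list_all2 (same_blks N \<tau>) (map (\<lambda>a. (f a, g ((?t \<circ> \<pi>) a))) xs) (map (\<lambda>a. (f a, g (\<pi> a))) xs)"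
      unfolding list_all2_map1 list_all2_map2 list_all2_same
    proof (rule ballI)
      fix c assume c: "c \<in> set xs"
      then have "\<pi> c \<in> set xs" using permutes_in_image[OF that] by blast
      then show "same_blks N \<tau> (f c, g ((?t \<circ> \<pi>) c)) (f c, g (\<pi> c))"
        using assms c by (auto simp: same_blks_def transpose_def)
    qed
  qed simp
  have "antisym_sum N r \<tau> xs f g = (\<Sum>\<pi> | \<pi> permutes set xs. sign (?t \<circ> \<pi>) * ?T (?t \<circ> \<pi>))"
    unfolding antisym_sum_def by (rule setum_permutations_compose_left[OF permutes_swap_id[OF assms(5,6)]])
  also have "\<dots> = (\<Sum>\<pi> | \<pi> permutes set xs. - (sign \<pi> * ?T \<pi>))"
    by (rule sum.cong) (simp_all only: mem_Collect_eq T sign_transpose_compose(1)[OF _ finite_set assms(7)] minus_mult_left)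
  also have "\<dots> = - antisym_sum N r \<tau> xs f g"
    unfolding antisym_sum_def by (rule sum_negf)
  finally show ?thesis by simp
qed

lemma mset_map_permutes:
  assumes "distinct xs" "t permutes set xs"
  shows "mset (map (\<lambda>a. h (t a)) xs) = mset (map h xs)"
proof -
  have "mset (map (\<lambda>a. h (t a)) xs) = image_mset h (image_mset t (mset_set (set xs)))"
    using assms(1) by (simp add: mset_set_set image_mset.compositionality comp_def)
  also have "image_mset t (mset_set (set xs)) = mset_set (set xs)"
    using permutes_inj_on[OF assms(2)] permutes_image[OF assms(2)] by (simp add: image_mset_mset_set)
  also have "image_mset h (mset_set (set xs)) = mset (map h xs)"
    using assms(1) by (simp add: mset_set_set)
  finally show ?thesis .
qed

lemma antisym_sum_zero_left:
  assumes "partition_on N \<tau>" "r \<in> N" "distinct xs" "f ` set xs \<subseteq> N" "g ` set xs \<subseteq> N"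
    and "a \<in> set xs" "b \<in> set xs" "a \<noteq> b" "blk \<tau> (f a) = blk \<tau> (f b)"
  shows "antisym_sum N r \<tau> xs f g = 0"
proof -
  let ?T = "\<lambda>\<pi>. signed_sum N r \<tau> (map (\<lambda>a. (f a, g (\<pi> a))) xs) []"
  let ?t = "transpose a b"
  have t: "?t permutes set xs" using assms(6,7) by (rule permutes_swap_id)
  have T: "?T (\<pi> \<circ> ?t) = ?T \<pi>" if "\<pi> permutes set xs" for \<pi>
  proof -
    have "?T (\<pi> \<circ> ?t) = signed_sum N r \<tau> (map (\<lambda>a. (f (?t a), g (\<pi> a))) xs) []"
      using mset_map_permutes[OF assms(3) t, of "\<lambda>a. (f (?t a), g (\<pi> a))"]
      by (intro signed_sum_cong_pairs) (simp add: comp_def)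
    also have "\<dots> = ?T \<pi>"
    proof (rule signed_sum_cong_blk[OF assms(1,2)])
      show "list_all2 (same_blks N \<tau>) (map (\<lambda>a. (f (?t a), g (\<pi> a))) xs) (map (\<lambda>a. (f a, g (\<pi> a))) xs)"
        unfolding list_all2_map1 list_all2_map2 list_all2_same
      proof (rule ballI)
        fix c assume c: "c \<in> set xs"
        then have "\<pi> c \<in> set xs" using permutes_in_image[OF that] by blast
        then show "same_blks N \<tau> (f (?t c), g (\<pi> c)) (f c, g (\<pi> c))"
          using assms c by (auto simp: same_blks_def transpose_def)
      qed
    qed simp
    finally show ?thesis .
  qed
  \<comment> \<open>Precomposition permutes the pairs in addition; the order of the pairs is irrelevant.\<close>
  have "antisym_sum N r \<tau> xs f g = (\<Sum>\<pi> | \<pi> permutes set xs. sign (\<pi> \<circ> ?t) * ?T (\<pi> \<circ> ?t))"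
    unfolding antisym_sum_def by (rule sum_permutations_compose_right[OF t])
  also have "\<dots> = (\<Sum>\<pi> | \<pi> permutes set xs. - (sign \<pi> * ?T \<pi>))"
    by (rule sum.cong) (simp_all only: mem_Collect_eq T sign_transpose_compose(2)[OF _ finite_set assms(8)] minus_mult_left)
  also have "\<dots> = - antisym_sum N r \<tau> xs f g"
    unfolding antisym_sum_def by (rule sum_negf)
  finally show ?thesis by simp
qed

lemma signed_sum_card: "signed_sum N r \<tau> ps es \<noteq> 0 \<Longrightarrow> card \<tau> = Suc (length ps + length es)"
proof (induction ps arbitrary: es)
  case Nil
  then show ?case by (auto simp: tree_def split: if_splits)
next
  case (Cons p ps)
  obtain u v where p: "p = (u, v)" by force
  have "signed_sum N r \<tau> ps ((u, r) # es) \<noteq> 0 \<or> signed_sum N r \<tau> ps ((v, r) # es) \<noteq> 0 \<or>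
      signed_sum N r \<tau> ps ((u, v) # es) \<noteq> 0"
    using Cons.prems by (auto simp: p)
  then show ?case using Cons.IH by auto
qed

text \<open>
  Every part without the root has degree at least two, but contains at most one node of each family by
  antisymmetry; so it contains exactly one node of each.
\<close>

lemma antisym_sum_nonzero:
  assumes "finite N" "partition_on N \<tau>" "r \<in> N" "distinct xs" "f ` set xs \<subseteq> N" "g ` set xs \<subseteq> N"
    and nz: "antisym_sum N r \<tau> xs f g \<noteq> 0"
  shows "card \<tau> = Suc (length xs)"
    and "inj_on (\<lambda>a. blk \<tau> (f a)) (set xs)" "inj_on (\<lambda>a. blk \<tau> (g a)) (set xs)"
    and "\<And>X. X \<in> \<tau> \<Longrightarrow> r \<notin> X \<Longrightarrow> (\<exists>a\<in>set xs. f a \<in> X) \<and> (\<exists>a\<in>set xs. g a \<in> X)"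
proof -
  show injf: "inj_on (\<lambda>a. blk \<tau> (f a)) (set xs)"
    using antisym_sum_zero_left[OF assms(2-6)] nz by (intro inj_onI) blast
  show injg: "inj_on (\<lambda>a. blk \<tau> (g a)) (set xs)"
    using antisym_sum_zero_right[OF assms(2,3,5,6)] nz by (intro inj_onI) blast
  obtain \<pi> where \<pi>: "\<pi> permutes set xs" and nz': "signed_sum N r \<tau> (map (\<lambda>a. (f a, g (\<pi> a))) xs) [] \<noteq> 0"
    using nz unfolding antisym_sum_def by (metis (mono_tags, lifting) mem_Collect_eq mult_zero_right sum.neutral)
  show "card \<tau> = Suc (length xs)" using signed_sum_card[OF nz'] by simp
  have in_xs: "\<pi> a \<in> set xs" if "a \<in> set xs" for a using permutes_in_image[OF \<pi>] that by blast
  have ps: "set (map (\<lambda>a. (f a, g (\<pi> a))) xs) \<subseteq> N \<times> N" using assms(5,6) in_xs by auto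
  fix X assume X: "X \<in> \<tau>" "r \<notin> X"
  have "\<not> degree_in X (map (\<lambda>a. (f a, g (\<pi> a))) xs) \<le> 1"
    using signed_sum_degree_le_1[OF assms(1,2) X(1) assms(3) X(2) ps] nz' by blast
  then have deg: "card {a \<in> set xs. f a \<in> X} + card {a \<in> set xs. g (\<pi> a) \<in> X} > 1"
    by (simp add: degree_in_map[OF assms(4)])
  have "card {a \<in> set xs. f a \<in> X} \<le> 1"
  proof (rule card_le_1_if_unique)
    fix x y assume "x \<in> {a \<in> set xs. f a \<in> X}" "y \<in> {a \<in> set xs. f a \<in> X}"
    then show "x = y" using inj_onD[OF injf, of x y] blk_eq[OF assms(2) X(1)] by simp
  qed
  moreover have "card {a \<in> set xs. g (\<pi> a) \<in> X} \<le> 1"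
  proof (rule card_le_1_if_unique)
    fix x y assume xy: "x \<in> {a \<in> set xs. g (\<pi> a) \<in> X}" "y \<in> {a \<in> set xs. g (\<pi> a) \<in> X}"
    then have "\<pi> x = \<pi> y" using inj_onD[OF injg, of "\<pi> x" "\<pi> y"] blk_eq[OF assms(2) X(1)] in_xs by simp
    then show "x = y" using permutes_inj[OF \<pi>] by (auto dest: injD)
  qed
  ultimately have "card {a \<in> set xs. f a \<in> X} \<noteq> 0" "card {a \<in> set xs. g (\<pi> a) \<in> X} \<noteq> 0"
    using deg by linarith+
  then have "{a \<in> set xs. f a \<in> X} \<noteq> {}" "{a \<in> set xs. g (\<pi> a) \<in> X} \<noteq> {}" by (metis card.empty)+
  then show "(\<exists>a\<in>set xs. f a \<in> X) \<and> (\<exists>a\<in>set xs. g a \<in> X)" using in_xs by blast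
qed

section \<open>Planar partitions and the extremes of their parts\<close>

lemma planarD:
  assumes "\<tau> \<in> planar_partitions n"
  shows "partition_on {1..n} \<tau>" "\<not> crossing \<tau>"
  using assms by (auto simp: planar_partitions_def node_partitions_def)

lemma not_crossingD:
  assumes "\<not> crossing \<tau>" "A \<in> \<tau>" "B \<in> \<tau>" "a < b" "b < c" "c < d" "a \<in> A" "c \<in> A" "b \<in> B" "d \<in> B"
  shows "A = B"
proof (rule ccontr)
  assume "A \<noteq> B"
  then have "A \<noteq> B \<and> (\<exists>a b c d. a < b \<and> b < c \<and> c < d \<and> a \<in> A \<and> c \<in> A \<and> b \<in> B \<and> d \<in> B)"
    using assms(4-10) by (intro conjI exI) assumption+
  then have "crossing \<tau>" unfolding crossing_def using assms(2,3) by (intro bexI)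
  then show False using assms(1) by simp
qed

text \<open>
  The node \<open>n\<close> serves as root.
\<close>

definition nonroot :: "nat \<Rightarrow> nat set set \<Rightarrow> nat set set" where
  "nonroot n \<tau> = {X \<in> \<tau>. n \<notin> X}"

lemma nonroot_split:
  assumes "partition_on N \<tau>" "n \<in> N"
  shows "\<tau> = insert (blk \<tau> n) (nonroot n \<tau>)" "blk \<tau> n \<notin> nonroot n \<tau>"
proof -
  note b = blk_mem[OF assms]
  have "X = blk \<tau> n" if "X \<in> \<tau>" "n \<in> X" for X
    using blk_eq[OF assms(1) that] by (rule sym)
  then show "\<tau> = insert (blk \<tau> n) (nonroot n \<tau>)" using b(1) unfolding nonroot_def by blast
  show "blk \<tau> n \<notin> nonroot n \<tau>" using b(2) by (simp add: nonroot_def)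
qed

lemma block_facts:
  assumes "partition_on {1..n::nat} \<tau>" "X \<in> \<tau>"
  shows "finite X" "X \<noteq> {}" "Min X \<in> X" "Max X \<in> X" "X \<subseteq> {1..n}"
    and "\<And>i. i \<in> X \<Longrightarrow> Min X \<le> i" "\<And>i. i \<in> X \<Longrightarrow> i \<le> Max X"
    and "Min X \<in> {1..n}" "Max X \<in> {1..n}"
proof -
  show s: "X \<subseteq> {1..n}" using blk_subset[OF assms] .
  then show f: "finite X" by (rule finite_subset) simp
  show ne: "X \<noteq> {}" using assms(2) partition_onD3[OF assms(1)] by auto
  show m: "Min X \<in> X" "Max X \<in> X" using f ne by (rule Min_in, rule Max_in)
  show "Min X \<in> {1..n}" "Max X \<in> {1..n}" using m s by blast+
  show "Min X \<le> i" "i \<le> Max X" if "i \<in> X" for i using f that by (rule Min_le, rule Max_ge)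
qed

lemma block_unique:
  "partition_on (N :: nat set) \<tau> \<Longrightarrow> X \<in> \<tau> \<Longrightarrow> Y \<in> \<tau> \<Longrightarrow> i \<in> X \<Longrightarrow> i \<in> Y \<Longrightarrow> X = Y"
  using blk_eq[of N \<tau>] by metis

text \<open>
  The matching of minima with maxima is that of brackets. If the part of \<open>\<tau>'\<close> with a
  given minimum extended beyond \<open>c = Max X\<close>, then the part of \<open>\<tau>'\<close> with
  maximum \<open>c\<close> would be nested in it, and the part of \<open>\<tau>\<close> with the same
  minimum as that nested part would close before \<open>c\<close>. This is the same discrepancy with a
  larger minimum, so that it cannot persist.
\<close>

lemma same_min_max_le:
  assumes "\<tau> \<in> planar_partitions n" "\<tau>' \<in> planar_partitions n"
    and mins: "Min ` nonroot n \<tau> = Min ` nonroot n \<tau>'" and maxs: "Max ` nonroot n \<tau> = Max ` nonroot n \<tau>'"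
    and "X \<in> nonroot n \<tau>" "X' \<in> nonroot n \<tau>'" "Min X = Min X'"
  shows "Max X' \<le> Max X"
  using assms(5-7)
proof (induction "n - Min X" arbitrary: X X' rule: less_induct)
  case less
  note p = planarD[OF assms(1)] and p' = planarD[OF assms(2)]
  have X: "X \<in> \<tau>" "n \<notin> X" and X': "X' \<in> \<tau>'" "n \<notin> X'" using less.prems by (auto simp: nonroot_def)
  note bX = block_facts[OF p(1) X(1)] and bX' = block_facts[OF p'(1) X'(1)]
  show ?case
  proof (rule ccontr)
    assume "\<not> Max X' \<le> Max X"
    then have lt: "Max X < Max X'" by simp
    have "Max X \<in> Max ` nonroot n \<tau>'" using less.prems(1) maxs by blast
    then obtain Y' where Y': "Y' \<in> nonroot n \<tau>'" "Max Y' = Max X" by (metis imageE)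
    then have Y'\<tau>: "Y' \<in> \<tau>'" by (simp add: nonroot_def)
    note bY' = block_facts[OF p'(1) Y'\<tau>]
    have ne': "Y' \<noteq> X'" using Y'(2) lt by auto
    have "Min X' \<le> Max X" using bX(6)[OF bX(4)] less.prems(3) by simp
    have "Min X' \<noteq> Max X"
      using block_unique[OF p'(1) X'(1) Y'\<tau>, of "Max X"] bX'(3) bY'(4) Y'(2) ne' by auto
    then have oc: "Min X' < Max X" using \<open>Min X' \<le> Max X\<close> by simp
    have "Min Y' \<noteq> Min X'" using block_unique[OF p'(1) X'(1) Y'\<tau>, of "Min X'"] bX'(3) bY'(3) ne' by auto
    moreover have "\<not> Min Y' < Min X'"
      using not_crossingD[OF p'(2) Y'\<tau> X'(1) _ oc lt bY'(3)] bY'(4) Y'(2) bX'(3,4) ne' by auto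
    ultimately have o: "Min X < Min Y'" using less.prems(3) by simp
    have "Min Y' \<in> Min ` nonroot n \<tau>" using Y'(1) mins by blast
    then obtain Y where Y: "Y \<in> nonroot n \<tau>" "Min Y = Min Y'" by (metis imageE)
    then have Y\<tau>: "Y \<in> \<tau>" by (simp add: nonroot_def)
    note bY = block_facts[OF p(1) Y\<tau>]
    have ne: "Y \<noteq> X" using Y(2) o by auto
    have "Min Y' \<le> Max X" using bY'(6)[OF bY'(4)] Y'(2) by simp
    moreover have "Min Y \<noteq> Max X"
      using block_unique[OF p(1) X(1) Y\<tau>, of "Max X"] bX(4) bY(3) ne by auto
    ultimately have o2: "Min Y < Max X" using Y(2) by simp
    have "Max Y \<noteq> Max X" using block_unique[OF p(1) X(1) Y\<tau>, of "Max X"] bX(4) bY(4) ne by auto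
    moreover have "\<not> Max X < Max Y"
      using not_crossingD[OF p(2) X(1) Y\<tau> _ o2 _ bX(3,4) bY(3,4)] o Y(2) ne by auto
    ultimately have "Max Y < Max Y'" using Y'(2) by simp
    moreover have "n - Min Y < n - Min X"
    proof -
      have "Min X < n" using o bY'(5) bY'(3) by auto
      then show ?thesis using o Y(2) by simp
    qed
    ultimately show False using less.hyps[OF _ Y(1) Y'(1) Y(2)] by simp
  qed
qed

text \<open>
  In a planar partition, a node in the range of some part that avoids \<open>n\<close> belongs to the
  innermost such part, and the ranges in \<open>\<tau>\<close> and \<open>\<tau>'\<close> agree.
\<close>

lemma same_min_max_subset:
  assumes "\<tau> \<in> planar_partitions n" "\<tau>' \<in> planar_partitions n"
    and mins: "Min ` nonroot n \<tau> = Min ` nonroot n \<tau>'" and maxs: "Max ` nonroot n \<tau> = Max ` nonroot n \<tau>'"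
    and "X \<in> nonroot n \<tau>" "X' \<in> nonroot n \<tau>'" "Min X = Min X'"
  shows "X \<subseteq> X'"
proof
  fix i assume i: "i \<in> X"
  note p = planarD[OF assms(1)] and p' = planarD[OF assms(2)]
  have X: "X \<in> \<tau>" "n \<notin> X" and X': "X' \<in> \<tau>'" "n \<notin> X'" using assms(5,6) by (auto simp: nonroot_def)
  note bX = block_facts[OF p(1) X(1)] and bX' = block_facts[OF p'(1) X'(1)]
  have mx: "Max X' = Max X"
    using same_min_max_le[OF assms] same_min_max_le[OF assms(2,1) mins[symmetric] maxs[symmetric] assms(6,5) assms(7)[symmetric]]
    by simp
  have iN: "i \<in> {1..n}" using i bX(5) by blast
  show "i \<in> X'"
  proof (rule ccontr)
    assume niX': "i \<notin> X'"
    define Y' where "Y' = blk \<tau>' i"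
    have Y': "Y' \<in> \<tau>'" "i \<in> Y'" using blk_mem[OF p'(1) iN] by (simp_all add: Y'_def)
    note bY' = block_facts[OF p'(1) Y'(1)]
    have ne': "Y' \<noteq> X'" using Y' niX' by blast
    have lt: "Min X' < i" "i < Max X'"
      using bX(6)[OF i] bX(7)[OF i] assms(7) mx bX'(3,4) niX' by (metis le_neq_implies_less)+
    have "Max X' < n" using bX'(4,5) X'(2) by (metis atLeastAtMost_iff le_neq_implies_less subsetD)
    then have "n \<notin> Y'"
      using not_crossingD[OF p'(2) X'(1) Y'(1) lt _ bX'(3,4) Y'(2)] ne' by blast
    then have Y'n: "Y' \<in> nonroot n \<tau>'" using Y' by (simp add: nonroot_def)
    have "Min Y' \<noteq> Min X'" using block_unique[OF p'(1) X'(1) Y'(1), of "Min X'"] bX'(3) bY'(3) ne' by auto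
    moreover have "\<not> Min Y' < Min X'"
      using not_crossingD[OF p'(2) Y'(1) X'(1) _ lt bY'(3) Y'(2) bX'(3,4)] ne' by blast
    ultimately have o: "Min X' < Min Y'" by simp
    have "Min Y' \<in> Min ` nonroot n \<tau>" using Y'n mins by blast
    then obtain Y where Y: "Y \<in> nonroot n \<tau>" "Min Y = Min Y'" by (metis imageE)
    then have Y\<tau>: "Y \<in> \<tau>" by (simp add: nonroot_def)
    note bY = block_facts[OF p(1) Y\<tau>]
    have "Max Y' \<le> Max Y" by (rule same_min_max_le[OF assms(1-4) Y(1) Y'n Y(2)])
    then have le: "i \<le> Max Y" using bY'(7)[OF Y'(2)] by simp
    have ge: "Min Y \<le> i" using bY'(6)[OF Y'(2)] Y(2) by simp
    have ne: "X \<noteq> Y" using o assms(7) Y(2) by auto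
    then have "i \<notin> Y" using block_unique[OF p(1) X(1) Y\<tau> i] by blast
    then have "Min Y < i" "i < Max Y" using le ge bY(3,4) by (metis le_neq_implies_less)+
    then show False
      using not_crossingD[OF p(2) X(1) Y\<tau> _ _ _ bX(3) i bY(3,4)] o assms(7) Y(2) ne by auto
  qed
qed

lemma planar_determined:
  assumes "\<tau> \<in> planar_partitions n" "\<tau>' \<in> planar_partitions n" "n \<ge> 1"
    and "Min ` nonroot n \<tau> = Min ` nonroot n \<tau>'" "Max ` nonroot n \<tau> = Max ` nonroot n \<tau>'"
  shows "\<tau> = \<tau>'"
proof -
  have sub: "nonroot n \<tau> \<subseteq> nonroot n \<tau>'"
    if "\<tau> \<in> planar_partitions n" "\<tau>' \<in> planar_partitions n"
      "Min ` nonroot n \<tau> = Min ` nonroot n \<tau>'" "Max ` nonroot n \<tau> = Max ` nonroot n \<tau>'" for \<tau> \<tau>'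
  proof
    fix X assume X: "X \<in> nonroot n \<tau>"
    then have "Min X \<in> Min ` nonroot n \<tau>'" using that(3) by blast
    then obtain X' where X': "X' \<in> nonroot n \<tau>'" "Min X' = Min X" by (metis imageE)
    have "X = X'"
      using same_min_max_subset[OF that X X'(1) X'(2)[symmetric]]
        same_min_max_subset[OF that(2,1) that(3,4)[symmetric] X'(1) X X'(2)] by (rule subset_antisym)
    then show "X \<in> nonroot n \<tau>'" using X' by simp
  qed
  have eq: "nonroot n \<tau> = nonroot n \<tau>'"
    using sub[OF assms(1,2,4,5)] sub[OF assms(2,1) assms(4,5)[symmetric]] by (rule subset_antisym)
  have decomp: "\<tau> = insert ({1..n} - \<Union>(nonroot n \<tau>)) (nonroot n \<tau>)" if "\<tau> \<in> planar_partitions n" for \<tau>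
  proof -
    note p = planarD(1)[OF that]
    have n: "n \<in> {1..n}" using assms(3) by simp
    note b = blk_mem[OF p n]
    note split = nonroot_split(1)[OF p n]
    have "{1..n} = \<Union>\<tau>" using partition_onD1[OF p] .
    moreover have "blk \<tau> n \<inter> \<Union>(nonroot n \<tau>) = {}"
      using block_unique[OF p b(1)] b(2) unfolding nonroot_def by blast
    moreover have "\<Union>\<tau> = blk \<tau> n \<union> \<Union>(nonroot n \<tau>)" by (subst split) simp
    ultimately have "{1..n} - \<Union>(nonroot n \<tau>) = blk \<tau> n" by blast
    then show ?thesis using split by (simp only:)
  qed
  show ?thesis using decomp[OF assms(1)] decomp[OF assms(2)] eq by simp
qed

section \<open>Planar partitions are independent modulo the kernel\<close>

lemma finite_node_partitions: "finite (node_partitions n)"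
  unfolding node_partitions_def by (rule finitely_many_partition_on) simp

lemma planar_subset: "planar_partitions n \<subseteq> node_partitions n"
  by (auto simp: planar_partitions_def)

lemma finite_planar: "finite (planar_partitions n)"
  using finite_subset[OF planar_subset finite_node_partitions] .

lemma kernel_signed_sum:
  fixes c :: "nat set set \<Rightarrow> 'a::{idom,ring_char_0}"
  assumes "\<And>\<rho>. \<rho> \<in> node_partitions n \<Longrightarrow> (\<Sum>\<tau>\<in>planar_partitions n. c \<tau> * of_bool (tree_pair n \<tau> \<rho>)) = 0"
    and "r \<in> {1..n}" "set ps \<subseteq> {1..n} \<times> {1..n}" "set es \<subseteq> {1..n} \<times> {1..n}"
  shows "(\<Sum>\<tau>\<in>planar_partitions n. c \<tau> * of_int (signed_sum {1..n} r \<tau> ps es)) = 0"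
  using assms(3,4)
proof (induction ps arbitrary: es)
  case Nil
  from tree_functional[OF Nil(2)] show ?case
  proof
    assume "\<exists>\<rho>\<in>node_partitions n. \<forall>\<tau>\<in>node_partitions n. tree {1..n} \<tau> es = tree_pair n \<tau> \<rho>"
    then obtain \<rho> where \<rho>: "\<rho> \<in> node_partitions n" "\<And>\<tau>. \<tau> \<in> node_partitions n \<Longrightarrow> tree {1..n} \<tau> es = tree_pair n \<tau> \<rho>"
      by blast
    have "(\<Sum>\<tau>\<in>planar_partitions n. c \<tau> * of_int (signed_sum {1..n} r \<tau> [] es)) =
        (\<Sum>\<tau>\<in>planar_partitions n. c \<tau> * of_bool (tree_pair n \<tau> \<rho>))"
      using \<rho>(2) planar_subset by (intro sum.cong) auto
    then show ?thesis using assms(1)[OF \<rho>(1)] by simp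
  next
    assume "\<forall>\<tau>\<in>node_partitions n. \<not> tree {1..n} \<tau> es"
    then show ?thesis using planar_subset by (intro sum.neutral) auto
  qed
next
  case (Cons p ps)
  obtain u v where p: "p = (u, v)" by force
  have "(\<Sum>\<tau>\<in>planar_partitions n. c \<tau> * of_int (signed_sum {1..n} r \<tau> ps (x # es))) = 0"
    if "x \<in> {1..n} \<times> {1..n}" for x
    using Cons.prems that by (intro Cons.IH) auto
  from this[of "(u, r)"] this[of "(v, r)"] this[of "(u, v)"] show ?case
    using Cons.prems assms(2) by (simp add: p algebra_simps sum.distrib sum_subtractf)
qed

lemma kernel_antisym_sum:
  fixes c :: "nat set set \<Rightarrow> 'a::{idom,ring_char_0}"
  assumes "\<And>\<rho>. \<rho> \<in> node_partitions n \<Longrightarrow> (\<Sum>\<tau>\<in>planar_partitions n. c \<tau> * of_bool (tree_pair n \<tau> \<rho>)) = 0"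
    and "r \<in> {1..n}" "f ` set xs \<subseteq> {1..n}" "g ` set xs \<subseteq> {1..n}"
  shows "(\<Sum>\<tau>\<in>planar_partitions n. c \<tau> * of_int (antisym_sum {1..n} r \<tau> xs f g)) = 0"
proof -
  have "(\<Sum>\<tau>\<in>planar_partitions n. c \<tau> * of_int (antisym_sum {1..n} r \<tau> xs f g)) =
    (\<Sum>\<pi> | \<pi> permutes set xs. of_int (sign \<pi>) *
      (\<Sum>\<tau>\<in>planar_partitions n. c \<tau> * of_int (signed_sum {1..n} r \<tau> (map (\<lambda>a. (f a, g (\<pi> a))) xs) [])))"
    unfolding antisym_sum_def of_int_sum sum_distrib_left
    by (subst sum.swap) (simp add: mult_ac)
  also have "\<dots> = 0"
  proof (intro sum.neutral ballI)
    fix \<pi> assume "\<pi> \<in> {\<pi>. \<pi> permutes set xs}"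
    then have \<pi>: "\<pi> permutes set xs" by simp
    have "\<pi> a \<in> set xs" if "a \<in> set xs" for a using permutes_in_image[OF \<pi>] that by simp
    then have "set (map (\<lambda>a. (f a, g (\<pi> a))) xs) \<subseteq> {1..n} \<times> {1..n}" using assms(3,4) by auto
    from kernel_signed_sum[OF assms(1,2) this, of "[]"]
    show "of_int (sign \<pi>) * (\<Sum>\<tau>\<in>planar_partitions n. c \<tau> *
        of_int (signed_sum {1..n} r \<tau> (map (\<lambda>a. (f a, g (\<pi> a))) xs) [])) = (0 :: 'a)" by simp
  qed
  finally show ?thesis .
qed

definition spread :: "nat \<Rightarrow> nat set set \<Rightarrow> int" where
  "spread n \<tau> = (\<Sum>X\<in>nonroot n \<tau>. int (Max X) - int (Min X))"

text \<open>
  For the partition itself all summands are positive, whichever permutation is used.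
\<close>

lemma antisym_sum_self_pos:
  assumes "n \<ge> 1" "partition_on {1..n} \<tau>" "distinct xs" "set xs = nonroot n \<tau>"
  shows "antisym_sum {1..n} n \<tau> xs Min Max > 0"
  unfolding antisym_sum_def
proof (rule sum_pos)
  show "finite {\<pi>. \<pi> permutes set xs}" by (rule finite_permutations) simp
  show "{\<pi>. \<pi> permutes set xs} \<noteq> {}" using permutes_id by blast
  fix \<pi> assume "\<pi> \<in> {\<pi>. \<pi> permutes set xs}"
  then have \<pi>: "\<pi> permutes set xs" by simp
  have n: "n \<in> {1..n}" using assms(1) by simp
  have X: "X \<in> \<tau>" "n \<notin> X" if "X \<in> set xs" for X using that assms(4) by (auto simp: nonroot_def)
  have blkX: "blk \<tau> (Min X) = X" "blk \<tau> (Max X) = X" "Min X \<in> {1..n}" "Max X \<in> {1..n}" "X \<noteq> blk \<tau> n"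
    if "X \<in> set xs" for X
  proof -
    note b = block_facts[OF assms(2) X(1)[OF that]]
    show "blk \<tau> (Min X) = X" "blk \<tau> (Max X) = X"
      using blk_eq[OF assms(2) X(1)[OF that]] b(3,4) by blast+
    show "Min X \<in> {1..n}" "Max X \<in> {1..n}" by (rule b(8,9))+
    show "X \<noteq> blk \<tau> n" using X(2)[OF that] blk_mem(2)[OF assms(2) n] by blast
  qed
  show "0 < sign \<pi> * signed_sum {1..n} n \<tau> (map (\<lambda>a. (Min a, Max (\<pi> a))) xs) []"
  proof (rule signed_sum_pos[OF _ n assms(2,3) \<pi>])
    show "Min X \<in> {1..n} \<and> Max X \<in> {1..n} \<and> blk \<tau> (Max X) = blk \<tau> (Min X) \<and> blk \<tau> (Min X) \<noteq> blk \<tau> n"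
      if "X \<in> set xs" for X using blkX[OF that] by simp
    show "inj_on (\<lambda>X. blk \<tau> (Min X)) (set xs)" using blkX by (intro inj_onI) simp
    have "\<tau> = insert (blk \<tau> n) (set xs)"
      unfolding assms(4) by (rule nonroot_split(1)[OF assms(2) n])
    moreover have "blk \<tau> n \<notin> set xs" using blkX(5) by blast
    ultimately show "card \<tau> = Suc (length xs)"
      using distinct_card[OF assms(3)] by (metis card_insert_disjoint finite_set)
  qed simp
qed

lemma card_nonroot:
  assumes "n \<ge> 1" "partition_on {1..n} \<tau>"
  shows "card \<tau> = Suc (card (nonroot n \<tau>))"
proof -
  have n: "n \<in> {1..n}" using assms(1) by simp
  note nonroot_split[OF assms(2) n]
  moreover have "finite (nonroot n \<tau>)"
    using finite_elements[OF _ assms(2)] by (simp add: nonroot_def)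
  ultimately show ?thesis by (metis card_insert_disjoint)
qed

text \<open>
  If the minima and the maxima of \<open>\<tau>0\<close> are transversals of the parts of
  \<open>\<tau>\<close>, then the parts of \<open>\<tau>\<close> reach at least as far to both sides:
  the spread can only grow, and it stays the same only if the extremes agree.
\<close>

lemma antisym_sum_triangular:
  assumes "n \<ge> 1" "\<tau> \<in> planar_partitions n" "\<tau>0 \<in> planar_partitions n"
    and xs: "distinct xs" "set xs = nonroot n \<tau>0"
    and nz: "antisym_sum {1..n} n \<tau> xs Min Max \<noteq> 0" and le: "spread n \<tau> \<le> spread n \<tau>0"
  shows "\<tau> = \<tau>0"
proof -
  note p = planarD(1)[OF assms(2)] and p0 = planarD(1)[OF assms(3)]
  have n: "n \<in> {1..n}" using assms(1) by simp
  have B: "Min B \<in> {1..n}" "Max B \<in> {1..n}" if "B \<in> set xs" for B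
    using block_facts(8,9)[OF p0, of B] that xs(2) unfolding nonroot_def by blast+
  then have img: "Min ` set xs \<subseteq> {1..n}" "Max ` set xs \<subseteq> {1..n}" by auto
  note N = antisym_sum_nonzero[OF finite_atLeastAtMost p n xs(1) img nz]
  let ?R = "nonroot n \<tau>"
  have fin: "finite ?R" using finite_elements[OF _ p] by (simp add: nonroot_def)
  have cardR: "card ?R = card (set xs)"
    using card_nonroot[OF assms(1) p] N(1) distinct_card[OF xs(1)] by simp
  have R: "X \<in> \<tau>" "n \<notin> X" if "X \<in> ?R" for X using that by (auto simp: nonroot_def)
  have "\<exists>a. \<forall>X\<in>?R. a X \<in> set xs \<and> Min (a X) \<in> X" using N(4) R by (intro bchoice) blast
  then obtain a where a: "\<And>X. X \<in> ?R \<Longrightarrow> a X \<in> set xs" "\<And>X. X \<in> ?R \<Longrightarrow> Min (a X) \<in> X" by blast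
  have "\<exists>b. \<forall>X\<in>?R. b X \<in> set xs \<and> Max (b X) \<in> X" using N(4) R by (intro bchoice) blast
  then obtain b where b: "\<And>X. X \<in> ?R \<Longrightarrow> b X \<in> set xs" "\<And>X. X \<in> ?R \<Longrightarrow> Max (b X) \<in> X" by blast
  have inja: "inj_on a ?R"
  proof (rule inj_onI)
    fix X Y assume XY: "X \<in> ?R" "Y \<in> ?R" "a X = a Y"
    show "X = Y" using block_unique[OF p R(1)[OF XY(1)] R(1)[OF XY(2)]] a(2)[OF XY(1)] a(2)[OF XY(2)] XY(3) by simp
  qed
  have injb: "inj_on b ?R"
  proof (rule inj_onI)
    fix X Y assume XY: "X \<in> ?R" "Y \<in> ?R" "b X = b Y"
    show "X = Y" using block_unique[OF p R(1)[OF XY(1)] R(1)[OF XY(2)]] b(2)[OF XY(1)] b(2)[OF XY(2)] XY(3) by simp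
  qed
  have ima: "a ` ?R = set xs"
    using card_subset_eq[of "set xs" "a ` ?R"] a(1) card_image[OF inja] cardR by auto
  have imb: "b ` ?R = set xs"
    using card_subset_eq[of "set xs" "b ` ?R"] b(1) card_image[OF injb] cardR by auto
  have ge1: "int (Min X) \<le> int (Min (a X))" "int (Max (b X)) \<le> int (Max X)" if "X \<in> ?R" for X
    using block_facts(6,7)[OF p R(1)[OF that]] a(2)[OF that] b(2)[OF that] by auto
  let ?d = "\<lambda>X. (int (Max X) - int (Min X)) - (int (Max (b X)) - int (Min (a X)))"
  have "spread n \<tau>0 = (\<Sum>B\<in>set xs. int (Max B)) - (\<Sum>B\<in>set xs. int (Min B))"
    by (simp add: spread_def xs(2) sum_subtractf)
  also have "(\<Sum>B\<in>set xs. int (Max B)) = (\<Sum>X\<in>?R. int (Max (b X)))"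
    unfolding imb[symmetric] by (rule sum.reindex_cong[OF injb]) auto
  also have "(\<Sum>B\<in>set xs. int (Min B)) = (\<Sum>X\<in>?R. int (Min (a X)))"
    unfolding ima[symmetric] by (rule sum.reindex_cong[OF inja]) auto
  finally have s0: "spread n \<tau>0 = (\<Sum>X\<in>?R. int (Max (b X)) - int (Min (a X)))" by (simp add: sum_subtractf)
  have "(\<Sum>X\<in>?R. ?d X) \<le> 0"
    using le unfolding s0 spread_def[of n \<tau>] by (simp add: sum_subtractf)
  moreover have nonneg: "0 \<le> ?d X" if "X \<in> ?R" for X
    using ge1[OF that] by linarith
  ultimately have "(\<Sum>X\<in>?R. ?d X) = 0"
    by (intro antisym sum_nonneg) auto
  then have "\<forall>X\<in>?R. ?d X = 0"
    using sum_nonneg_eq_0_iff[OF fin, of ?d] nonneg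
    by blast
  then have eq: "Max X = Max (b X)" "Min X = Min (a X)" if "X \<in> ?R" for X
    using ge1[OF that] that by fastforce+
  have "Min ` ?R = Min ` (a ` ?R)" unfolding image_image by (rule image_cong) (simp_all add: eq(2)[symmetric])
  moreover have "Max ` ?R = Max ` (b ` ?R)" unfolding image_image by (rule image_cong) (simp_all add: eq(1)[symmetric])
  ultimately show ?thesis
    using planar_determined[OF assms(2,3,1)] by (simp add: ima imb xs(2))
qed

text \<open>
  The planar subspace meets the kernel of the form only in \<open>0\<close>. In a nontrivial
  combination take a partition of maximal spread; its functional sees no other partition of the
  combination. The factor that remains is a positive integer, hence nonzero in characteristic
  \<open>0\<close>.
\<close>

theorem planar_kernel_trivial:
  fixes c :: "nat set set \<Rightarrow> 'a::{idom,ring_char_0}"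
  assumes "n \<ge> 1"
    and ker: "\<And>\<rho>. \<rho> \<in> node_partitions n \<Longrightarrow> (\<Sum>\<tau>\<in>planar_partitions n. c \<tau> * of_bool (tree_pair n \<tau> \<rho>)) = 0"
    and "\<sigma> \<in> planar_partitions n"
  shows "c \<sigma> = 0"
proof (rule ccontr)
  assume "c \<sigma> \<noteq> 0"
  let ?S = "{\<tau> \<in> planar_partitions n. c \<tau> \<noteq> 0}"
  have S: "finite ?S" "?S \<noteq> {}" using finite_planar \<open>c \<sigma> \<noteq> 0\<close> assms(3) by auto
  have "Max (spread n ` ?S) \<in> spread n ` ?S" using S by (intro Max_in) auto
  then obtain \<tau>0 where \<tau>0: "\<tau>0 \<in> ?S" and M: "Max (spread n ` ?S) = spread n \<tau>0" by (rule imageE)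
  have max: "spread n \<tau> \<le> spread n \<tau>0" if "\<tau> \<in> ?S" for \<tau>
    unfolding M[symmetric] using S(1) that by (intro Max_ge) auto
  note p0 = planarD(1)[of \<tau>0 n]
  have "finite (nonroot n \<tau>0)" using finite_elements[of "{1..n}" \<tau>0] p0 \<tau>0 by (simp add: nonroot_def)
  from finite_distinct_list[OF this] obtain xs where xs: "set xs = nonroot n \<tau>0" "distinct xs" by blast
  have B: "Min B \<in> {1..n}" "Max B \<in> {1..n}" if "B \<in> set xs" for B
    using block_facts(8,9)[OF p0, of B] that xs(1) \<tau>0 unfolding nonroot_def by blast+
  have "(\<Sum>\<tau>\<in>planar_partitions n. c \<tau> * of_int (antisym_sum {1..n} n \<tau> xs Min Max)) = 0"
    by (rule kernel_antisym_sum[OF ker]) (use B assms(1) in auto)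
  also have "(\<Sum>\<tau>\<in>planar_partitions n. c \<tau> * of_int (antisym_sum {1..n} n \<tau> xs Min Max)) =
    (\<Sum>\<tau>\<in>{\<tau>0}. c \<tau> * of_int (antisym_sum {1..n} n \<tau> xs Min Max))"
  proof (rule sum.mono_neutral_right[OF finite_planar])
    show "{\<tau>0} \<subseteq> planar_partitions n" using \<tau>0 by simp
    show "\<forall>\<tau>\<in>planar_partitions n - {\<tau>0}. c \<tau> * of_int (antisym_sum {1..n} n \<tau> xs Min Max) = 0"
    proof
      fix \<tau> assume \<tau>: "\<tau> \<in> planar_partitions n - {\<tau>0}"
      show "c \<tau> * of_int (antisym_sum {1..n} n \<tau> xs Min Max) = 0"
      proof (cases "c \<tau> = 0")
        case False
        then have "antisym_sum {1..n} n \<tau> xs Min Max = 0"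
          using antisym_sum_triangular[OF assms(1) _ _ xs(2,1), of \<tau>] max[of \<tau>] \<tau> \<tau>0 by blast
        then show ?thesis by simp
      qed simp
    qed
  qed
  finally have "c \<tau>0 * of_int (antisym_sum {1..n} n \<tau>0 xs Min Max) = 0" by simp
  moreover have "antisym_sum {1..n} n \<tau>0 xs Min Max > 0"
    using antisym_sum_self_pos[OF assms(1) p0 xs(2,1)] \<tau>0 by simp
  ultimately show False using \<tau>0 by simp
qed

section \<open>Entries of the projection matrix\<close>

abbreviation "keys \<equiv> Poly_Mapping.keys"
abbreviation "lookup \<equiv> Poly_Mapping.lookup"

text \<open>
  The difference of \<open>\<tau>\<close> and its planar expansion lies in the kernel; it is tested on
  the single partition \<open>\<rho>\<close>.
\<close>

lemma projection_pairing:
  fixes P :: "nat set set \<Rightarrow> nat set set \<Rightarrow> 'a::{idom,ring_char_0}"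
  assumes "n \<ge> 1" "is_planar_projection_matrix n P" "\<tau> \<in> node_partitions n" "\<rho> \<in> node_partitions n"
  shows "of_bool (tree_pair n \<tau> \<rho>) = (\<Sum>\<sigma>\<in>planar_partitions n. P \<sigma> \<tau> * of_bool (tree_pair n \<sigma> \<rho>))"
proof -
  define w where "w = Poly_Mapping.single \<tau> 1 - (\<Sum>\<sigma>\<in>planar_partitions n. Poly_Mapping.single \<sigma> (P \<sigma> \<tau>))"
  have w: "w \<in> K_space n" using assms(2,3) unfolding is_planar_projection_matrix_def w_def by blast
  have keys_w: "keys w \<subseteq> node_partitions n" using w by (simp add: K_space_def W_space_def)
  have s: "Poly_Mapping.single \<rho> (1::'a) \<in> W_space n" using assms(4) by (simp add: W_space_def)
  have lookup_w: "lookup w \<xi> = of_bool (\<xi> = \<tau>) - (\<Sum>\<sigma>\<in>planar_partitions n. if \<sigma> = \<xi> then P \<sigma> \<tau> else 0)" for \<xi>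
    unfolding w_def lookup_minus lookup_sum by (simp add: lookup_single when_def eq_commute)
  have "0 = W_form n w (Poly_Mapping.single \<rho> 1)" using w s unfolding K_space_def by simp
  also have "\<dots> = (\<Sum>\<xi>\<in>keys w. lookup w \<xi> * partition_pairing n \<xi> \<rho>)"
    by (simp add: W_form_def)
  also have "\<dots> = (\<Sum>\<xi>\<in>node_partitions n. lookup w \<xi> * partition_pairing n \<xi> \<rho>)"
    by (rule sum.mono_neutral_left[OF finite_node_partitions keys_w]) (simp add: in_keys_iff)
  also have "\<dots> = (\<Sum>\<xi>\<in>node_partitions n. lookup w \<xi> * of_bool (tree_pair n \<xi> \<rho>))"
    using partition_pairing_eq[OF assms(1) _ assms(4), where 'a = 'a] by (intro sum.cong) auto
  also have "\<dots> = (\<Sum>\<xi>\<in>node_partitions n. of_bool (\<xi> = \<tau>) * of_bool (tree_pair n \<xi> \<rho>)) -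
      (\<Sum>\<xi>\<in>node_partitions n. (\<Sum>\<sigma>\<in>planar_partitions n. if \<sigma> = \<xi> then P \<sigma> \<tau> else 0) * of_bool (tree_pair n \<xi> \<rho>))"
    unfolding lookup_w left_diff_distrib by (rule sum_subtractf)
  also have "(\<Sum>\<xi>\<in>node_partitions n. of_bool (\<xi> = \<tau>) * of_bool (tree_pair n \<xi> \<rho>)) = (of_bool (tree_pair n \<tau> \<rho>) :: 'a)"
    using assms(3) by (simp add: of_bool_def if_distrib[of "\<lambda>z. z * _"] finite_node_partitions cong: if_cong)
  also have "(\<Sum>\<xi>\<in>node_partitions n. (\<Sum>\<sigma>\<in>planar_partitions n. if \<sigma> = \<xi> then P \<sigma> \<tau> else 0) * of_bool (tree_pair n \<xi> \<rho>)) =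
      (\<Sum>\<xi>\<in>node_partitions n. if \<xi> \<in> planar_partitions n then P \<xi> \<tau> * of_bool (tree_pair n \<xi> \<rho>) else 0)"
    by (rule sum.cong) (simp_all add: finite_planar)
  also have "\<dots> = (\<Sum>\<xi>\<in>planar_partitions n. P \<xi> \<tau> * of_bool (tree_pair n \<xi> \<rho>))"
    using planar_subset[of n] finite_node_partitions[of n] by (simp add: sum.inter_restrict[symmetric] Int_absorb1)
  finally show ?thesis by simp
qed

text \<open>
  The tool for computing entries of \<open>P\<close>: any combination of planar partitions with the
  right pairings has the entries of \<open>P\<close> as coefficients.
\<close>

lemma projection_unique:
  fixes P :: "nat set set \<Rightarrow> nat set set \<Rightarrow> 'a::{idom,ring_char_0}"
  assumes "n \<ge> 1" "is_planar_projection_matrix n P" "\<tau> \<in> node_partitions n" "\<sigma> \<in> planar_partitions n"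
    and "\<And>\<rho>. \<rho> \<in> node_partitions n \<Longrightarrow>
      of_bool (tree_pair n \<tau> \<rho>) = (\<Sum>\<sigma>\<in>planar_partitions n. d \<sigma> * of_bool (tree_pair n \<sigma> \<rho>))"
  shows "P \<sigma> \<tau> = d \<sigma>"
proof -
  have "P \<sigma> \<tau> - d \<sigma> = 0"
  proof (rule planar_kernel_trivial[OF assms(1) _ assms(4)])
    fix \<rho> assume \<rho>: "\<rho> \<in> node_partitions n"
    show "(\<Sum>\<sigma>\<in>planar_partitions n. (P \<sigma> \<tau> - d \<sigma>) * of_bool (tree_pair n \<sigma> \<rho>)) = 0"
      using projection_pairing[OF assms(1-3) \<rho>] assms(5)[OF \<rho>]
      by (simp add: left_diff_distrib sum_subtractf)
  qed
  then show ?thesis by simp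
qed

lemma projection_self:
  fixes P :: "nat set set \<Rightarrow> nat set set \<Rightarrow> 'a::{idom,ring_char_0}"
  assumes "n \<ge> 1" "is_planar_projection_matrix n P" "\<sigma> \<in> planar_partitions n"
  shows "P \<sigma> \<sigma> = 1"
proof -
  have "P \<sigma> \<sigma> = of_bool (\<sigma> = \<sigma>)"
    using assms planar_subset[of n] finite_planar[of n]
    by (intro projection_unique[OF assms(1,2)])
      (auto simp: of_bool_def if_distrib[of "\<lambda>z. z * _"] cong: if_cong)
  then show ?thesis by simp
qed

text \<open>
  The form pairs partitions with \<open>k\<close> parts only with partitions with \<open>n + 1 -
  k\<close> parts, so discarding the entries for other numbers of parts leaves all pairings unchanged.
\<close>

lemma projection_card:
  fixes P :: "nat set set \<Rightarrow> nat set set \<Rightarrow> 'a::{idom,ring_char_0}"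
  assumes "n \<ge> 1" "is_planar_projection_matrix n P" "\<tau> \<in> node_partitions n" "\<sigma> \<in> planar_partitions n"
    and "P \<sigma> \<tau> \<noteq> 0"
  shows "card \<tau> = card \<sigma>"
proof -
  have "P \<sigma> \<tau> = P \<sigma> \<tau> * of_bool (card \<tau> = card \<sigma>)"
  proof (rule projection_unique[OF assms(1-4)])
    fix \<rho> assume \<rho>: "\<rho> \<in> node_partitions n"
    show "of_bool (tree_pair n \<tau> \<rho>) =
      (\<Sum>\<sigma>\<in>planar_partitions n. P \<sigma> \<tau> * of_bool (card \<tau> = card \<sigma>) * of_bool (tree_pair n \<sigma> \<rho>))"
    proof (cases "card \<tau> + card \<rho> = n + 1")
      case True
      have "(\<Sum>\<sigma>\<in>planar_partitions n. P \<sigma> \<tau> * of_bool (card \<tau> = card \<sigma>) * of_bool (tree_pair n \<sigma> \<rho>)) =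
          (\<Sum>\<sigma>\<in>planar_partitions n. P \<sigma> \<tau> * of_bool (tree_pair n \<sigma> \<rho>))"
        by (rule sum.cong) (use True in \<open>auto simp: tree_pair_def\<close>)
      then show ?thesis using projection_pairing[OF assms(1-3) \<rho>] by simp
    next
      case False
      have "of_bool (card \<tau> = card \<xi>) * of_bool (tree_pair n \<xi> \<rho>) = (0 :: 'a)" for \<xi>
        using False by (simp add: tree_pair_def)
      then have "(\<Sum>\<sigma>\<in>planar_partitions n. P \<sigma> \<tau> * of_bool (card \<tau> = card \<sigma>) * of_bool (tree_pair n \<sigma> \<rho>)) = 0"
        by (intro sum.neutral) (simp add: mult.assoc)
      then show ?thesis using False by (simp add: tree_pair_def)
    qed
  qed
  then show ?thesis using assms(5) by (auto simp: of_bool_def split: if_splits)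
qed

section \<open>The skein relation\<close>

text \<open>
  Translates the two shapes of edge pairs in \<open>skein_tree\<close>, two disjoint edges and a path,
  into partitions.
\<close>

lemma tree_merge_pairs:
  assumes "finite N" "partition_on N \<pi>" "\<pi> = {A, B, C, D} \<union> R"
    and "a \<in> A" "b \<in> B" "c \<in> C" "d \<in> D" "distinct [A, B, C, D]" "{A, B, C, D} \<inter> R = {}"
    and "set es \<subseteq> N \<times> N"
  shows "tree N \<pi> ((a, b) # (c, d) # es) = tree N ({A \<union> B, C \<union> D} \<union> R) es"
    and "tree N \<pi> ((b, c) # (c, d) # es) = tree N ({A, B \<union> C \<union> D} \<union> R) es"
proof -
  have mem: "A \<in> \<pi>" "B \<in> \<pi>" "C \<in> \<pi>" "D \<in> \<pi>" using assms(3) by auto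
  have N: "a \<in> N" "b \<in> N" "c \<in> N" "d \<in> N" using mem assms(4-7) blk_subset[OF assms(2)] by blast+
  have blk: "blk \<pi> a = A" "blk \<pi> b = B" "blk \<pi> c = C" "blk \<pi> d = D"
    using blk_eq[OF assms(2)] mem assms(4-7) by blast+
  have ne: "A \<noteq> B" "A \<noteq> C" "A \<noteq> D" "B \<noteq> C" "B \<noteq> D" "C \<noteq> D" using assms(8) by auto
  have nR: "A \<notin> R" "B \<notin> R" "C \<notin> R" "D \<notin> R" using assms(9) by auto
  have uni: "X = Y" if "X \<in> \<pi>" "Y \<in> \<pi>" "i \<in> X" "i \<in> Y" for X Y i
    using block_unique[OF assms(2) that] .
  show "tree N \<pi> ((a, b) # (c, d) # es) = tree N ({A \<union> B, C \<union> D} \<union> R) es"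
  proof -
    note m = merge_partition[OF assms(2) N(1,2)]
    have bm: "blk (merge \<pi> a b) c = C" "blk (merge \<pi> a b) d = D"
      using blk_merge[OF assms(2) N(1,2,3)] blk_merge[OF assms(2) N(1,2,4)] ne by (auto simp: blk)
    have nAB: "A \<union> B \<noteq> C" "A \<union> B \<noteq> D"
      using uni[OF mem(1,3)] uni[OF mem(1,4)] ne assms(4) by blast+
    have "\<pi> - {A, B} = {C, D} \<union> R"
      unfolding assms(3) using ne nR by blast
    then have "merge \<pi> a b = {A \<union> B, C, D} \<union> R"
      unfolding merge_def blk by simp
    then have "merge (merge \<pi> a b) c d = insert (C \<union> D) ({A \<union> B, C, D} \<union> R - {C, D})"
      unfolding merge_def[of "merge \<pi> a b"] bm by simp
    also have "{A \<union> B, C, D} \<union> R - {C, D} = {A \<union> B} \<union> R"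
      using nAB ne nR by blast
    also have "insert (C \<union> D) ({A \<union> B} \<union> R) = {A \<union> B, C \<union> D} \<union> R" by fast
    finally have "merge (merge \<pi> a b) c d = {A \<union> B, C \<union> D} \<union> R" .
    then show ?thesis
      using tree_Cons[OF assms(1,2) N(1,2), of "(c, d) # es"] tree_Cons[OF assms(1) m N(3,4) assms(10)]
        bm blk ne N assms(10) by simp
  qed
  show "tree N \<pi> ((b, c) # (c, d) # es) = tree N ({A, B \<union> C \<union> D} \<union> R) es"
  proof -
    note m = merge_partition[OF assms(2) N(2,3)]
    have bm: "blk (merge \<pi> b c) c = B \<union> C" "blk (merge \<pi> b c) d = D"
      using blk_merge[OF assms(2) N(2,3,3)] blk_merge[OF assms(2) N(2,3,4)] ne by (auto simp: blk)
    have nBC: "B \<union> C \<noteq> A" "B \<union> C \<noteq> D" "B \<union> C \<notin> R"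
      using uni[OF mem(2,1)] uni[OF mem(2,4)] uni[OF mem(2), of "B \<union> C" b] uni[OF mem(3), of "B \<union> C" c]
        ne assms(3,5,6) by blast+
    have "\<pi> - {B, C} = {A, D} \<union> R"
      unfolding assms(3) using ne nR by blast
    then have "merge \<pi> b c = {B \<union> C, A, D} \<union> R"
      unfolding merge_def blk by simp
    then have "merge (merge \<pi> b c) c d = insert (B \<union> C \<union> D) ({B \<union> C, A, D} \<union> R - {B \<union> C, D})"
      unfolding merge_def[of "merge \<pi> b c"] bm by simp
    also have "{B \<union> C, A, D} \<union> R - {B \<union> C, D} = {A} \<union> R"
      using nBC ne nR by blast
    also have "insert (B \<union> C \<union> D) ({A} \<union> R) = {A, B \<union> C \<union> D} \<union> R" by fast
    finally have "merge (merge \<pi> b c) c d = {A, B \<union> C \<union> D} \<union> R" .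
    then show ?thesis
      using tree_Cons[OF assms(1,2) N(2,3), of "(c, d) # es"] tree_Cons[OF assms(1) m N(3,4) assms(10)]
        bm blk ne nBC N assms(10) by simp
  qed
qed

text \<open>
  As the relation holds against every \<open>\<rho>\<close>, it holds modulo the kernel of the form.
\<close>

lemma skein_pairing:
  assumes "partition_on {1..n} ({A, B, C, D} \<union> R)" "distinct [A, B, C, D]" "{A, B, C, D} \<inter> R = {}"
    and "\<rho> \<in> node_partitions n"
  defines "p \<equiv> \<lambda>X Y. of_bool (tree_pair n ({X, Y} \<union> R) \<rho>) :: int"
  shows "p (A \<union> B) (C \<union> D) + p (A \<union> C) (B \<union> D) + p (A \<union> D) (B \<union> C) =
    p A (B \<union> C \<union> D) + p B (A \<union> C \<union> D) + p C (A \<union> B \<union> D) + p D (A \<union> B \<union> C)"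
proof -
  let ?\<pi> = "{A, B, C, D} \<union> R"
  have "partition_on {1..n} \<rho>" using assms(4) by (simp add: node_partitions_def)
  from exists_forest_list[OF finite_atLeastAtMost this] obtain es
    where es: "set es \<subseteq> {1..n} \<times> {1..n}" "edge_part {1..n} es = \<rho>" "card \<rho> + length es = n" by auto
  have p: "p X Y = tr {1..n} ({X, Y} \<union> R) es" for X Y
    unfolding p_def using tree_eq_tree_pair[OF es(1)] es(2,3) by simp
  have "A \<noteq> {}" "B \<noteq> {}" "C \<noteq> {}" "D \<noteq> {}" using partition_onD3[OF assms(1)] by auto
  then obtain a b c d where abcd: "a \<in> A" "b \<in> B" "c \<in> C" "d \<in> D" by blast
  have N: "a \<in> {1..n}" "b \<in> {1..n}" "c \<in> {1..n}" "d \<in> {1..n}"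
    using blk_subset[OF assms(1)] abcd by blast+
  note tm = tree_merge_pairs[OF finite_atLeastAtMost assms(1) _ _ _ _ _ _ _ es(1)]
  have ne: "A \<noteq> B" "A \<noteq> C" "A \<noteq> D" "B \<noteq> C" "B \<noteq> D" "C \<noteq> D" using assms(2) by auto
  have "tree {1..n} ?\<pi> ((a, b) # (c, d) # es) = tree {1..n} ({A \<union> B, C \<union> D} \<union> R) es"
    by (rule tm(1)) (use abcd assms(2,3) in auto)
  moreover have "tree {1..n} ?\<pi> ((a, c) # (b, d) # es) = tree {1..n} ({A \<union> C, B \<union> D} \<union> R) es"
    by (rule tm(1)) (use abcd ne assms(3) in auto)
  moreover have "tree {1..n} ?\<pi> ((a, d) # (b, c) # es) = tree {1..n} ({A \<union> D, B \<union> C} \<union> R) es"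
    by (rule tm(1)) (use abcd ne assms(3) in auto)
  moreover have "tree {1..n} ?\<pi> ((b, c) # (c, d) # es) = tree {1..n} ({A, B \<union> C \<union> D} \<union> R) es"
    by (rule tm(2)[where a = a]) (use abcd ne assms(3) in auto)
  moreover have "tree {1..n} ?\<pi> ((a, c) # (c, d) # es) = tree {1..n} ({B, A \<union> C \<union> D} \<union> R) es"
    by (rule tm(2)[where a = b]) (use abcd ne assms(3) in auto)
  moreover have "tree {1..n} ?\<pi> ((a, b) # (b, d) # es) = tree {1..n} ({C, A \<union> B \<union> D} \<union> R) es"
    by (rule tm(2)[where a = c]) (use abcd ne assms(3) in auto)
  moreover have "tree {1..n} ?\<pi> ((a, b) # (b, c) # es) = tree {1..n} ({D, A \<union> B \<union> C} \<union> R) es"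
    by (rule tm(2)[where a = d]) (use abcd ne assms(3) in auto)
  ultimately show ?thesis
    using skein_tree[OF finite_atLeastAtMost assms(1) N es(1)] by (simp only: p)
qed

section \<open>Transposing two neighbouring nodes\<close>

text \<open>
  A symmetric form of crossing, in which two points of one set separate two points of the other on the
  circle; it avoids distinguishing which set comes first.
\<close>

definition linked :: "nat set \<Rightarrow> nat set \<Rightarrow> bool" where
  "linked A B \<longleftrightarrow> (\<exists>a1\<in>A. \<exists>a2\<in>A. \<exists>b1\<in>B. \<exists>b2\<in>B. a1 < b1 \<and> b1 < a2 \<and> (b2 < a1 \<or> a2 < b2))"

lemma linked_sym: "linked A B \<Longrightarrow> linked B A"
  unfolding linked_def by blast

lemma linkedI: "a1 \<in> A \<Longrightarrow> a2 \<in> A \<Longrightarrow> b1 \<in> B \<Longrightarrow> b2 \<in> B \<Longrightarrow> a1 < b1 \<Longrightarrow> b1 < a2 \<Longrightarrow> b2 < a1 \<or> a2 < b2 \<Longrightarrow> linked A B"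
  unfolding linked_def by blast

lemma linkedE:
  assumes "linked A B"
  obtains a1 a2 b1 b2 where "a1 \<in> A" "a2 \<in> A" "b1 \<in> B" "b2 \<in> B" "a1 < b1" "b1 < a2" "b2 < a1 \<or> a2 < b2"
  using assms unfolding linked_def by blast

lemma linked_mono: "linked A B \<Longrightarrow> A \<subseteq> A' \<Longrightarrow> B \<subseteq> B' \<Longrightarrow> linked A' B'"
  unfolding linked_def by blast

lemma crossing_iff_linked: "crossing \<tau> \<longleftrightarrow> (\<exists>A\<in>\<tau>. \<exists>B\<in>\<tau>. A \<noteq> B \<and> linked A B)"
proof
  assume "crossing \<tau>"
  then obtain A B a b c d where "A \<in> \<tau>" "B \<in> \<tau>" "A \<noteq> B" "a < b" "b < c" "c < d" "a \<in> A" "c \<in> A" "b \<in> B" "d \<in> B"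
    unfolding crossing_def by blast
  then show "\<exists>A\<in>\<tau>. \<exists>B\<in>\<tau>. A \<noteq> B \<and> linked A B" using linkedI[of a A c b B d] by blast
next
  assume "\<exists>A\<in>\<tau>. \<exists>B\<in>\<tau>. A \<noteq> B \<and> linked A B"
  then obtain A B where AB: "A \<in> \<tau>" "B \<in> \<tau>" "A \<noteq> B" "linked A B" by blast
  from AB(4) obtain a1 a2 b1 b2 where l: "a1 \<in> A" "a2 \<in> A" "b1 \<in> B" "b2 \<in> B" "a1 < b1" "b1 < a2"
    and o: "b2 < a1 \<or> a2 < b2" by (rule linkedE)
  show "crossing \<tau>"
  proof (rule ccontr)
    assume nc: "\<not> crossing \<tau>"
    from o show False
    proof
      assume "b2 < a1"
      from not_crossingD[OF nc AB(2,1) this l(5,6,4,3,1,2)] AB(3) show False by simp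
    next
      assume "a2 < b2"
      from not_crossingD[OF nc AB(1,2) l(5,6) this l(1,2,3,4)] AB(3) show False by simp
    qed
  qed
qed

lemma repartition:
  assumes "partition_on (N :: nat set) \<sigma>" "\<S> \<subseteq> \<sigma>" "partition_on (\<Union>\<S>) \<Q>"
  shows "partition_on N (\<Q> \<union> (\<sigma> - \<S>))"
proof (rule partition_onI)
  have "\<Union>\<sigma> = N" "\<Union>\<Q> = \<Union>\<S>" using partition_onD1[OF assms(1)] partition_onD1[OF assms(3)] by simp_all
  moreover have "\<Union>\<sigma> = \<Union>\<S> \<union> \<Union>(\<sigma> - \<S>)" using assms(2) by blast
  ultimately show "\<Union>(\<Q> \<union> (\<sigma> - \<S>)) = N" by (simp only: Union_Un_distrib)
  show "{} \<notin> \<Q> \<union> (\<sigma> - \<S>)" using partition_onD3[OF assms(1)] partition_onD3[OF assms(3)] by simp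
  have old: "disjnt U V" if "U \<in> \<sigma>" "V \<in> \<sigma>" "U \<noteq> V" for U V
    using block_unique[OF assms(1) that(1,2)] that(3) unfolding disjnt_iff by blast
  have new: "disjnt U V" if "U \<in> \<Q>" "V \<in> \<Q>" "U \<noteq> V" for U V
    using partition_onD2[OF assms(3)] that by (simp add: pairwise_def)
  have mixed: "disjnt U V" if "U \<in> \<Q>" "V \<in> \<sigma> - \<S>" for U V
    unfolding disjnt_iff
  proof (intro allI notI)
    fix i assume i: "i \<in> U \<and> i \<in> V"
    then have "i \<in> \<Union>\<S>" using that(1) partition_onD1[OF assms(3)] by blast
    then obtain W where W: "W \<in> \<S>" "i \<in> W" by blast
    have "W = V" by (rule block_unique[OF assms(1), of _ _ i]) (use W i that(2) assms(2) in auto)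
    then show False using W(1) that(2) by simp
  qed
  fix U V assume UV: "U \<in> \<Q> \<union> (\<sigma> - \<S>)" "V \<in> \<Q> \<union> (\<sigma> - \<S>)" "U \<noteq> V"
  consider "U \<in> \<Q>" "V \<in> \<Q>" | "U \<in> \<Q>" "V \<in> \<sigma> - \<S>" | "V \<in> \<Q>" "U \<in> \<sigma> - \<S>" | "U \<in> \<sigma>" "V \<in> \<sigma>"
    using UV(1,2) by auto
  then show "disjnt U V"
  proof cases
    case 1 then show ?thesis using UV(3) by (rule new)
  next
    case 2 then show ?thesis by (rule mixed)
  next
    case 3 then show ?thesis using mixed disjnt_sym by blast
  next
    case 4 then show ?thesis using UV(3) by (rule old)
  qed
qed

lemma partition_on_two: "X \<inter> Y = {} \<Longrightarrow> X \<noteq> {} \<Longrightarrow> Y \<noteq> {} \<Longrightarrow> partition_on (X \<union> Y) {X, Y}"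
  by (auto simp: partition_on_def disjoint_def)

text \<open>
  Let \<open>A\<close> and \<open>D\<close> be the parts \<open>S\<close> and \<open>T\<close> without
  \<open>x\<close> and \<open>y\<close>. In the skein relation for \<open>A\<close>,
  \<open>{x}\<close>, \<open>{y}\<close>, \<open>D\<close> the term \<open>13|24\<close> is the
  transposed partition and the term \<open>12|34\<close> is \<open>\<sigma>\<close>. The other five
  terms are planar, because only singletons lie between \<open>x\<close> and \<open>y\<close>, and
  differ from \<open>\<sigma>\<close>. Solving for \<open>13|24\<close> gives its planar expansion,
  with coefficient \<open>-1\<close> at \<open>\<sigma>\<close>.
\<close>

lemma swap_coefficient:
  fixes P :: "nat set set \<Rightarrow> nat set set \<Rightarrow> 'a::{idom,ring_char_0}"
  assumes "is_planar_projection_matrix n P" "\<sigma> \<in> planar_partitions n"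
    and S: "S \<in> \<sigma>" "x \<in> S" "S \<noteq> {x}" and T: "T \<in> \<sigma>" "y \<in> T" "T \<noteq> {y}" and "S \<noteq> T"
    and "x < y" and between: "\<And>z. x < z \<Longrightarrow> z < y \<Longrightarrow> {z} \<in> \<sigma>"
  defines "\<tau> \<equiv> {(S - {x}) \<union> {y}, (T - {y}) \<union> {x}} \<union> (\<sigma> - {S, T})"
  shows "\<tau> \<in> node_partitions n" "P \<sigma> \<tau> = -1"
proof -
  note p = planarD[OF assms(2)]
  have uni: "X = Y" if "X \<in> \<sigma>" "Y \<in> \<sigma>" "i \<in> X" "i \<in> Y" for X Y i
    using block_unique[OF p(1) that] .
  have n1: "n \<ge> 1" using blk_subset[OF p(1) S(1)] S(2) by auto
  define A where "A = S - {x}"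
  define D where "D = T - {y}"
  let ?R = "\<sigma> - {S, T}"
  have AD: "A \<noteq> {}" "D \<noteq> {}" "S = A \<union> {x}" "T = {y} \<union> D" "x \<notin> A" "y \<notin> D"
    using S T by (auto simp: A_def D_def)
  have ST: "S \<inter> T = {}" using uni[OF S(1) T(1)] \<open>S \<noteq> T\<close> by blast
  have xT: "x \<notin> T" and yS: "y \<notin> S" using ST S(2) T(2) by blast+
  have AT: "A \<inter> T = {}" and DS: "D \<inter> S = {}" and ADd: "A \<inter> D = {}" using ST AD by blast+
  have gap: "\<not> (x < z \<and> z < y)" if "z \<in> U" "U \<in> \<sigma>" "w \<in> U" "w \<noteq> z" for z w U
  proof
    assume "x < z \<and> z < y"
    then have "{z} \<in> \<sigma>" using between by blast
    then have "U = {z}" using uni[OF that(2) _ that(1), of "{z}"] by simp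
    then show False using that by blast
  qed
  have gapS: "\<not> (x < z \<and> z < y)" if "z \<in> S" for z
  proof (cases "z = x")
    case False
    then show ?thesis using gap[OF that S(1) S(2)] by blast
  qed simp
  have gapT: "\<not> (x < z \<and> z < y)" if "z \<in> T" for z
  proof (cases "z = y")
    case False
    then show ?thesis using gap[OF that T(1) T(2)] by blast
  qed simp
  have nl: "\<not> linked U V" if "U \<in> \<sigma>" "V \<in> \<sigma>" "U \<noteq> V" for U V
    using p(2) that unfolding crossing_iff_linked by blast
  have nlR: "\<not> linked U (S \<union> T)" if U: "U \<in> ?R" for U
  proof
    assume "linked U (S \<union> T)"
    then obtain c1 c2 m1 m2 where l: "c1 \<in> U" "c2 \<in> U" "m1 \<in> S \<union> T" "m2 \<in> S \<union> T" "c1 < m1" "m1 < c2"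
      and o: "m2 < c1 \<or> c2 < m2" by (rule linkedE)
    have US: "U \<in> \<sigma>" "U \<noteq> S" "U \<noteq> T" using U by auto
    have c: "c1 \<noteq> x" "c1 \<noteq> y" "c2 \<noteq> x" "c2 \<noteq> y"
      using uni[OF US(1) S(1)] uni[OF US(1) T(1)] US l(1,2) S(2) T(2) by blast+
    have g: "\<not> (x < c1 \<and> c1 < y)" "\<not> (x < c2 \<and> c2 < y)"
      using gap[OF l(1) US(1) l(2)] gap[OF l(2) US(1) l(1)] l(5,6) by linarith+
    \<comment> \<open>No point of \<open>U\<close> lies between \<open>x\<close> and \<open>y\<close>, so
      \<open>c1\<close> and \<open>c2\<close> do not separate them. They do not separate points of
      \<open>S\<close> or points of \<open>T\<close> either; hence all of \<open>S \<union> T\<close> is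
      on one side.\<close>
    have side: "(c1 < x \<and> x < c2) = (c1 < y \<and> y < c2)" using c g \<open>x < y\<close> by linarith
    have nS: "\<not> linked U S" "\<not> linked U T" using nl US S(1) T(1) by auto
    have K: "\<not> (c1 < i \<and> i < c2 \<and> (j < c1 \<or> c2 < j))" if "i \<in> Z" "j \<in> Z" "Z = S \<or> Z = T" for i j Z
      using linkedI[OF l(1,2) that(1,2)] nS that(3) by blast
    have out: "(j < c1 \<or> c2 < j) \<longleftrightarrow> \<not> (c1 < j \<and> j < c2)" if "j \<in> S \<union> T" for j
    proof -
      have "j \<noteq> c1" "j \<noteq> c2" using that uni[OF US(1) S(1)] uni[OF US(1) T(1)] US l(1,2) by blast+
      then show ?thesis by linarith
    qed
    have same: "(c1 < i \<and> i < c2) = (c1 < j \<and> j < c2)" if "i \<in> Z" "j \<in> Z" "Z = S \<or> Z = T" for i j Z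
      using K[OF that] K[OF that(2,1,3)] out[of i] out[of j] that by blast
    have all: "(c1 < i \<and> i < c2) = (c1 < x \<and> x < c2)" if "i \<in> S \<union> T" for i
      using that same[of i S x] same[of i T y] S(2) T(2) side by blast
    show False using all[OF l(3)] all[OF l(4)] out[OF l(4)] l(5,6) o by blast
  qed
  have part: "partition_on {1..n} ({X, Y} \<union> ?R)" if "X \<union> Y = S \<union> T" "X \<inter> Y = {}" "X \<noteq> {}" "Y \<noteq> {}" for X Y
    using repartition[OF p(1), of "{S, T}" "{X, Y}"] partition_on_two[OF that(2-4)] S(1) T(1) that(1) by simp
  have planar: "{X, Y} \<union> ?R \<in> planar_partitions n"
    if XY: "X \<union> Y = S \<union> T" "X \<inter> Y = {}" "X \<noteq> {}" "Y \<noteq> {}" and nlXY: "\<not> linked X Y" for X Y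
  proof -
    have sub: "X \<subseteq> S \<union> T" "Y \<subseteq> S \<union> T" using XY(1) by blast+
    have "\<not> linked U V" if "U \<in> {X, Y} \<union> ?R" "V \<in> {X, Y} \<union> ?R" "U \<noteq> V" for U V
    proof -
      have 1: "\<not> linked U V" if "U \<in> ?R" "V = X \<or> V = Y" for U V
        using nlR[OF that(1)] linked_mono[of U V U "S \<union> T"] that(2) sub by blast
      have 2: "\<not> linked Y X" using nlXY linked_sym by blast
      show ?thesis
        using that 1[of U V] 1[of V U] linked_sym[of U V] nl[of U V] nlXY 2 by blast
    qed
    then have "\<not> crossing ({X, Y} \<union> ?R)" unfolding crossing_iff_linked by blast
    then show ?thesis using part[OF XY] by (simp add: planar_partitions_def node_partitions_def)
  qed
  have sing: "\<not> linked {i} V" for i V unfolding linked_def by auto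
  have nlST: "\<not> linked S T" "\<not> linked T S" using nl[OF S(1) T(1)] nl[OF T(1) S(1)] \<open>S \<noteq> T\<close> by auto
  have nl\<alpha>: "\<not> linked {x, y} (A \<union> D)"
  proof
    assume "linked {x, y} (A \<union> D)"
    then obtain a1 a2 b1 b2 where l: "a1 \<in> {x, y}" "a2 \<in> {x, y}" "b1 \<in> A \<union> D" "a1 < b1" "b1 < a2" by (rule linkedE)
    then have "x < b1 \<and> b1 < y" using \<open>x < y\<close> by auto
    then show False using gapS[of b1] gapT[of b1] l(3) AD by blast
  qed
  have nl1: "\<not> linked A ({x, y} \<union> D)"
  proof
    assume "linked A ({x, y} \<union> D)"
    then obtain a1 a2 b1 b2 where l: "a1 \<in> A" "a2 \<in> A" "b1 \<in> {x, y} \<union> D" "b2 \<in> {x, y} \<union> D" "a1 < b1" "b1 < a2"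
      and o: "b2 < a1 \<or> a2 < b2" by (rule linkedE)
    \<comment> \<open>No point of \<open>A\<close> distinguishes \<open>x\<close> from its neighbour \<open>y\<close>, so
      that \<open>x\<close> may be moved into \<open>T\<close>.\<close>
    define h where "h b = (if b = x then y else b)" for b
    have hT: "h b \<in> T" if "b \<in> {x, y} \<union> D" for b using that AD(4) by (auto simp: h_def)
    have cmp: "(a < h b) = (a < b)" "(h b < a) = (b < a)" if "a \<in> A" for a b
    proof -
      have "a \<noteq> x" "a \<noteq> y" "\<not> (x < a \<and> a < y)" using that AD(3,5) yS gapS[of a] by blast+
      then show "(a < h b) = (a < b)" "(h b < a) = (b < a)" using \<open>x < y\<close> by (auto simp: h_def)
    qed
    have "linked S T"
      by (rule linkedI[of a1 _ a2 "h b1" _ "h b2"]) (use l o hT AD(3) in \<open>auto simp: cmp\<close>)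
    then show False using nlST by simp
  qed
  have nl4: "\<not> linked D (A \<union> {x} \<union> {y})"
  proof
    assume "linked D (A \<union> {x} \<union> {y})"
    then obtain a1 a2 b1 b2 where l: "a1 \<in> D" "a2 \<in> D" "b1 \<in> A \<union> {x} \<union> {y}" "b2 \<in> A \<union> {x} \<union> {y}" "a1 < b1" "b1 < a2"
      and o: "b2 < a1 \<or> a2 < b2" by (rule linkedE)
    define h where "h b = (if b = y then x else b)" for b
    have hS: "h b \<in> S" if "b \<in> A \<union> {x} \<union> {y}" for b using that AD(3) by (auto simp: h_def)
    have cmp: "(a < h b) = (a < b)" "(h b < a) = (b < a)" if "a \<in> D" for a b
    proof -
      have "a \<noteq> x" "a \<noteq> y" "\<not> (x < a \<and> a < y)" using that AD(4,6) xT gapT[of a] by blast+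
      then show "(a < h b) = (a < b)" "(h b < a) = (b < a)" using \<open>x < y\<close> by (auto simp: h_def)
    qed
    have "linked T S"
      by (rule linkedI[of a1 _ a2 "h b1" _ "h b2"]) (use l o hS AD(4) in \<open>auto simp: cmp\<close>)
    then show False using nlST by simp
  qed
  have xy: "x \<noteq> y" using \<open>x < y\<close> by simp
  let ?q = "\<lambda>X Y. {X, Y} \<union> ?R"
  have \<sigma>: "?q (A \<union> {x}) ({y} \<union> D) = \<sigma>" using S(1) T(1) AD(3,4) by auto
  have \<tau>: "?q (A \<union> {y}) ({x} \<union> D) = \<tau>" unfolding \<tau>_def A_def D_def by auto
  have un: "X \<union> Y = S \<union> T" if "X \<union> Y = A \<union> {x} \<union> {y} \<union> D" for X Y using that AD(3,4) by blast
  have dis: "x \<notin> D" "y \<notin> A" using xT yS AD by blast+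
  have pl\<alpha>: "?q (A \<union> D) ({x} \<union> {y}) \<in> planar_partitions n"
    by (rule planar[OF un]) (use AD dis xy linked_sym[of "A \<union> D" "{x, y}"] nl\<alpha> in \<open>auto simp: insert_commute\<close>)
  have pl1: "?q A ({x} \<union> {y} \<union> D) \<in> planar_partitions n"
    by (rule planar[OF un]) (use AD dis xy ADd nl1 in \<open>auto simp: insert_commute\<close>)
  have pl2: "?q {x} (A \<union> {y} \<union> D) \<in> planar_partitions n"
    by (rule planar[OF un]) (use AD dis xy sing in auto)
  have pl3: "?q {y} (A \<union> {x} \<union> D) \<in> planar_partitions n"
    by (rule planar[OF un]) (use AD dis xy sing in auto)
  have pl4: "?q D (A \<union> {x} \<union> {y}) \<in> planar_partitions n"
    by (rule planar[OF un]) (use AD dis xy ADd nl4 in auto)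
  show \<tau>n: "\<tau> \<in> node_partitions n"
    unfolding \<tau>[symmetric] node_partitions_def mem_Collect_eq
    by (rule part[OF un]) (use AD dis xy ADd in auto)
  have neq: "?q X Y \<noteq> \<sigma>" if "X \<noteq> S" "Y \<noteq> S" for X Y using that S(1) by blast
  have ne: "?q (A \<union> D) ({x} \<union> {y}) \<noteq> \<sigma>" "?q A ({x} \<union> {y} \<union> D) \<noteq> \<sigma>" "?q {x} (A \<union> {y} \<union> D) \<noteq> \<sigma>"
    "?q {y} (A \<union> {x} \<union> D) \<noteq> \<sigma>" "?q D (A \<union> {x} \<union> {y}) \<noteq> \<sigma>"
    by (rule neq; use S T AD DS yS xT in blast)+
  have part4: "partition_on {1..n} ({A, {x}, {y}, D} \<union> ?R)"
  proof -
    have "partition_on (\<Union>{S, T}) {A, {x}, {y}, D}"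
      unfolding partition_on_def disjoint_def using AD dis xy ADd by auto
    then show ?thesis using repartition[OF p(1), of "{S, T}" "{A, {x}, {y}, D}"] S(1) T(1) by simp
  qed
  have dist4: "distinct [A, {x}, {y}, D]"
    using AD dis xy ADd by auto
  have notR: "{A, {x}, {y}, D} \<inter> ?R = {}"
    using uni[OF S(1), of A] uni[OF S(1), of "{x}" x] uni[OF T(1), of "{y}" y] uni[OF T(1), of D] S T AD by blast
  \<comment> \<open>The planar expansion of \<open>\<tau>\<close> given by the skein relation.\<close>
  define d :: "nat set set \<Rightarrow> 'a" where "d \<xi> =
     of_bool (\<xi> = ?q A ({x} \<union> {y} \<union> D)) + of_bool (\<xi> = ?q {x} (A \<union> {y} \<union> D)) +
     of_bool (\<xi> = ?q {y} (A \<union> {x} \<union> D)) + of_bool (\<xi> = ?q D (A \<union> {x} \<union> {y})) -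
     of_bool (\<xi> = \<sigma>) - of_bool (\<xi> = ?q (A \<union> D) ({x} \<union> {y}))" for \<xi>
  have "P \<sigma> \<tau> = d \<sigma>"
  proof (rule projection_unique[OF n1 assms(1) \<tau>n assms(2)])
    fix \<rho> assume \<rho>: "\<rho> \<in> node_partitions n"
    have pick: "(\<Sum>\<xi>\<in>planar_partitions n. of_bool (\<xi> = \<eta>) * of_bool (tree_pair n \<xi> \<rho>)) = (of_bool (tree_pair n \<eta> \<rho>) :: 'a)"
      if "\<eta> \<in> planar_partitions n" for \<eta>
      using that by (simp add: of_bool_def if_distrib[of "\<lambda>z. z * _"] finite_planar cong: if_cong)
    note sk = skein_pairing[OF part4 dist4 notR \<rho>, unfolded \<sigma> \<tau>]
    have "(of_bool (tree_pair n \<tau> \<rho>) :: 'a) = of_int (of_bool (tree_pair n \<tau> \<rho>))" by simp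
    also have "of_bool (tree_pair n \<tau> \<rho>) =
      of_bool (tree_pair n (?q A ({x} \<union> {y} \<union> D)) \<rho>) + of_bool (tree_pair n (?q {x} (A \<union> {y} \<union> D)) \<rho>) +
      of_bool (tree_pair n (?q {y} (A \<union> {x} \<union> D)) \<rho>) + of_bool (tree_pair n (?q D (A \<union> {x} \<union> {y})) \<rho>) -
      of_bool (tree_pair n \<sigma> \<rho>) - (of_bool (tree_pair n (?q (A \<union> D) ({x} \<union> {y})) \<rho>) :: int)"
      using sk by linarith
    finally show "of_bool (tree_pair n \<tau> \<rho>) = (\<Sum>\<xi>\<in>planar_partitions n. d \<xi> * of_bool (tree_pair n \<xi> \<rho>))"
      unfolding d_def left_diff_distrib distrib_right sum.distrib sum_subtractf
        pick[OF pl1] pick[OF pl2] pick[OF pl3] pick[OF pl4] pick[OF pl\<alpha>] pick[OF assms(2)]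
      by (simp only: of_int_add of_int_diff of_int_of_bool)
  qed
  also have "d \<sigma> = -1" using ne by (simp add: d_def eq_commute[of \<sigma>])
  finally show "P \<sigma> \<tau> = -1" .
qed

section \<open>Forests of the complete graph\<close>

lemma complete_edges_subset: "complete_edges n \<subseteq> {1..n} \<times> {1..n}"
  by (auto simp: complete_edges_def)

lemma finite_complete_edges: "finite (complete_edges n)"
  by (rule finite_subset[OF complete_edges_subset]) simp

lemma edge_const_rtrancl:
  assumes "edge_const F f" "(a, b) \<in> (F \<union> F\<inverse>)\<^sup>*"
  shows "f a = f b"
  using assms(2)
proof induction
  case (step b c)
  have "f b = f c" using step(2) assms(1) unfolding edge_const_iff by blast
  with step.IH show ?case by simp
qed simp

text \<open>
  Connects the components in terms of paths with the language of cuts.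
\<close>

lemma components_partition:
  assumes "F \<subseteq> {1..n} \<times> {1..n}"
  shows "partition_on {1..n} (components n F)"
    and "part_const (components n F) f \<longleftrightarrow> edge_const F f"
proof -
  let ?R = "(F \<union> F\<inverse>)\<^sup>*"
  have symR: "sym ?R" by (rule sym_rtrancl) (rule sym_Un_converse)
  have class_sub: "y \<in> {1..n}" if "(x, y) \<in> ?R" "x \<in> {1..n}" for x y
    using that by induction (use assms in auto)
  have "equiv {1..n} (?R \<inter> {1..n} \<times> {1..n})"
  proof (rule equivI)
    show "sym (?R \<inter> {1..n} \<times> {1..n})" using symR by (auto simp: sym_def)
    show "trans (?R \<inter> {1..n} \<times> {1..n})" by (rule transI) (auto intro: rtrancl_trans)
  qed (auto simp: refl_on_def)
  moreover have "{1..n} // (?R \<inter> {1..n} \<times> {1..n}) = components n F"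
    unfolding components_def quotient_def using class_sub by (intro SUP_cong) auto
  ultimately show "partition_on {1..n} (components n F)"
    by (metis partition_on_quotient)
  show "part_const (components n F) f \<longleftrightarrow> edge_const F f"
  proof
    assume f: "part_const (components n F) f"
    show "edge_const F f"
      unfolding edge_const_iff
    proof (intro allI impI)
      fix u v assume uv: "(u, v) \<in> F"
      then have "?R `` {u} \<in> components n F" using assms by (auto simp: components_def quotient_def)
      from part_constD[OF f this] show "f u = f v" using uv by blast
    qed
  next
    assume f: "edge_const F f"
    show "part_const (components n F) f"
      unfolding part_const_def
    proof (intro ballI)
      fix X x y assume "X \<in> components n F" "x \<in> X" "y \<in> X"
      then obtain u where "(u, x) \<in> ?R" "(u, y) \<in> ?R" by (auto simp: components_def quotient_def)
      then show "f x = f y" using edge_const_rtrancl[OF f] by metis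
    qed
  qed
qed

lemma components_eqI:
  assumes "F \<subseteq> {1..n} \<times> {1..n}" "partition_on {1..n} \<tau>" "\<And>f. part_const \<tau> f = edge_const F f"
  shows "components n F = \<tau>"
  by (rule part_const_determines[OF components_partition(1)[OF assms(1)] assms(2)])
    (simp add: components_partition(2)[OF assms(1)] assms(3))

lemma components_eq_edge_part:
  assumes "set es \<subseteq> {1..n} \<times> {1..n}"
  shows "components n (set es) = edge_part {1..n} es"
  by (rule components_eqI[OF assms edge_part_partition[OF assms]]) (rule part_const_edge_part[OF assms])

lemma edge_part_card_ge:
  assumes "finite N" "set es \<subseteq> N \<times> N"
  shows "card N \<le> card (edge_part N es) + length es"
  using assms(2)
proof (induction es)
  case Nil
  then show ?case by (simp add: card_image)
next
  case (Cons e es)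
  have es: "set es \<subseteq> N \<times> N" and e: "fst e \<in> N" "snd e \<in> N" using Cons(2) by auto
  note p = edge_part_partition[OF es]
  show ?case
    using Cons.IH[OF es] merge_card[OF assms(1) p e] merge_same[OF p e(1), of "snd e"]
    by (cases "blk (edge_part N es) (fst e) = blk (edge_part N es) (snd e)") simp_all
qed

lemma components_card_ge:
  assumes "F \<subseteq> complete_edges n"
  shows "n \<le> card F + card (components n F)"
proof -
  have "finite F" using finite_subset[OF assms finite_complete_edges] .
  from finite_distinct_list[OF this] obtain es where es: "set es = F" "distinct es" by blast
  have sub: "set es \<subseteq> {1..n} \<times> {1..n}" using assms complete_edges_subset es(1) by blast
  show ?thesis
    using edge_part_card_ge[OF finite_atLeastAtMost sub] components_eq_edge_part[OF sub] distinct_card[OF es(2)] es(1)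
    by simp
qed

text \<open>
  If removing the edge does not separate its ends, a simple path between them closes up to a cycle.
  The path has at least three nodes, as the edge itself has been removed.
\<close>

lemma redundant_edge_cycle:
  assumes "F \<subseteq> complete_edges n" "(u, v) \<in> F"
    and "\<And>f. edge_const (F - {(u, v)}) f \<Longrightarrow> f u = f v"
  shows "has_cycle F"
proof -
  let ?G = "F - {(u, v)}"
  have uv: "u < v" using assms(1,2) by (auto simp: complete_edges_def)
  have "edge_const ?G (\<lambda>z. (u, z) \<in> (?G \<union> ?G\<inverse>)\<^sup>*)"
    unfolding edge_const_iff by (intro allI impI iffI; erule rtrancl_into_rtrancl) auto
  from assms(3)[OF this] have "(u, v) \<in> (?G \<union> ?G\<inverse>)\<^sup>*" by simp
  then have "(\<lambda>a b. (a, b) \<in> ?G \<union> ?G\<inverse>)\<^sup>*\<^sup>* u v"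
  proof -
    assume "(u, v) \<in> (?G \<union> ?G\<inverse>)\<^sup>*"
    moreover have "{(x, y). (x, y) \<in> S} = S" for S :: "(nat \<times> nat) set" by fast
    ultimately show ?thesis by (simp only: rtranclp_rtrancl_eq)
  qed
  then obtain xs0 where "rtrancl_path (\<lambda>a b. (a, b) \<in> ?G \<union> ?G\<inverse>) u xs0 v"
    unfolding rtranclp_eq_rtrancl_path by blast
  then obtain xs where xs: "rtrancl_path (\<lambda>a b. (a, b) \<in> ?G \<union> ?G\<inverse>) u xs v" and dist: "distinct (u # xs)"
    by (rule rtrancl_path_distinct)
  have ne: "xs \<noteq> []" using xs uv by (auto elim: rtrancl_path.cases)
  have last: "last xs = v" by (rule rtrancl_path_last[OF xs ne])
  have step: "((u # xs) ! k, xs ! k) \<in> ?G \<union> ?G\<inverse>" if "k < length xs" for k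
    using rtrancl_path_nth[OF xs that] .
  have "length xs \<noteq> 1"
  proof
    assume l: "length xs = 1"
    then have "xs ! 0 = v" using last ne by (simp add: last_conv_nth)
    then have "(u, v) \<in> ?G \<union> ?G\<inverse>" using step[of 0] l by simp
    then have "(v, u) \<in> F" by auto
    then show False using assms(1) uv by (auto simp: complete_edges_def)
  qed
  then have len: "2 \<le> length xs" using ne by (cases xs; cases "tl xs") auto
  have "((u # xs) ! k, (u # xs) ! (Suc k mod length (u # xs))) \<in> F \<union> F\<inverse>" if "k < length (u # xs)" for k
  proof (cases "k < length xs")
    case True
    then show ?thesis using step[OF True] by auto
  next
    case False
    then have k: "k = length xs" using that by simp
    have "(u # xs) ! k = v" using k last ne by (simp add: last_conv_nth nth_Cons')
    then show ?thesis using k assms(2) by simp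
  qed
  then show ?thesis unfolding has_cycle_def using dist len by (intro exI[of _ "u # xs"]) simp
qed

text \<open>
  Together with \<open>acyclic_if_card\<close> this replaces the search for cycles by counting: a set
  of edges is a forest iff its number of edges and its number of components add up to
  \<open>n\<close>.
\<close>

lemma forest_card:
  assumes "F \<subseteq> complete_edges n" "\<not> has_cycle F"
  shows "card F + card (components n F) = n"
proof -
  have "finite F" using finite_subset[OF assms(1) finite_complete_edges] .
  from finite_distinct_list[OF this] obtain es where es: "set es = F" "distinct es" by blast
  have sub: "set es \<subseteq> {1..n} \<times> {1..n}" using assms complete_edges_subset es(1) by blast
  from edge_part_card_or_redundant[OF finite_atLeastAtMost sub] show ?thesis
  proof
    assume "card (edge_part {1..n} es) + length es = card {1..n}"
    then show ?thesis using components_eq_edge_part[OF sub] distinct_card[OF es(2)] es(1) by simp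
  next
    assume "\<exists>xs e ys. es = xs @ e # ys \<and> (\<forall>f. edge_const (set (xs @ ys)) f \<longrightarrow> f (fst e) = f (snd e))"
    then obtain xs u v ys where e: "es = xs @ (u, v) # ys" "\<And>f. edge_const (set (xs @ ys)) f \<Longrightarrow> f u = f v"
      by auto
    have "set (xs @ ys) = F - {(u, v)}" using es e(1) by auto
    then have "has_cycle F"
      using e es(1) by (intro redundant_edge_cycle[OF assms(1), of u v]) auto
    then show ?thesis using assms(2) by simp
  qed
qed

text \<open>
  The closing edge of a cycle: along the rest of the cycle a function that is constant on the other
  edges keeps its value.
\<close>

lemma cycle_redundant_edge:
  assumes "F \<subseteq> complete_edges n" "has_cycle F"
  shows "\<exists>u v. (u, v) \<in> F \<and> (\<forall>f. edge_const (F - {(u, v)}) f \<longrightarrow> f u = f v)"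
proof -
  obtain vs where vs: "3 \<le> length vs" "distinct vs"
    and edge: "\<And>k. k < length vs \<Longrightarrow> (vs ! k, vs ! (Suc k mod length vs)) \<in> F \<union> F\<inverse>"
    using assms(2) unfolding has_cycle_def by blast
  let ?L = "length vs - 1"
  have "Suc ?L = length vs" using vs(1) by simp
  then have L: "?L < length vs" "Suc ?L mod length vs = 0" "2 \<le> ?L" using vs(1) by auto
  from edge[OF L(1)] have "(vs ! ?L, vs ! 0) \<in> F \<union> F\<inverse>" using L(2) by simp
  then obtain u v where uv: "(u, v) \<in> F" "{u, v} = {vs ! ?L, vs ! 0}" by auto
  have "f u = f v" if f: "edge_const (F - {(u, v)}) f" for f
  proof -
    have step: "f (vs ! k) = f (vs ! Suc k)" if k: "k < ?L" for k
    proof -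
      have "{vs ! k, vs ! Suc k} \<noteq> {vs ! ?L, vs ! 0}"
      proof -
        have "k < length vs" "Suc k < length vs" "0 < length vs" using k L by linarith+
        then show ?thesis using vs(2) k L(1,3) by (auto simp: doubleton_eq_iff nth_eq_iff_index_eq)
      qed
      then have "(vs ! k, vs ! Suc k) \<noteq> (u, v)" "(vs ! Suc k, vs ! k) \<noteq> (u, v)" using uv(2) by auto
      moreover have "(vs ! k, vs ! Suc k) \<in> F \<union> F\<inverse>" using edge[of k] k by simp
      ultimately have "(vs ! k, vs ! Suc k) \<in> F - {(u, v)} \<or> (vs ! Suc k, vs ! k) \<in> F - {(u, v)}" by blast
      then show ?thesis using f unfolding edge_const_iff by blast
    qed
    have "f (vs ! 0) = f (vs ! k)" if "k \<le> ?L" for k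
      using that by (induction k) (simp_all add: step)
    then have "f (vs ! 0) = f (vs ! ?L)" by blast
    then show ?thesis using uv(2) by (auto simp: doubleton_eq_iff)
  qed
  then show ?thesis using uv(1) by blast
qed

lemma acyclic_if_card:
  assumes "F \<subseteq> complete_edges n" "card F + card (components n F) \<le> n"
  shows "\<not> has_cycle F"
proof
  assume "has_cycle F"
  from cycle_redundant_edge[OF assms(1) this] obtain u v
    where uvr: "(u, v) \<in> F \<and> (\<forall>f. edge_const (F - {(u, v)}) f \<longrightarrow> f u = f v)" by (elim exE)
  note uv = conjunct1[OF uvr]
  have r: "f u = f v" if "edge_const (F - {(u, v)}) f" for f
    by (rule mp[OF spec[OF conjunct2[OF uvr]] that])
  let ?G = "F - {(u, v)}"
  have F: "F \<subseteq> {1..n} \<times> {1..n}" using assms(1) complete_edges_subset by blast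
  have G: "?G \<subseteq> complete_edges n" using assms(1) by blast
  have ins: "F = insert (u, v) ?G" using uv by blast
  have eq: "edge_const F f = edge_const ?G f" for f
  proof -
    have "edge_const F f \<longleftrightarrow> f u = f v \<and> edge_const ?G f"
      by (subst ins) (rule edge_const_Cons)
    then show ?thesis using r[of f] by blast
  qed
  have "components n ?G = components n F"
  proof (rule components_eqI[OF _ components_partition(1)[OF F]])
    show "?G \<subseteq> {1..n} \<times> {1..n}" using F by blast
    show "part_const (components n F) f = edge_const ?G f" for f
      unfolding components_partition(2)[OF F] by (rule eq)
  qed
  moreover have "card F = Suc (card ?G)"
    using card_Suc_Diff1[OF finite_subset[OF assms(1) finite_complete_edges] uv] by (rule sym)
  ultimately show False using components_card_ge[OF G] assms(2) by simp
qed

lemma forests_spanningD: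
  assumes "F \<in> forests_spanning n \<tau>"
  shows "F \<subseteq> complete_edges n" "\<not> has_cycle F" "components n F = \<tau>" "card F + card \<tau> = n"
  using assms forest_card by (auto simp: forests_spanning_def)

lemma forests_spanningI:
  assumes "F \<subseteq> complete_edges n" "partition_on {1..n} \<tau>" "\<And>f. part_const \<tau> f = edge_const F f" "card F + card \<tau> \<le> n"
  shows "F \<in> forests_spanning n \<tau>"
proof -
  have "components n F = \<tau>"
    using assms(1) complete_edges_subset by (intro components_eqI assms(2,3)) blast
  then show ?thesis using acyclic_if_card[OF assms(1)] assms(1,4) by (simp add: forests_spanning_def)
qed

text \<open>
  The representation of the unordered pair \<open>{i, j}\<close> in \<open>complete_edges n\<close>.
\<close>

abbreviation edge :: "nat \<Rightarrow> nat \<Rightarrow> nat \<times> nat" where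
  "edge i j \<equiv> (min i j, max i j)"

lemma edge_commute: "edge i j = edge j i"
  by (simp add: min.commute max.commute)

lemma edge_eq_const: "f (min i j) = f (max i j) \<longleftrightarrow> (f i :: bool) = f j"
  by (auto simp: min_def max_def)

lemma edge_in_complete: "i \<in> {1..n} \<Longrightarrow> j \<in> {1..n} \<Longrightarrow> i \<noteq> j \<Longrightarrow> edge i j \<in> complete_edges n"
  by (auto simp: complete_edges_def min_def max_def)

lemma forest_exists:
  assumes "\<tau> \<in> node_partitions n"
  shows "\<exists>F. F \<in> forests_spanning n \<tau>"
proof -
  have p: "partition_on {1..n} \<tau>" using assms by (simp add: node_partitions_def)
  from exists_forest_list[OF finite_atLeastAtMost p] obtain es
    where es: "set es \<subseteq> {1..n} \<times> {1..n}" "edge_part {1..n} es = \<tau>" "card \<tau> + length es = n" by auto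
  define F where "F = (\<lambda>(i, j). edge i j) ` {e \<in> set es. fst e \<noteq> snd e}"
  have "F \<in> forests_spanning n \<tau>"
  proof (rule forests_spanningI[OF _ p])
    show "F \<subseteq> complete_edges n"
      unfolding F_def using es(1) edge_in_complete[of _ n] by fastforce
    have "card F \<le> card {e \<in> set es. fst e \<noteq> snd e}" unfolding F_def by (rule card_image_le) simp
    also have "\<dots> \<le> card (set es)" by (rule card_mono) auto
    also have "\<dots> \<le> length es" by (rule card_length)
    finally show "card F + card \<tau> \<le> n" using es(3) by simp
    fix f
    have "edge_const F f \<longleftrightarrow> (\<forall>e\<in>set es. fst e \<noteq> snd e \<longrightarrow> f (fst e) = f (snd e))"
      unfolding F_def edge_const_def by (auto simp: edge_eq_const split_beta)
    also have "\<dots> \<longleftrightarrow> edge_const (set es) f"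
      unfolding edge_const_def split_beta by metis
    finally show "part_const \<tau> f = edge_const F f"
      using part_const_edge_part[OF es(1)] es(2) by simp
  qed
  then show ?thesis by blast
qed

lemma forest_no_triangle:
  assumes "F \<in> forests_spanning n \<tau>" "i \<noteq> j" "j \<noteq> k" "i \<noteq> k" "edge i j \<in> F" "edge j k \<in> F" "edge i k \<in> F"
  shows False
proof -
  have "has_cycle F"
    unfolding has_cycle_def
  proof (intro exI[of _ "[i, j, k]"] conjI allI impI)
    fix l assume "l < length [i, j, k]"
    then consider "l = 0" | "l = 1" | "l = 2" by force
    then show "([i, j, k] ! l, [i, j, k] ! (Suc l mod length [i, j, k])) \<in> F \<union> F\<inverse>"
      by cases (use assms(5-7) in \<open>auto simp: min_def max_def split: if_splits\<close>)
  qed (use assms(2-4) in auto)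
  then show False using forests_spanningD(2)[OF assms(1)] by blast
qed

text \<open>
  In the presence of the edge \<open>ij\<close> the equations for \<open>jk\<close> and for
  \<open>ik\<close> are equivalent, so the same partition is spanned by the same number of edges.
\<close>

lemma forest_exchange:
  assumes "F \<in> forests_spanning n \<tau>" "i \<noteq> j" "j \<noteq> k" "i \<noteq> k" "edge i j \<in> F" "edge j k \<in> F"
  shows "insert (edge i k) (F - {edge j k}) \<in> forests_spanning n \<tau>"
proof -
  note F = forests_spanningD[OF assms(1)]
  have FN: "F \<subseteq> {1..n} \<times> {1..n}" using F(1) complete_edges_subset by blast
  have p: "partition_on {1..n} \<tau>" using components_partition(1)[OF FN] F(3) by simp
  have ik: "i \<in> {1..n}" "k \<in> {1..n}" using FN assms(5,6) by (auto simp: min_def max_def split: if_splits)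
  have fin: "finite F" using finite_subset[OF F(1) finite_complete_edges] .
  let ?G = "F - {edge j k}"
  have F_eq: "F = insert (edge j k) ?G" using assms(6) by blast
  have "edge i j \<noteq> edge j k" using assms(2-4) by (auto simp: min_def max_def split: if_splits)
  then have "edge i j \<notin> {edge j k}" by (rule contrapos_nn) (erule singletonD)
  with assms(5) have "edge i j \<in> ?G" by (rule DiffI)
  then have G: "?G = insert (edge i j) ?G" by (rule insert_absorb[symmetric])
  show ?thesis
  proof (rule forests_spanningI[OF _ p])
    show "insert (edge i k) ?G \<subseteq> complete_edges n" using F(1) edge_in_complete[OF ik assms(4)] by blast
    have "card (insert (edge i k) ?G) \<le> Suc (card ?G)" by (rule card_insert_le_m1) auto
    also have "Suc (card ?G) = card F" using card_Suc_Diff1[OF fin assms(6)] .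
    finally show "card (insert (edge i k) ?G) + card \<tau> \<le> n" using F(4) by simp
    fix f
    have "part_const \<tau> f \<longleftrightarrow> edge_const F f" using components_partition(2)[OF FN] F(3) by simp
    also have "\<dots> \<longleftrightarrow> f j = f k \<and> edge_const ?G f"
      by (subst F_eq) (simp only: edge_const_Cons edge_eq_const)
    also have "\<dots> \<longleftrightarrow> f j = f k \<and> f i = f j \<and> edge_const ?G f"
      by (subst G) (simp only: edge_const_Cons edge_eq_const)
    also have "\<dots> \<longleftrightarrow> f i = f k \<and> f i = f j \<and> edge_const ?G f" by blast
    also have "\<dots> \<longleftrightarrow> f i = f k \<and> edge_const ?G f"
      by (subst (2) G) (simp only: edge_const_Cons edge_eq_const)
    finally show "part_const \<tau> f = edge_const (insert (edge i k) ?G) f"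
      by (simp only: edge_const_Cons edge_eq_const)
  qed
qed

section \<open>Products of multivariate polynomials\<close>

type_synonym ('v, 'a) mpoly = "('v \<Rightarrow>\<^sub>0 nat) \<Rightarrow>\<^sub>0 'a"

definition vars :: "('v, 'a::zero) mpoly \<Rightarrow> 'v set" where
  "vars f = (\<Union>m\<in>keys f. keys m)"

lemma keys_mult_E:
  assumes "m \<in> keys (f * g)"
  obtains a b where "a \<in> keys f" "b \<in> keys g" "m = a + b"
  using keys_mult[of f g] assms by blast

text \<open>
  The parts of \<open>f\<close> and \<open>g\<close> of highest degree in the variable
  \<open>v\<close> have a nonzero product, and nothing else contributes to that degree of \<open>f *
  g\<close>. The linear order on the variables is there because it makes the polynomials an integral
  domain.
\<close>

lemma top_exponent_mult:
  fixes f g :: "('v::linorder, 'a::idom) mpoly"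
  assumes "f \<noteq> 0" "g \<noteq> 0" "a0 \<in> keys f" "b0 \<in> keys g"
  shows "\<exists>m\<in>keys (f * g).
    lookup a0 v + lookup b0 v \<le> lookup m v"
proof -
  let ?deg = "\<lambda>f. Max ((\<lambda>m. lookup m v) ` keys f)"
  define top where "top f = Poly_Mapping.mapp (\<lambda>m c. if lookup m v = ?deg f then c else 0) f"
    for f :: "('v, 'a) mpoly"
  have lookup_top: "lookup (top h) m =
      (if lookup m v = ?deg h then lookup h m else 0)" for h m
    by (simp add: top_def lookup_mapp when_def in_keys_iff)
  have deg_ge: "lookup m v \<le> ?deg h" if "m \<in> keys h" for m and h :: "('v, 'a) mpoly"
    using that by (intro Max_ge) auto
  have top_nz: "top h \<noteq> 0" if "h \<noteq> 0" for h
  proof -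
    have "?deg h \<in> (\<lambda>m. lookup m v) ` keys h" using that by (intro Max_in) auto
    then obtain m where m: "m \<in> keys h" "lookup m v = ?deg h" by auto
    then have "lookup (top h) m \<noteq> 0" by (simp add: lookup_top in_keys_iff)
    then show ?thesis by auto
  qed
  have keys_top: "lookup m v = ?deg h" if "m \<in> keys (top h)" for m h
    using that by (auto simp: in_keys_iff lookup_top split: if_splits)
  have keys_rest: "lookup m v < ?deg h" if "m \<in> keys (h - top h)" for m h
  proof -
    have "m \<in> keys h" "lookup m v \<noteq> ?deg h"
      using that by (auto simp: in_keys_iff lookup_minus lookup_top split: if_splits)
    then show ?thesis by (intro le_neq_implies_less deg_ge)
  qed
  have "top f * top g \<noteq> 0" using top_nz assms(1,2) by simp
  then obtain m where m: "m \<in> keys (top f * top g)" by (metis all_not_in_conv keys_eq_empty)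
  have mdeg: "lookup m v = ?deg f + ?deg g"
  proof -
    obtain a b where ab: "a \<in> keys (top f)" "b \<in> keys (top g)" "m = a + b"
      using m by (rule keys_mult_E)
    show ?thesis using keys_top[OF ab(1)] keys_top[OF ab(2)] by (simp add: ab(3) lookup_add)
  qed
  have "f * g = top f * top g + (top f * (g - top g) + (f - top f) * g)" by (simp add: algebra_simps)
  moreover have "m \<notin> keys (top f * (g - top g))"
  proof
    assume "m \<in> keys (top f * (g - top g))"
    then obtain a b where ab: "a \<in> keys (top f)" "b \<in> keys (g - top g)" "m = a + b"
      by (rule keys_mult_E)
    show False using keys_top[OF ab(1)] keys_rest[OF ab(2)] mdeg by (simp add: ab(3) lookup_add)
  qed
  moreover have "m \<notin> keys ((f - top f) * g)"
  proof
    assume "m \<in> keys ((f - top f) * g)"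
    then obtain a b where ab: "a \<in> keys (f - top f)" "b \<in> keys g" "m = a + b"
      by (rule keys_mult_E)
    show False using keys_rest[OF ab(1)] deg_ge[OF ab(2)] mdeg by (simp add: ab(3) lookup_add)
  qed
  ultimately have "lookup (f * g) m = lookup (top f * top g) m"
    by (simp add: lookup_add in_keys_iff)
  then have "m \<in> keys (f * g)" using m by (simp add: in_keys_iff)
  then show ?thesis using mdeg deg_ge[OF assms(3)] deg_ge[OF assms(4)] by (intro bexI[of _ m]) auto
qed

text \<open>
  With disjoint variables, a monomial of the product splits in only one way.
\<close>

lemma lookup_mult_disjoint_vars:
  fixes f g :: "('v, 'a::comm_ring_1) mpoly"
  assumes "vars f \<inter> vars g = {}" "a \<in> keys f" "b \<in> keys g"
  shows "lookup (f * g) (a + b) = lookup f a * lookup g b"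
proof -
  have uniq: "l = a \<and> q = b"
    if "l \<in> keys f" "q \<in> keys g" "l + q = a + b" for l q
  proof -
    have "lookup l v = lookup a v \<and> lookup q v = lookup b v" for v
    proof -
      have sum: "lookup l v + lookup q v = lookup a v + lookup b v"
        using that(3) by (metis lookup_add)
      show ?thesis
      proof (cases "v \<in> vars f")
        case True
        then have "v \<notin> vars g" using assms(1) by blast
        then have "v \<notin> keys q" "v \<notin> keys b"
          using that(2) assms(3) by (auto simp: vars_def)
        then show ?thesis using sum by (simp add: in_keys_iff)
      next
        case False
        then have "v \<notin> keys l" "v \<notin> keys a"
          using that(1) assms(2) by (auto simp: vars_def)
        then show ?thesis using sum by (simp add: in_keys_iff)
      qed
    qed
    then show ?thesis by (auto intro: poly_mapping_eqI)
  qed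
  define c d where "c = lookup f a" and "d = lookup g b"
  define f' g' where "f' = f - Poly_Mapping.single a c" and "g' = g - Poly_Mapping.single b d"
  have f': "l \<in> keys f" "l \<noteq> a" if "l \<in> keys f'" for l
    using that by (auto simp: f'_def c_def in_keys_iff lookup_minus lookup_single when_def split: if_splits)
  have g': "q \<in> keys g" "q \<noteq> b" if "q \<in> keys g'" for q
    using that by (auto simp: g'_def d_def in_keys_iff lookup_minus lookup_single when_def split: if_splits)
  have "f * g = Poly_Mapping.single (a + b) (c * d) + (Poly_Mapping.single a c * g' + f' * g)"
    by (simp add: f'_def g'_def algebra_simps mult_single)
  moreover have "a + b \<notin> keys (Poly_Mapping.single a c * g')"
  proof
    assume "a + b \<in> keys (Poly_Mapping.single a c * g')"
    then obtain l q where lq: "l \<in> keys (Poly_Mapping.single a c)" "q \<in> keys g'" "a + b = l + q"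
      by (rule keys_mult_E)
    have "l = a" using lq(1) by (simp split: if_splits)
    then show False using uniq[of l q] assms(2) g'[OF lq(2)] lq(3) by simp
  qed
  moreover have "a + b \<notin> keys (f' * g)"
  proof
    assume "a + b \<in> keys (f' * g)"
    then obtain l q where lq: "l \<in> keys f'" "q \<in> keys g" "a + b = l + q"
      by (rule keys_mult_E)
    show False using uniq[of l q] f'[OF lq(1)] lq(2,3) by simp
  qed
  ultimately show ?thesis by (simp add: lookup_add in_keys_iff c_def d_def)
qed

text \<open>
  A constant factor divides the coefficient \<open>1\<close>.
\<close>

lemma unit_if_no_vars:
  fixes f g :: "('v, 'a::comm_ring_1) mpoly"
  assumes "vars f = {}" "lookup (f * g) m = 1"
  shows "f dvd 1"
proof -
  define c where "c = lookup f 0"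
  have "keys f \<subseteq> {0}"
  proof
    fix a assume "a \<in> keys f"
    then have "keys a = {}" using assms(1) by (auto simp: vars_def)
    then show "a \<in> {0}" by simp
  qed
  then have f: "f = Poly_Mapping.single 0 c"
    by (intro poly_mapping_eqI) (auto simp: c_def lookup_single when_def in_keys_iff)
  have "m \<in> keys (f * g)" using assms(2) by (simp add: in_keys_iff)
  then obtain a b where ab: "a \<in> keys f" "b \<in> keys g" "m = a + b" by (rule keys_mult_E)
  have "a = 0" using ab(1) f by (auto split: if_splits)
  then have "c * lookup g b = 1"
    using lookup_mult_disjoint_vars[of f g a b] ab assms by (simp add: c_def)
  then have "1 = f * Poly_Mapping.single 0 (lookup g b)"
    by (subst f) (simp add: mult_single)
  then show ?thesis by (rule dvdI)
qed

section \<open>The coefficients of the polynomial\<close>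

definition edge_monomial :: "'v set \<Rightarrow> ('v \<Rightarrow>\<^sub>0 nat)" where
  "edge_monomial F = (\<Sum>e\<in>F. Poly_Mapping.single e 1)"

lemma lookup_edge_monomial: "finite F \<Longrightarrow> lookup (edge_monomial F) e = of_bool (e \<in> F)"
  by (simp add: edge_monomial_def lookup_sum lookup_single when_def)

lemma keys_edge_monomial: "finite F \<Longrightarrow> keys (edge_monomial F) = F"
  by (auto simp: in_keys_iff lookup_edge_monomial)

lemma prod_L_var:
  assumes "F \<subseteq> complete_edges n"
  shows "(\<Prod>(i, j)\<in>F. L_var i j) = Poly_Mapping.single (edge_monomial F) (1 :: 'a::{idom,ring_char_0})"
proof -
  have "finite F" using finite_subset[OF assms finite_complete_edges] .
  then show ?thesis using assms
  proof (induction F)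
    case empty
    then show ?case by (simp add: edge_monomial_def)
  next
    case (insert e F)
    obtain i j where e: "e = (i, j)" by force
    have "i < j" using insert.prems e by (auto simp: complete_edges_def)
    then have "L_var i j = (Poly_Mapping.single (Poly_Mapping.single e 1) 1 :: 'a L_poly)"
      by (simp add: L_var_def e)
    then show ?case using insert by (simp add: e edge_monomial_def mult_single)
  qed
qed

lemma finite_forests: "finite (forests_spanning n \<tau>)"
  by (rule finite_subset[of _ "Pow (complete_edges n)"]) (auto simp: forests_spanning_def finite_complete_edges)

lemma lookup_Pr_poly:
  "lookup (Pr_poly n P \<sigma>) m =
    (\<Sum>\<tau>\<in>node_partitions n. \<Sum>F\<in>forests_spanning n \<tau>. (P \<sigma> \<tau> when edge_monomial F = m))"
proof -
  have "L_const (P \<sigma> \<tau>) * L_partition n \<tau> = (\<Sum>F\<in>forests_spanning n \<tau>. Poly_Mapping.single (edge_monomial F) (P \<sigma> \<tau>))" for \<tau>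
    unfolding L_partition_def L_const_def sum_distrib_left
    by (rule sum.cong) (auto simp: prod_L_var[of _ n] forests_spanning_def mult_single)
  then show ?thesis by (simp add: Pr_poly_def lookup_sum lookup_single)
qed

lemma keys_Pr_poly:
  assumes "m \<in> keys (Pr_poly n P \<sigma>)"
  obtains \<tau> F where "\<tau> \<in> node_partitions n" "F \<in> forests_spanning n \<tau>" "m = edge_monomial F" "P \<sigma> \<tau> \<noteq> 0"
proof -
  have "(\<Sum>\<tau>\<in>node_partitions n. \<Sum>F\<in>forests_spanning n \<tau>. (P \<sigma> \<tau> when edge_monomial F = m)) \<noteq> 0"
    using assms by (simp add: in_keys_iff lookup_Pr_poly)
  then obtain \<tau> where \<tau>: "\<tau> \<in> node_partitions n" "(\<Sum>F\<in>forests_spanning n \<tau>. (P \<sigma> \<tau> when edge_monomial F = m)) \<noteq> 0"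
    by (rule sum.not_neutral_contains_not_neutral)
  from \<tau>(2) obtain F where "F \<in> forests_spanning n \<tau>" "(P \<sigma> \<tau> when edge_monomial F = m) \<noteq> 0"
    by (rule sum.not_neutral_contains_not_neutral)
  then show thesis using that[OF \<tau>(1)] by (auto simp: when_def split: if_splits)
qed

lemma forests_finite: "F \<in> forests_spanning n \<tau> \<Longrightarrow> finite F"
  by (rule finite_subset[OF forests_spanningD(1) finite_complete_edges])

lemma lookup_Pr_poly_forest:
  assumes "\<tau> \<in> node_partitions n" "F \<in> forests_spanning n \<tau>"
  shows "lookup (Pr_poly n P \<sigma>) (edge_monomial F) = P \<sigma> \<tau>"
proof -
  have eq: "G = F \<and> \<tau>' = \<tau>" if "G \<in> forests_spanning n \<tau>'" "edge_monomial G = edge_monomial F" for G \<tau>'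
  proof -
    have "G = keys (edge_monomial G)" by (rule keys_edge_monomial[OF forests_finite[OF that(1)], symmetric])
    also have "\<dots> = F" unfolding that(2) by (rule keys_edge_monomial[OF forests_finite[OF assms(2)]])
    finally have "G = F" .
    moreover from this have "\<tau>' = \<tau>" using forests_spanningD(3)[OF that(1)] forests_spanningD(3)[OF assms(2)] by metis
    ultimately show ?thesis ..
  qed
  have "(\<Sum>G\<in>forests_spanning n \<tau>'. (P \<sigma> \<tau>' when edge_monomial G = edge_monomial F)) = (if \<tau>' = \<tau> then P \<sigma> \<tau> else 0)" for \<tau>'
  proof (cases "\<tau>' = \<tau>")
    case True
    have "(\<Sum>G\<in>forests_spanning n \<tau>. (P \<sigma> \<tau> when edge_monomial G = edge_monomial F)) = (\<Sum>G\<in>forests_spanning n \<tau>. if G = F then P \<sigma> \<tau> else 0)"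
      by (intro sum.cong refl) (use eq in \<open>auto simp only: when_def split: if_splits\<close>)
    then show ?thesis using True assms(2) finite_forests by simp
  next
    case False
    then have "(P \<sigma> \<tau>' when edge_monomial G = edge_monomial F) = 0" if "G \<in> forests_spanning n \<tau>'" for G
      using eq[OF that] by (auto simp only: when_def split: if_splits)
    then show ?thesis using False by (simp add: sum.neutral)
  qed
  then show ?thesis using assms(1) by (simp add: lookup_Pr_poly finite_node_partitions)
qed

section \<open>The support is not a product\<close>

definition support_forests ::
  "nat \<Rightarrow> (nat set set \<Rightarrow> nat set set \<Rightarrow> 'a::zero) \<Rightarrow> nat set set \<Rightarrow> (nat \<times> nat) set set" where
  "support_forests n P \<sigma> = {F. \<exists>\<tau>\<in>node_partitions n. F \<in> forests_spanning n \<tau> \<and> P \<sigma> \<tau> \<noteq> 0}"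

lemma support_forestsE:
  assumes "F \<in> support_forests n P \<sigma>"
  obtains \<tau> where "\<tau> \<in> node_partitions n" "F \<in> forests_spanning n \<tau>" "P \<sigma> \<tau> \<noteq> 0"
  using assms unfolding support_forests_def by blast

lemma support_exchange:
  assumes "F \<in> support_forests n P \<sigma>" "i \<noteq> j" "j \<noteq> k" "i \<noteq> k" "edge i j \<in> F" "edge j k \<in> F"
  shows "insert (edge i k) (F - {edge j k}) \<in> support_forests n P \<sigma>"
  using assms(1) forest_exchange[OF _ assms(2-6)] unfolding support_forests_def by blast

lemma support_no_triangle:
  assumes "F \<in> support_forests n P \<sigma>" "i \<noteq> j" "j \<noteq> k" "i \<noteq> k" "edge i j \<in> F" "edge j k \<in> F" "edge i k \<in> F"
  shows False
proof -
  obtain \<tau> where "F \<in> forests_spanning n \<tau>" using assms(1) unfolding support_forests_def by blast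
  from forest_no_triangle[OF this assms(2-7)] show False .
qed

lemma edge_neq: "i \<noteq> j \<Longrightarrow> j \<noteq> k \<Longrightarrow> i \<noteq> k \<Longrightarrow> edge i j \<noteq> edge j k"
  by (auto simp: min_def max_def split: if_splits)

text \<open>
  Take a forest of the support that contains \<open>ij\<close> and \<open>jk\<close>. If
  \<open>ik\<close> belongs to the first factor, exchange \<open>jk\<close> for \<open>ik\<close>: the
  first factor then contains \<open>ij\<close> and \<open>ik\<close>, and combining it with the old
  second factor gives a triangle. If \<open>ik\<close> belongs to the second factor, exchange
  \<open>ij\<close> for \<open>ik\<close> instead.
\<close>

lemma product_edges_no_common_vertex:
  assumes prod: "\<And>A B. A \<in> \<A> \<Longrightarrow> B \<in> \<B> \<Longrightarrow> A \<union> B \<in> support_forests n P \<sigma>"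
    and dec: "\<And>F. F \<in> support_forests n P \<sigma> \<Longrightarrow> \<exists>A\<in>\<A>. \<exists>B\<in>\<B>. F = A \<union> B"
    and disj: "\<Union>\<A> \<inter> \<Union>\<B> = {}"
    and ij: "edge i j \<in> \<Union>\<A>" "i \<noteq> j" and jk: "edge j k \<in> \<Union>\<B>" "j \<noteq> k"
  shows False
proof -
  have ik: "i \<noteq> k" using ij jk disj edge_commute[of i j] by auto
  obtain A B where A: "A \<in> \<A>" "edge i j \<in> A" and B: "B \<in> \<B>" "edge j k \<in> B" using ij jk by blast
  have F: "A \<union> B \<in> support_forests n P \<sigma>" by (rule prod[OF A(1) B(1)])
  have ne: "edge i j \<noteq> edge j k" by (rule edge_neq[OF ij(2) jk(2) ik])
  have F': "insert (edge i k) (A \<union> B - {edge j k}) \<in> support_forests n P \<sigma>"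
    by (rule support_exchange[OF F ij(2) jk(2) ik]) (use A B in simp_all)
  from dec[OF F'] obtain A' B' where A': "A' \<in> \<A>" "B' \<in> \<B>" "insert (edge i k) (A \<union> B - {edge j k}) = A' \<union> B'"
    by blast
  show False
  proof (cases "edge i k \<in> A'")
    case True
    have "edge i j \<in> A' \<union> B'" unfolding A'(3)[symmetric] using A(2) ne by (intro insertI2 DiffI UnI1) simp_all
    then have "edge i j \<in> A'" using A'(2) ij(1) disj by blast
    show False
      by (rule support_no_triangle[OF prod[OF A'(1) B(1)] ij(2) jk(2) ik])
        (use True \<open>edge i j \<in> A'\<close> B(2) in simp_all)
  next
    case False
    have "edge i k \<in> A' \<union> B'" unfolding A'(3)[symmetric] by (rule insertI1)
    then have ikB: "edge i k \<in> \<Union>\<B>" using False A'(2) by blast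
    have G: "insert (edge k i) (A \<union> B - {edge j i}) \<in> support_forests n P \<sigma>"
      by (rule support_exchange[OF F jk(2)[symmetric] ij(2)[symmetric] ik[symmetric]])
        (unfold edge_commute[of k j] edge_commute[of j i], rule UnI2[OF B(2)], rule UnI1[OF A(2)])
    from dec[OF G] obtain A'' B''
      where A'': "A'' \<in> \<A>" "B'' \<in> \<B>" "insert (edge k i) (A \<union> B - {edge j i}) = A'' \<union> B''"
      by blast
    have "edge k i \<in> A'' \<union> B''" unfolding A''(3)[symmetric] by (rule insertI1)
    then have 1: "edge i k \<in> B''" using ikB A''(1) disj edge_commute[of i k] by auto
    have "edge j k \<noteq> edge j i" using ne edge_commute[of i j] by metis
    then have "edge j k \<in> A'' \<union> B''" unfolding A''(3)[symmetric] using B(2) by (intro insertI2 DiffI UnI2) simp_all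
    then have 2: "edge j k \<in> B''" using A''(1) jk(1) disj by blast
    show False
      by (rule support_no_triangle[OF prod[OF A(1) A''(2)] ij(2) jk(2) ik]) (use 1 2 A(2) in simp_all)
  qed
qed

text \<open>
  The combinatorial core. The colouring of the nodes by membership in \<open>NA\<close>, the nodes
  touched by the first factor, is constant on the parts of every partition in the support; the
  transposition of two nearest nodes of different colours violates this.
\<close>

lemma support_not_product:
  fixes P :: "nat set set \<Rightarrow> nat set set \<Rightarrow> 'a::{idom,ring_char_0}"
  assumes n1: "n \<ge> 1" and proj: "is_planar_projection_matrix n P" and \<sigma>: "\<sigma> \<in> planar_partitions n"
    and prod: "\<And>A B. A \<in> \<A> \<Longrightarrow> B \<in> \<B> \<Longrightarrow> A \<union> B \<in> support_forests n P \<sigma>"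
    and dec: "\<And>F. F \<in> support_forests n P \<sigma> \<Longrightarrow> \<exists>A\<in>\<A>. \<exists>B\<in>\<B>. F = A \<union> B"
    and disj: "\<Union>\<A> \<inter> \<Union>\<B> = {}"
    and ne: "\<Union>\<A> \<noteq> {}" "\<Union>\<B> \<noteq> {}"
  shows False
proof -
  note p = planarD[OF \<sigma>]
  have \<sigma>n: "\<sigma> \<in> node_partitions n" using \<sigma> planar_subset by blast
  obtain F0 where F0: "F0 \<in> forests_spanning n \<sigma>" using forest_exists[OF \<sigma>n] by blast
  have "F0 \<in> support_forests n P \<sigma>"
    using F0 \<sigma>n projection_self[OF n1 proj \<sigma>] by (auto simp: support_forests_def)
  from dec[OF this] obtain A0 B0 where AB0: "A0 \<in> \<A>" "B0 \<in> \<B>" "F0 = A0 \<union> B0" by blast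
  have card: "card F = card F0" "finite F" "F \<subseteq> complete_edges n" if "F \<in> support_forests n P \<sigma>" for F
  proof -
    obtain \<tau> where \<tau>: "\<tau> \<in> node_partitions n" "F \<in> forests_spanning n \<tau>" "P \<sigma> \<tau> \<noteq> 0"
      using \<open>F \<in> support_forests n P \<sigma>\<close> by (rule support_forestsE)
    show "card F = card F0"
      using projection_card[OF n1 proj \<tau>(1) \<sigma> \<tau>(3)] forests_spanningD(4)[OF \<tau>(2)] forests_spanningD(4)[OF F0] by simp
    show "finite F" by (rule forests_finite[OF \<tau>(2)])
    show "F \<subseteq> complete_edges n" by (rule forests_spanningD(1)[OF \<tau>(2)])
  qed
  \<comment> \<open>All forests of the support have as many edges as \<open>F0\<close>, so a factor that contributes no
    edge to \<open>F0\<close> never contributes any.\<close>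
  have no_growth: "Z = {}" if "X \<in> support_forests n P \<sigma>" "X = Z \<union> Y" "Y = F0" "Z \<inter> Y = {}" for X Y Z
  proof -
    note F = card(1,2)[OF that(1), unfolded that(2)]
    have "card (Z \<union> Y) = card Z + card Y" using F(2) that(4) by (intro card_Un_disjoint) auto
    then have "card Z = 0" using F(1) that(3) by simp
    then show ?thesis using F(2) by simp
  qed
  have A0: "A0 \<noteq> {}"
  proof
    assume e: "A0 = {}"
    have "A1 = {}" if "A1 \<in> \<A>" for A1
      by (rule no_growth[OF prod[OF that AB0(2)] refl]; use e AB0 disj that in blast)
    then show False using ne(1) by blast
  qed
  have B0: "B0 \<noteq> {}"
  proof
    assume e: "B0 = {}"
    have "B1 = {}" if "B1 \<in> \<B>" for B1
      by (rule no_growth[OF prod[OF AB0(1) that] Un_commute]; use e AB0 disj that in blast)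
    then show False using ne(2) by blast
  qed
  have comp: "\<Union>\<A> \<subseteq> complete_edges n" "\<Union>\<B> \<subseteq> complete_edges n"
    using card(3)[OF prod[OF _ AB0(2)]] card(3)[OF prod[OF AB0(1)]] by blast+
  \<comment> \<open>The order of the end points matches that in \<open>product_edges_no_common_vertex\<close>.\<close>
  define NA where "NA = {z. \<exists>w. w \<noteq> z \<and> edge w z \<in> \<Union>\<A>}"
  define NB where "NB = {z. \<exists>w. w \<noteq> z \<and> edge z w \<in> \<Union>\<B>}"
  have NAB: "NA \<inter> NB = {}"
  proof (rule ccontr)
    assume "NA \<inter> NB \<noteq> {}"
    then obtain z w w' where e: "edge w z \<in> \<Union>\<A>" "w \<noteq> z" "edge z w' \<in> \<Union>\<B>" "z \<noteq> w'"
      unfolding NA_def NB_def by blast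
    show False by (rule product_edges_no_common_vertex[OF prod dec disj e])
  qed
  have endsA: "u \<in> NA" "v \<in> NA" if "(u, v) \<in> \<Union>\<A>" for u v
  proof -
    have "u < v" using that comp(1) by (auto simp: complete_edges_def)
    then have "edge u v = (u, v)" "edge v u = (u, v)" "u \<noteq> v" by (auto simp: min_def max_def)
    then show "u \<in> NA" "v \<in> NA" using that unfolding NA_def by (metis (mono_tags, lifting) mem_Collect_eq)+
  qed
  have endsB: "u \<in> NB" "v \<in> NB" if "(u, v) \<in> \<Union>\<B>" for u v
  proof -
    have "u < v" using that comp(2) by (auto simp: complete_edges_def)
    then have "edge u v = (u, v)" "edge v u = (u, v)" "u \<noteq> v" by (auto simp: min_def max_def)
    then show "u \<in> NB" "v \<in> NB" using that unfolding NB_def by (metis (mono_tags, lifting) mem_Collect_eq)+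
  qed
  have colour: "part_const \<tau> (\<lambda>z. z \<in> NA)"
    if \<tau>: "\<tau> \<in> node_partitions n" "P \<sigma> \<tau> \<noteq> 0" for \<tau>
  proof -
    obtain F where F: "F \<in> forests_spanning n \<tau>" using forest_exists[OF \<tau>(1)] by blast
    then have "F \<in> support_forests n P \<sigma>" using \<tau> by (auto simp: support_forests_def)
    from dec[OF this] obtain A B where AB: "A \<in> \<A>" "B \<in> \<B>" "F = A \<union> B" by blast
    have "edge_const F (\<lambda>z. z \<in> NA)"
      unfolding edge_const_iff
    proof (intro allI impI)
      fix u v assume "(u, v) \<in> F"
      then consider "(u, v) \<in> \<Union>\<A>" | "(u, v) \<in> \<Union>\<B>" using AB by blast
      then show "(u \<in> NA) = (v \<in> NA)"
      proof cases
        case 1 then show ?thesis using endsA by simp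
      next
        case 2 then show ?thesis using endsB[OF 2] NAB by blast
      qed
    qed
    moreover have "F \<subseteq> {1..n} \<times> {1..n}" using forests_spanningD(1)[OF F] complete_edges_subset by blast
    ultimately show ?thesis using components_partition(2)[of F n] forests_spanningD(3)[OF F] by simp
  qed
  have F0N: "F0 \<subseteq> {1..n} \<times> {1..n}" using forests_spanningD(1)[OF F0] complete_edges_subset by blast
  have \<sigma>_const: "part_const \<sigma> f \<longleftrightarrow> edge_const F0 f" for f
    using components_partition(2)[OF F0N] forests_spanningD(3)[OF F0] by simp
  have not_single: "{u} \<notin> \<sigma>" "{v} \<notin> \<sigma>" "u \<in> {1..n}" "v \<in> {1..n}" if "(u, v) \<in> F0" for u v
  proof -
    have "u < v" using that forests_spanningD(1)[OF F0] by (auto simp: complete_edges_def)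
    have "{w} \<notin> \<sigma>" if w: "w = u \<or> w = v" for w
    proof
      assume "{w} \<in> \<sigma>"
      then have "edge_const F0 (\<lambda>z. z \<in> {w})" using part_const_block[OF p(1)] \<sigma>_const by blast
      then have "(u \<in> {w}) = (v \<in> {w})" using \<open>(u, v) \<in> F0\<close> unfolding edge_const_iff by blast
      then show False using \<open>u < v\<close> w by auto
    qed
    then show "{u} \<notin> \<sigma>" "{v} \<notin> \<sigma>" by blast+
    show "u \<in> {1..n}" "v \<in> {1..n}" using that F0N by auto
  qed
  have covered: "z \<in> NA \<or> z \<in> NB" if z: "z \<in> {1..n}" "{z} \<notin> \<sigma>" for z
  proof (rule ccontr)
    assume nz: "\<not> (z \<in> NA \<or> z \<in> NB)"
    have "edge_const F0 (\<lambda>w. w \<in> {z})"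
      unfolding edge_const_iff
    proof (intro allI impI)
      fix u v assume "(u, v) \<in> F0"
      then have "(u, v) \<in> \<Union>\<A> \<or> (u, v) \<in> \<Union>\<B>" using AB0 by blast
      then have "u \<noteq> z" "v \<noteq> z" using endsA endsB nz by blast+
      then show "(u \<in> {z}) = (v \<in> {z})" by simp
    qed
    then have c: "part_const \<sigma> (\<lambda>w. w \<in> {z})" by (simp only: \<sigma>_const)
    note b = blk_mem[OF p(1) z(1)]
    have "w = z" if "w \<in> blk \<sigma> z" for w
      using part_constD[OF c b(1,2) that] by simp
    then have "blk \<sigma> z = {z}" using b(2) by blast
    then show False using b(1) z(2) by simp
  qed
  define XA where "XA = {z \<in> {1..n}. {z} \<notin> \<sigma> \<and> z \<in> NA}"
  define XB where "XB = {z \<in> {1..n}. {z} \<notin> \<sigma> \<and> z \<in> NB}"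
  have "XA \<noteq> {}"
  proof -
    obtain u v where "(u, v) \<in> A0" using A0 by auto
    then have "u \<in> XA" using AB0 endsA[of u v] not_single[of u v] unfolding XA_def by blast
    then show ?thesis by blast
  qed
  moreover have "XB \<noteq> {}"
  proof -
    obtain u v where "(u, v) \<in> B0" using B0 by auto
    then have "u \<in> XB" using AB0 endsB[of u v] not_single[of u v] unfolding XB_def by blast
    then show ?thesis by blast
  qed
  ultimately obtain q0 where "q0 \<in> XA \<times> XB" by auto
  \<comment> \<open>Nodes between two nearest ones of different colours form singleton parts of \<open>\<sigma>\<close>:
    every other node has a colour and would give a closer pair.\<close>
  define dist where "dist q = max (fst q) (snd q) - min (fst q) (snd q)" for q :: "nat \<times> nat"
  obtain q where q: "q \<in> XA \<times> XB" and min_q: "\<And>q'. q' \<in> XA \<times> XB \<Longrightarrow> dist q \<le> dist q'"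
    using ex_has_least_nat[of "\<lambda>q. q \<in> XA \<times> XB" q0 dist] \<open>q0 \<in> XA \<times> XB\<close> by blast
  obtain x y where xy: "q = (x, y)" by force
  have x: "x \<in> {1..n}" "{x} \<notin> \<sigma>" "x \<in> NA" and y: "y \<in> {1..n}" "{y} \<notin> \<sigma>" "y \<in> NB"
    using q xy by (auto simp: XA_def XB_def)
  have yNA: "y \<notin> NA" using y(3) NAB by blast
  have between: "{z} \<in> \<sigma>" if z: "min x y < z" "z < max x y" for z
  proof (rule ccontr)
    assume nz: "{z} \<notin> \<sigma>"
    have zn: "z \<in> {1..n}" using z x(1) y(1) by (auto simp: min_def max_def split: if_splits)
    from covered[OF zn nz] show False
    proof
      assume "z \<in> NA"
      then have "(z, y) \<in> XA \<times> XB" using zn nz y by (auto simp: XA_def XB_def)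
      from min_q[OF this] show False using z by (auto simp: dist_def xy min_def max_def split: if_splits)
    next
      assume "z \<in> NB"
      then have "(x, z) \<in> XA \<times> XB" using zn nz x by (auto simp: XA_def XB_def)
      from min_q[OF this] show False using z by (auto simp: dist_def xy min_def max_def split: if_splits)
    qed
  qed
  let ?S = "blk \<sigma> x" and ?T = "blk \<sigma> y"
  note S = blk_mem[OF p(1) x(1)] and T = blk_mem[OF p(1) y(1)]
  have c\<sigma>: "part_const \<sigma> (\<lambda>z. z \<in> NA)" by (rule colour[OF \<sigma>n]) (simp add: projection_self[OF n1 proj \<sigma>])
  have ST: "?S \<noteq> ?T" using part_constD[OF c\<sigma> S, of y] T(2) x(3) yNA by auto
  have Sx: "?S \<noteq> {x}" using S(1) x(2) by auto
  have Ty: "?T \<noteq> {y}" using T(1) y(2) by auto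
  define \<tau> where "\<tau> = {(?S - {x}) \<union> {y}, (?T - {y}) \<union> {x}} \<union> (\<sigma> - {?S, ?T})"
  have "\<tau> \<in> node_partitions n \<and> P \<sigma> \<tau> = - 1"
  proof (cases "x < y")
    case True
    then have "min x y = x" "max x y = y" by auto
    then have bt: "{z} \<in> \<sigma>" if "x < z" "z < y" for z using between that by simp
    show ?thesis unfolding \<tau>_def
      using swap_coefficient[OF proj \<sigma> S Sx T Ty ST True bt] by simp
  next
    case False
    then have yx: "y < x" using x(3) yNA by (metis linorder_neqE_nat)
    then have "min x y = y" "max x y = x" by auto
    then have bt: "{z} \<in> \<sigma>" if "y < z" "z < x" for z using between that by simp
    have "\<tau> = {(?T - {y}) \<union> {x}, (?S - {x}) \<union> {y}} \<union> (\<sigma> - {?T, ?S})"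
      unfolding \<tau>_def by (simp only: insert_commute)
    then show ?thesis
      using swap_coefficient[OF proj \<sigma> T Ty S Sx ST[symmetric] yx bt] by simp
  qed
  then have c\<tau>: "part_const \<tau> (\<lambda>z. z \<in> NA)" by (intro colour) auto
  obtain s where s: "s \<in> ?S" "s \<noteq> x" using Sx S(2) by blast
  have "s \<in> NA" using part_constD[OF c\<sigma> S s(1)] x(3) by simp
  moreover have "(?S - {x}) \<union> {y} \<in> \<tau>" unfolding \<tau>_def by blast
  from part_constD[OF c\<tau> this, of s y] have "(s \<in> NA) = (y \<in> NA)" using s by simp
  ultimately show False using yNA by simp
qed

section \<open>Irreducibility\<close>

theorem theorem5p1:
  fixes n :: nat
    and P :: "nat set set \<Rightarrow> nat set set \<Rightarrow> 'a::{idom,ring_char_0}"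
    and \<sigma> :: "nat set set"
  assumes "is_planar_projection_matrix n P"
    and "\<sigma> \<in> planar_partitions n"
    and "\<sigma> \<noteq> singletons_partition n"
  shows "irreducible (Pr_poly n P \<sigma>)"
proof -
  note p = planarD(1)[OF assms(2)]
  have n1: "n \<ge> 1"
  proof (rule ccontr)
    assume "\<not> n \<ge> 1"
    then have "n = 0" by simp
    then show False using p assms(3) by (simp add: partition_on_empty singletons_partition_def)
  qed
  have \<sigma>n: "\<sigma> \<in> node_partitions n" using assms(2) planar_subset by blast
  obtain F0 where F0: "F0 \<in> forests_spanning n \<sigma>" using forest_exists[OF \<sigma>n] by blast
  have fin0: "finite F0" by (rule forests_finite[OF F0])
  let ?p = "Pr_poly n P \<sigma>"
  have lookup0: "lookup ?p (edge_monomial F0) = 1"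
    using lookup_Pr_poly_forest[OF \<sigma>n F0, of P \<sigma>] projection_self[OF n1 assms(1,2)] by simp
  then have key0: "edge_monomial F0 \<in> keys ?p" by (simp add: in_keys_iff)
  have "F0 \<noteq> {}"
  proof
    assume "F0 = {}"
    then have "components n {} = \<sigma>" using forests_spanningD(3)[OF F0] by simp
    moreover have "components n {} = singletons_partition n"
      by (rule components_eqI) (auto simp: singletons_partition_def part_const_def intro: partition_on_singletons)
    ultimately show False using assms(3) by simp
  qed
  then obtain e0 where e0: "e0 \<in> F0" by blast
  have p0: "?p \<noteq> 0" using key0 by auto
  have exp1: "lookup m e \<le> 1" if "m \<in> keys ?p" for m e
    using that by (rule keys_Pr_poly) (simp add: lookup_edge_monomial forests_finite)
  have support: "F \<in> support_forests n P \<sigma> \<longleftrightarrow> finite F \<and> edge_monomial F \<in> keys ?p" for F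
  proof
    assume "F \<in> support_forests n P \<sigma>"
    then show "finite F \<and> edge_monomial F \<in> keys ?p"
      unfolding support_forests_def in_keys_iff using lookup_Pr_poly_forest[of _ n F P \<sigma>] forests_finite by auto
  next
    assume F: "finite F \<and> edge_monomial F \<in> keys ?p"
    then obtain \<tau> G where G: "\<tau> \<in> node_partitions n" "G \<in> forests_spanning n \<tau>" "edge_monomial F = edge_monomial G" "P \<sigma> \<tau> \<noteq> 0"
      using keys_Pr_poly by blast
    have "F = G" using arg_cong[OF G(3), of keys] F forests_finite[OF G(2)] by (simp add: keys_edge_monomial)
    then show "F \<in> support_forests n P \<sigma>" using G by (auto simp: support_forests_def)
  qed
  have monomial: "m = edge_monomial (keys m)" if "m \<in> keys ?p" for m
    using that by (rule keys_Pr_poly) (simp add: keys_edge_monomial forests_finite)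
  show ?thesis
    unfolding irreducible_def
  proof (intro conjI allI impI notI)
    show False if "?p = 0" using that p0 by simp
  next
    assume "?p dvd 1"
    then obtain h where h: "1 = ?p * h" by (rule dvdE)
    then have "h \<noteq> 0" by auto
    then obtain b where b: "b \<in> keys h" by (metis all_not_in_conv keys_eq_empty)
    from top_exponent_mult[OF p0 \<open>h \<noteq> 0\<close> key0 b, of e0] obtain m
      where m: "m \<in> keys (?p * h)" "lookup m e0 \<ge> 1"
      using e0 by (auto simp: lookup_edge_monomial[OF fin0])
    from m(1) have "m = 0" unfolding h[symmetric] by simp
    then show False using m(2) by simp
  next
    fix f g assume fg: "?p = f * g"
    have fg0: "f \<noteq> 0" "g \<noteq> 0" using fg p0 by auto
    have disj: "vars f \<inter> vars g = {}"
    proof (rule ccontr)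
      assume "vars f \<inter> vars g \<noteq> {}"
      then obtain e a b where ab: "a \<in> keys f" "b \<in> keys g"
        "e \<in> keys a" "e \<in> keys b" by (auto simp: vars_def)
      from top_exponent_mult[OF fg0 ab(1,2), of e] obtain m
        where m: "m \<in> keys ?p" "lookup a e + lookup b e \<le> lookup m e"
        unfolding fg by blast
      then show False using exp1[OF m(1), of e] ab(3,4) by (simp add: in_keys_iff)
    qed
    show "f dvd 1 \<or> g dvd 1"
    proof (rule ccontr)
      assume nu: "\<not> (f dvd 1 \<or> g dvd 1)"
      have vf: "vars f \<noteq> {}" using unit_if_no_vars[of f g] lookup0 nu unfolding fg by blast
      have vg: "vars g \<noteq> {}" using unit_if_no_vars[of g f] lookup0 nu unfolding fg mult.commute[of g f] by blast
      let ?\<A> = "keys ` keys f" and ?\<B> = "keys ` keys g"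
      have U: "\<Union>?\<A> = vars f" "\<Union>?\<B> = vars g" by (simp_all add: vars_def)
      have keys_add: "keys (a + b) = keys a \<union> keys b"
        for a b :: "(nat \<times> nat) \<Rightarrow>\<^sub>0 nat"
        by (auto simp: in_keys_iff lookup_add)
      show False
      proof (rule support_not_product[OF n1 assms(1,2), of ?\<A> ?\<B>])
        fix A B assume "A \<in> ?\<A>" "B \<in> ?\<B>"
        then obtain a b where ab: "a \<in> keys f" "b \<in> keys g"
          "A = keys a" "B = keys b" by blast
        have "lookup ?p (a + b) \<noteq> 0"
          unfolding fg lookup_mult_disjoint_vars[OF disj ab(1,2)] using ab(1,2) by (simp add: in_keys_iff)
        then have "a + b \<in> keys ?p" by (simp add: in_keys_iff)
        then have "edge_monomial (keys (a + b)) \<in> keys ?p" using monomial by metis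
        then show "A \<union> B \<in> support_forests n P \<sigma>" by (simp add: support keys_add ab(3,4))
      next
        fix F assume "F \<in> support_forests n P \<sigma>"
        then have F: "finite F" "edge_monomial F \<in> keys (f * g)" using support fg by auto
        from F(2) obtain a b where "a \<in> keys f" "b \<in> keys g" "edge_monomial F = a + b"
          by (rule keys_mult_E)
        then show "\<exists>A\<in>?\<A>. \<exists>B\<in>?\<B>. F = A \<union> B"
          using keys_edge_monomial[OF F(1)] keys_add[of a b] by auto
      qed (use disj vf vg U in auto)
    qed
  qed
qed

end
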